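(* Let $\theta\in(0,1)$ be irrational with $w(\theta)=w>1$. If $w<\infty$, then $$\frac{w/\tau-1}{w^2-1}\le\dim_H\mathcal U_\tau[\theta]\le\frac{1/\tau+1}{w+1}\quad\text{for }\tfrac1w\le\tau\le1,$$ $$0\le\dim_H\mathcal U_\tau[\theta]\le\frac{w/\tau-1}{w^2-1}\quad\text{for }1<\tau\le w.$$ Moreover, if $w(\theta)=\infty$, then $\dim_H\mathcal U_\tau[\theta]=0$ for all $\tau>0$.
   Context: $\mathbb T=\mathbb R/\mathbb Z$; points identified with fractional parts. $\|t\|$ is the distance from $t$ to the nearest integer. For irrational $\theta$, $w(\theta)=\sup\{s>0:\liminf_{j\to\infty}j^s\|j\theta\|=0\}$. For $\tau>0$, $\mathcal U_\tau[\theta]$ is the set of $y\in\mathbb T$ such that there exists $Q_0$ with: for every real $Q\ge Q_0$ there is an integer $1\le n\le Q$ with $\|n\theta-y\|<Q^{-\tau}$. *)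

theory Defs
  imports "HOL-Analysis.Analysis"
begin

definition dist_int :: "real \<Rightarrow> real" where
  "dist_int t = \<bar>t - of_int (round t)\<bar>"

definition irr_exponent :: "real \<Rightarrow> ereal" where
  "irr_exponent \<theta> = Sup (ereal ` {s::real. s > 0 \<and>
      liminf (\<lambda>j::nat. ereal (real j powr s * dist_int (real j * \<theta>))) = 0})"

text \<open>The uniform approximation set U_tau[theta]; points of the torus are represented
  by their fractional parts in [0,1).\<close>
definition unif_set :: "real \<Rightarrow> real \<Rightarrow> real set" where
  "unif_set \<tau> \<theta> = {y \<in> {0..<1}. \<exists>Q0::real. \<forall>Q::real. Q \<ge> Q0 \<longrightarrow>
      (\<exists>n::nat. 1 \<le> n \<and> real n \<le> Q \<and> dist_int (real n * \<theta> - y) < Q powr (- \<tau>))}"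

definition hausdorff_pre :: "real \<Rightarrow> real \<Rightarrow> 'a::metric_space set \<Rightarrow> ennreal" where
  "hausdorff_pre s \<delta> E = (INF U \<in> {U :: nat \<Rightarrow> 'a set. E \<subseteq> (\<Union>i. U i) \<and>
        (\<forall>i. bounded (U i) \<and> diameter (U i) \<le> \<delta>)}.
      (\<Sum>i. ennreal (diameter (U i) powr s)))"

definition hausdorff_measure :: "real \<Rightarrow> 'a::metric_space set \<Rightarrow> ennreal" where
  "hausdorff_measure s E = (SUP \<delta> \<in> {0<..}. hausdorff_pre s \<delta> E)"

definition hausdorff_dim :: "'a::metric_space set \<Rightarrow> real" where
  "hausdorff_dim E = Inf {s::real. s > 0 \<and> hausdorff_measure s E = 0}"

end

theory Submission
  imports Defs
begin

text \<open>Write \<open>q < q'\<close> for consecutive denominators of \<open>\<theta>\<close>. The points \<open>n\<theta>\<close>, \<open>n \<le> X\<close>, form \<open>q\<close> clusters of length about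
  \<open>X/(qq')\<close>, so \<open>X\<^sup>1\<^sup>+\<^sup>\<tau> = qq'\<close> is the optimal scale: there the set is covered by \<open>q\<close> arcs of length \<open>2X\<^sup>-\<^sup>\<tau>\<close>.
  With \<open>q' \<approx> q\<^sup>w\<close> this gives the bound \<open>(1/\<tau>+1)/(w+1)\<close>. For \<open>\<tau> > 1\<close> only few of the \<open>q\<close> clusters survive the
  conditions at earlier scales, about \<open>q\<^sup>\<nu>\<close> with \<open>\<nu> = (w-\<tau>)/((1+\<tau>)(w-1))\<close>, which improves the bound.

  For the lower bound a tree of arcs between orbit points is built on which the conditions hold and
  on which the weight \<open>length\<^sup>\<nu>\<close> of an arc is at most the total weight of its children. Distributing mass
  along the tree gives at most \<open>min(d\<^sup>\<nu>, r d'\<^sup>\<nu>\<^sup>-\<^sup>1)\<close> to an interval of length \<open>r\<close> between \<open>d' \<approx> 1/q'\<close> and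
  \<open>d \<approx> 1/q\<close>, which is \<open>O(r\<^sup>s)\<close> for \<open>s \<le> \<nu>/(\<nu>+w(1-\<nu>)) = (w/\<tau>-1)/(w\<^sup>2-1)\<close>.\<close>

section \<open>Covers and mass distributions\<close>

text \<open>The relation between \<open>q'\<close> and \<open>q^w\<close> is approached only at some
  stages; at others \<open>q'\<close> may be much smaller. An upper bound can pick its stages, since
  good covers are wanted only infinitely often. The lower bound has to pass through every stage.
  Therefore \<open>\<nu>\<close> is chosen such that the weight \<open>length^\<nu>\<close> can be
  preserved for every \<open>q'\<close> up to about \<open>q^w\<close>; one local inequality per
  stage then replaces all counting of arcs, whatever the partial quotients are. As \<open>w\<close>
  is known only through the inequalities on either side of it, auxiliary exponents
  \<open>\<sigma> < w < u < v\<close> are used. In the lower bound the gap between \<open>u\<close>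
  and \<open>v\<close> yields a small power of \<open>q\<close> that absorbs constants. This power
  is proportional to \<open>1 - \<tau>\<close>. At \<open>\<tau> = 1\<close>, where
  \<open>\<nu> = 1/2\<close> for every \<open>w\<close>, it disappears, and the inequality must hold
  with exact constants at every stage; this is the reason for the separate integer problem for the
  number of kept children.\<close>

lemma hausdorff_measure_eq_0I:
  fixes E :: "'a::metric_space set"
  assumes s: "s > 0"
    and cov: "\<And>\<epsilon>. \<epsilon> > 0 \<Longrightarrow> \<exists>U::nat \<Rightarrow> 'a set. E \<subseteq> (\<Union>i. U i) \<and> (\<forall>i. bounded (U i)) \<and>
        (\<Sum>i. ennreal (diameter (U i) powr s)) \<le> ennreal \<epsilon>"
  shows "hausdorff_measure s E = 0"
proof -
  have pre: "hausdorff_pre s \<delta> E \<le> ennreal e" if d: "\<delta> > 0" and e: "e > 0" for \<delta> e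
  proof -
    \<comment> \<open>Every summand is at most the whole sum, so a sum of at most
      \<open>\<delta> powr s\<close> already forces all diameters to be at most
      \<open>\<delta>\<close>.\<close>
    define \<epsilon> where "\<epsilon> = min e (\<delta> powr s)"
    have "\<epsilon> > 0" using d e by (simp add: \<epsilon>_def)
    from cov[OF this] obtain U :: "nat \<Rightarrow> 'a set" where U: "E \<subseteq> (\<Union>i. U i)" "\<And>i. bounded (U i)"
      "(\<Sum>i. ennreal (diameter (U i) powr s)) \<le> ennreal \<epsilon>" by blast
    have "diameter (U i) \<le> \<delta>" for i
    proof -
      have "ennreal (diameter (U i) powr s) \<le> (\<Sum>i. ennreal (diameter (U i) powr s))"
        using sum_le_suminf[OF summableI, of "{i}" "\<lambda>i. ennreal (diameter (U i) powr s)"]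
        by (simp only: finite.intros sum.insert finite.emptyI empty_iff sum.empty add_0_right zero_le simp_thms if_True)
      also have "\<dots> \<le> ennreal (\<delta> powr s)"
        using U(3) by (rule order_trans) (simp add: \<epsilon>_def ennreal_leI)
      finally have "diameter (U i) powr s \<le> \<delta> powr s" by simp
      then show ?thesis
        using powr_less_mono2[of s \<delta> "diameter (U i)"] s d by (meson less_imp_le not_le)
    qed
    with U(1,2) have "hausdorff_pre s \<delta> E \<le> (\<Sum>i. ennreal (diameter (U i) powr s))"
      unfolding hausdorff_pre_def by (intro INF_lower) auto
    also have "\<dots> \<le> ennreal e"
      using U(3) by (rule order_trans) (simp add: \<epsilon>_def ennreal_leI)
    finally show ?thesis .
  qed
  then have "hausdorff_pre s \<delta> E = 0" if "\<delta> > 0" for \<delta>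
  proof -
    have "hausdorff_pre s \<delta> E \<le> 0"
      by (rule ennreal_le_epsilon) (use that pre in simp)
    then show ?thesis by simp
  qed
  then show ?thesis by (simp add: hausdorff_measure_def)
qed

lemma hausdorff_measure_eq_0_imp_cover:
  fixes E :: "'a::metric_space set"
  assumes "hausdorff_measure s E = 0" "\<epsilon> > 0"
  obtains U :: "nat \<Rightarrow> 'a set" where "E \<subseteq> (\<Union>i. U i)" "\<And>i. bounded (U i)"
    "(\<Sum>i. ennreal (diameter (U i) powr s)) < ennreal \<epsilon>"
proof -
  have "hausdorff_pre s 1 E \<le> hausdorff_measure s E"
    unfolding hausdorff_measure_def by (rule SUP_upper) simp
  then have "hausdorff_pre s 1 E < ennreal \<epsilon>" using assms by simp
  then show ?thesis
    unfolding hausdorff_pre_def INF_less_iff using that by blast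
qed

lemma hausdorff_measure_UN_eq_0I:
  fixes E :: "nat \<Rightarrow> real set"
  assumes s: "s > 0"
    and cov: "\<And>K \<epsilon>. \<epsilon> > 0 \<Longrightarrow> \<exists>C r. finite C \<and> r \<ge> 0 \<and> real (card C) * r powr s \<le> \<epsilon> \<and>
        E K \<subseteq> (\<Union>c\<in>C. cball c r)"
  shows "hausdorff_measure s (\<Union>K. E K) = 0"
proof (rule hausdorff_measure_eq_0I[OF s])
  fix \<epsilon> :: real assume e: "\<epsilon> > 0"
  \<comment> \<open>The factor \<open>2 powr s\<close> pays for the diameter \<open>2 * r\<close> of
    a ball of radius \<open>r\<close>; the powers of 1/2 share \<open>\<epsilon>\<close> among the
    pieces \<open>E K\<close>.\<close>
  define \<eta> where "\<eta> K = \<epsilon> / 2 powr s * (1/2) ^ Suc K" for K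
  have "\<eta> K > 0" for K using e by (simp add: \<eta>_def)
  then have "\<exists>C r. finite C \<and> r \<ge> 0 \<and> real (card C) * r powr s \<le> \<eta> K \<and> E K \<subseteq> (\<Union>c\<in>C. cball c r)" for K
    using cov by blast
  then obtain C r where C: "\<And>K. finite (C K)" "\<And>K. r K \<ge> 0"
    "\<And>K. real (card (C K)) * r K powr s \<le> \<eta> K" "\<And>K. E K \<subseteq> (\<Union>c\<in>C K. cball c (r K))"
    by metis
  have "\<exists>h. bij_betw h {..<card (C K)} (C K)" for K
    using C(1) ex_bij_betw_nat_finite[of "C K"] by (auto simp: atLeast0LessThan)
  then obtain h where h: "\<And>K. bij_betw (h K) {..<card (C K)} (C K)" by metis
  \<comment> \<open>Padding with empty sets, which contribute \<open>0 powr s = 0\<close>, turns the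
    finite covers into sequences, and \<open>prod_decode\<close> merges these into a single
    one.\<close>
  define V where "V = (\<lambda>(K, j). if j < card (C K) then cball (h K j) (r K) else {})"
  have sub: "(\<Union>K. E K) \<subseteq> (\<Union>i. V (prod_decode i))"
  proof
    fix y assume "y \<in> (\<Union>K. E K)"
    then obtain K c where "c \<in> C K" "y \<in> cball c (r K)" using C(4) by blast
    then obtain j where "j < card (C K)" "y \<in> cball (h K j) (r K)"
      using h[of K] by (metis bij_betw_iff_bijections lessThan_iff)
    then have "y \<in> V (prod_decode (prod_encode (K, j)))" by (simp add: V_def)
    then show "y \<in> (\<Union>i. V (prod_decode i))" by blast
  qed
  have diam: "ennreal (diameter (V (K, j)) powr s) = (if j < card (C K) then ennreal ((2 * r K) powr s) else 0)" for K j
    using C(2)[of K] s by (simp add: V_def)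
  have "(\<Sum>i. ennreal (diameter (V (prod_decode i)) powr s)) = (\<Sum>K. \<Sum>j. ennreal (diameter (V (K, j)) powr s))"
    by (rule suminf_ennreal_2dimen) simp
  also have "\<dots> \<le> (\<Sum>K. ennreal (\<epsilon> * (1/2) ^ Suc K))"
  proof (intro suminf_le allI)
    fix K
    have "(\<Sum>j. ennreal (diameter (V (K, j)) powr s)) = (\<Sum>j<card (C K). ennreal ((2 * r K) powr s))"
      unfolding diam by (subst suminf_finite[of "{..<card (C K)}"]) (auto intro!: sum.cong simp del: sum_constant)
    also have "\<dots> = ennreal (real (card (C K)) * (2 * r K) powr s)"
      by (simp only: sum_constant card_lessThan ennreal_of_nat_eq_real_of_nat
          ennreal_mult[symmetric] of_nat_0_le_iff powr_ge_zero)
    also have "\<dots> \<le> ennreal (\<epsilon> * (1/2) ^ Suc K)"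
    proof (rule ennreal_leI)
      have "real (card (C K)) * (2 * r K) powr s = 2 powr s * (real (card (C K)) * r K powr s)"
        using C(2)[of K] by (simp add: powr_mult)
      also have "\<dots> \<le> 2 powr s * \<eta> K" using C(3)[of K] by (intro mult_left_mono) auto
      also have "\<dots> = \<epsilon> * (1/2) ^ Suc K" by (simp add: \<eta>_def)
      finally show "real (card (C K)) * (2 * r K) powr s \<le> \<epsilon> * (1/2) ^ Suc K" .
    qed
    finally show "(\<Sum>j. ennreal (diameter (V (K, j)) powr s)) \<le> ennreal (\<epsilon> * (1/2) ^ Suc K)" .
  qed (rule summableI)+
  also have "\<dots> = ennreal \<epsilon>"
  proof -
    have "(\<lambda>K. \<epsilon> * (1/2) ^ Suc K) sums (\<epsilon> * 1)"
      by (intro sums_mult power_half_series)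
    then show ?thesis using e
      by (intro suminf_ennreal_eq) (simp_all only: mult_1_right, simp)
  qed
  finally have sum: "(\<Sum>i. ennreal (diameter (V (prod_decode i)) powr s)) \<le> ennreal \<epsilon>" .
  have "bounded (V p)" for p by (cases p) (simp add: V_def)
  with sub sum show "\<exists>U::nat \<Rightarrow> real set. (\<Union>K. E K) \<subseteq> (\<Union>i. U i) \<and> (\<forall>i. bounded (U i)) \<and>
        (\<Sum>i. ennreal (diameter (U i) powr s)) \<le> ennreal \<epsilon>"
    by (intro exI[of _ "\<lambda>i. V (prod_decode i)"] conjI allI)
qed

section \<open>Distance to the nearest integer and covers on the torus\<close>

lemma dist_int_le: "dist_int t \<le> \<bar>t - of_int m\<bar>"
  unfolding dist_int_def by (rule round_diff_minimal)

lemma dist_int_nonneg: "0 \<le> dist_int t"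
  by (simp add: dist_int_def)

lemma dist_int_triangle: "dist_int (s + t) \<le> dist_int s + dist_int t"
  using dist_int_le[of "s + t" "round s + round t"] by (simp add: dist_int_def)

lemma dist_int_minus: "dist_int (- t) = dist_int t"
proof (rule antisym)
  show "dist_int (- t) \<le> dist_int t"
    using dist_int_le[of "- t" "- round t"] by (simp add: dist_int_def)
  show "dist_int t \<le> dist_int (- t)"
    using dist_int_le[of t "- round (- t)"] by (simp add: dist_int_def)
qed

lemma dist_int_diff_triangle: "dist_int (a - c) \<le> dist_int (a - b) + dist_int (b - c)"
  using dist_int_triangle[of "a - b" "b - c"] by simp

lemma dist_int_commute: "dist_int (a - b) = dist_int (b - a)"
  using dist_int_minus[of "a - b"] by simp

lemma dist_int_le_if_Ints:
  assumes "t - a \<in> \<int>" shows "dist_int t \<le> \<bar>a\<bar>"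
proof -
  from assms obtain m where "t - a = of_int m" by (auto elim: Ints_cases)
  then show ?thesis using dist_int_le[of t m] by (simp add: algebra_simps)
qed

lemma dist_int_multiple: "dist_int (real b * t) \<le> real b * dist_int t"
proof -
  have "real b * t - of_int (int b * round t) = real b * (t - of_int (round t))"
    by (simp add: algebra_simps)
  then have "\<bar>real b * t - of_int (int b * round t)\<bar> = real b * dist_int t"
    by (simp only: dist_int_def abs_mult abs_of_nat)
  then show ?thesis using dist_int_le[of "real b * t" "int b * round t"] by simp
qed

text \<open>Closeness is measured on the torus, dimension on the line. Both representatives lie in
  [0,1) and the torus distance is at most 1/2, so three integer shifts of a centre suffice. This is
  the origin of the factor 3 when torus balls are turned into balls of the line.\<close>

lemma dist_int_frac_shift:
  assumes "y \<in> {0..<1}"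
  obtains m :: int where "m \<in> {-1, 0, 1}" "\<bar>frac x + of_int m - y\<bar> = dist_int (x - y)"
proof -
  define m where "m = \<lfloor>x\<rfloor> - round (x - y)"
  have eq: "frac x + of_int m - y = (x - y) - of_int (round (x - y))"
    by (simp add: m_def frac_def)
  moreover have "\<bar>(x - y) - of_int (round (x - y))\<bar> \<le> 1/2"
    using of_int_round_abs_le[of "x - y"] by (simp add: abs_minus_commute)
  ultimately have "\<bar>frac x + of_int m - y\<bar> \<le> 1/2" by (simp only:)
  moreover have "0 \<le> y" "y < 1" using assms by auto
  ultimately have "\<bar>real_of_int m\<bar> < 2"
    using frac_lt_1[of x] frac_ge_0[of x] by linarith
  then have "m \<in> {-1, 0, 1}" by auto
  then show ?thesis using that eq by (simp add: dist_int_def)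
qed

lemma hausdorff_measure_torus_eq_0I:
  fixes E :: "nat \<Rightarrow> real set" and x :: "nat \<Rightarrow> real"
  assumes s: "s > 0" and E: "\<And>K. E K \<subseteq> {0..<1}"
    and cov: "\<And>K \<epsilon>. \<epsilon> > 0 \<Longrightarrow> \<exists>I R. finite I \<and> R \<ge> 0 \<and> real (card I) * R powr s \<le> \<epsilon> \<and>
        (\<forall>y\<in>E K. \<exists>i\<in>I. dist_int (x i - y) \<le> R)"
  shows "hausdorff_measure s (\<Union>K. E K) = 0"
proof (rule hausdorff_measure_UN_eq_0I[OF s])
  fix K and \<epsilon> :: real assume "\<epsilon> > 0"
  then have "\<epsilon> / 3 > 0" by simp
  from cov[OF this] obtain I R where I: "finite I" "R \<ge> 0" "real (card I) * R powr s \<le> \<epsilon> / 3"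
    "\<forall>y\<in>E K. \<exists>i\<in>I. dist_int (x i - y) \<le> R" by blast
  define C where "C = (\<lambda>(i, m). frac (x i) + of_int m) ` (I \<times> {-1, 0, 1::int})"
  have "card C \<le> card (I \<times> {-1, 0, 1::int})"
    unfolding C_def by (intro card_image_le) (use I in auto)
  also have "\<dots> = 3 * card I" by (simp add: card_cartesian_product)
  finally have "real (card C) \<le> 3 * real (card I)" by linarith
  then have "real (card C) * R powr s \<le> 3 * real (card I) * R powr s"
    by (intro mult_right_mono) auto
  also have "\<dots> \<le> \<epsilon>" using I(3) by simp
  finally have "real (card C) * R powr s \<le> \<epsilon>" .
  moreover have "E K \<subseteq> (\<Union>c\<in>C. cball c R)"
  proof
    fix y assume y: "y \<in> E K"
    then obtain i where i: "i \<in> I" "dist_int (x i - y) \<le> R" using I(4) by blast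
    obtain m :: int where m: "m \<in> {-1, 0, 1}" "\<bar>frac (x i) + of_int m - y\<bar> = dist_int (x i - y)"
      using dist_int_frac_shift[of y "x i"] y E by blast
    have "frac (x i) + of_int m \<in> C"
      using i(1) m(1) unfolding C_def by (intro image_eqI[of _ _ "(i, m)"]) auto
    moreover have "y \<in> cball (frac (x i) + of_int m) R"
      using m(2) i(2) by (simp add: dist_real_def)
    ultimately show "y \<in> (\<Union>c\<in>C. cball c R)" by blast
  qed
  moreover have "finite C" using I by (simp add: C_def)
  ultimately show "\<exists>C r. finite C \<and> r \<ge> 0 \<and> real (card C) * r powr s \<le> \<epsilon> \<and> E K \<subseteq> (\<Union>c\<in>C. cball c r)"
    using I(2) by blast
qed

section \<open>Masses on trees\<close>

lemma sum_UN_le: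
  fixes g :: "'s \<Rightarrow> real"
  assumes "finite I" "\<And>i. i \<in> I \<Longrightarrow> finite (S i)" "\<And>i x. i \<in> I \<Longrightarrow> x \<in> S i \<Longrightarrow> 0 \<le> g x"
  shows "sum g (\<Union>i\<in>I. S i) \<le> (\<Sum>i\<in>I. sum g (S i))"
  using assms
proof (induction I)
  case (insert a I)
  have "sum g (S a \<union> (\<Union>i\<in>I. S i)) + sum g (S a \<inter> (\<Union>i\<in>I. S i)) = sum g (S a) + sum g (\<Union>i\<in>I. S i)"
    using insert by (intro sum.union_inter) auto
  moreover have "0 \<le> sum g (S a \<inter> (\<Union>i\<in>I. S i))" using insert.prems by (intro sum_nonneg) auto
  moreover have "sum g (\<Union>i\<in>I. S i) \<le> (\<Sum>i\<in>I. sum g (S i))" using insert by auto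
  ultimately show ?case using insert.hyps by simp
qed simp

text \<open>The mass of a node is split among its children in proportion to their weights. As the
  children together weigh at least as much as the parent, the ratio \<open>\<mu> / f\<close> never
  increases along a branch, and it is 1 at the roots.\<close>

lemma mass_distribution_on_tree:
  fixes X :: "nat \<Rightarrow> 's set" and ch :: "nat \<Rightarrow> 's \<Rightarrow> 's set" and f :: "nat \<Rightarrow> 's \<Rightarrow> real"
  assumes fin: "\<And>k. finite (X k)"
    and sub: "\<And>k x. x \<in> X k \<Longrightarrow> ch k x \<subseteq> X (Suc k)"
    and cov: "\<And>k. X (Suc k) \<subseteq> (\<Union>x\<in>X k. ch k x)"
    and disj: "\<And>k x y. x \<in> X k \<Longrightarrow> y \<in> X k \<Longrightarrow> x \<noteq> y \<Longrightarrow> ch k x \<inter> ch k y = {}"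
    and pos: "\<And>k x. x \<in> X k \<Longrightarrow> f k x > 0"
    and super: "\<And>k x. x \<in> X k \<Longrightarrow> f k x \<le> (\<Sum>y\<in>ch k x. f (Suc k) y)"
  obtains \<mu> :: "nat \<Rightarrow> 's \<Rightarrow> real"
  where "\<And>x. x \<in> X 0 \<Longrightarrow> \<mu> 0 x = f 0 x"
    and "\<And>k x. x \<in> X k \<Longrightarrow> 0 \<le> \<mu> k x" and "\<And>k x. x \<in> X k \<Longrightarrow> \<mu> k x \<le> f k x"
    and "\<And>k x. x \<in> X k \<Longrightarrow> \<mu> k x = (\<Sum>y\<in>ch k x. \<mu> (Suc k) y)"
proof -
  define par where "par k y = (THE x. x \<in> X k \<and> y \<in> ch k x)" for k y
  have par: "par k y = x" if "x \<in> X k" "y \<in> ch k x" for k x y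
    unfolding par_def using that disj by (intro the_equality) blast+
  define tot where "tot k x = (\<Sum>y\<in>ch k x. f (Suc k) y)" for k x
  define \<mu> where "\<mu> = rec_nat (f 0) (\<lambda>k m y. m (par k y) * f (Suc k) y / tot k (par k y))"
  have \<mu>0: "\<mu> 0 = f 0" by (simp add: \<mu>_def)
  have \<mu>S: "\<mu> (Suc k) y = \<mu> k x * f (Suc k) y / tot k x" if "x \<in> X k" "y \<in> ch k x" for k x y
    using par[OF that] by (simp add: \<mu>_def)
  have tot: "f k x \<le> tot k x" "tot k x > 0" if "x \<in> X k" for k x
    using super[OF that] pos[OF that] by (auto simp: tot_def)
  have bd: "0 \<le> \<mu> k x \<and> \<mu> k x \<le> f k x" if "x \<in> X k" for k x
    using that
  proof (induction k arbitrary: x)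
    case 0
    then show ?case using pos[of x 0] by (simp add: \<mu>0)
  next
    case (Suc k)
    then obtain p where p: "p \<in> X k" "x \<in> ch k p" using cov by blast
    have "\<mu> k p / tot k p \<le> 1" using Suc.IH[OF p(1)] tot[OF p(1)] by simp
    then have "\<mu> k p / tot k p * f (Suc k) x \<le> 1 * f (Suc k) x"
      using pos[OF Suc.prems] by (intro mult_right_mono) auto
    moreover have "0 \<le> \<mu> k p / tot k p * f (Suc k) x"
      using Suc.IH[OF p(1)] tot[OF p(1)] pos[OF Suc.prems] by simp
    ultimately show ?case by (simp add: \<mu>S[OF p])
  qed
  have flow: "\<mu> k x = (\<Sum>y\<in>ch k x. \<mu> (Suc k) y)" if "x \<in> X k" for k x
  proof -
    have "(\<Sum>y\<in>ch k x. \<mu> (Suc k) y) = (\<Sum>y\<in>ch k x. \<mu> k x / tot k x * f (Suc k) y)"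
      by (intro sum.cong refl) (simp add: \<mu>S[OF that])
    also have "\<dots> = \<mu> k x / tot k x * tot k x"
      by (simp add: tot_def sum_distrib_left)
    finally show ?thesis using tot(2)[OF that] by simp
  qed
  show ?thesis by (rule that[of \<mu>]) (use \<mu>0 bd flow in auto)
qed

text \<open>The mass distribution principle, carried out at finite levels instead of with a limit
  measure. Compactness reduces a cover to finitely many open intervals, whose masses are compared at
  one deep level. \<open>bound\<close> may choose a different level for each interval, because the
  mass of the nodes that meet a fixed set decreases with the level.\<close>

lemma hausdorff_measure_tree_neq_0:
  fixes X :: "nat \<Rightarrow> 's set" and ch :: "nat \<Rightarrow> 's \<Rightarrow> 's set" and f :: "nat \<Rightarrow> 's \<Rightarrow> real"
    and J :: "nat \<Rightarrow> 's \<Rightarrow> real set"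
  assumes s: "s > 0" and rmax: "rmax > 0" and A: "A > 0"
    and fin: "\<And>k. finite (X k)" and ne: "X 0 \<noteq> {}"
    and sub: "\<And>k x. x \<in> X k \<Longrightarrow> ch k x \<subseteq> X (Suc k)"
    and cov: "\<And>k. X (Suc k) \<subseteq> (\<Union>x\<in>X k. ch k x)"
    and disj: "\<And>k x y. x \<in> X k \<Longrightarrow> y \<in> X k \<Longrightarrow> x \<noteq> y \<Longrightarrow> ch k x \<inter> ch k y = {}"
    and pos: "\<And>k x. x \<in> X k \<Longrightarrow> f k x > 0"
    and super: "\<And>k x. x \<in> X k \<Longrightarrow> f k x \<le> (\<Sum>y\<in>ch k x. f (Suc k) y)"
    and J: "\<And>k x. x \<in> X k \<Longrightarrow> compact (J k x)" "\<And>k x. x \<in> X k \<Longrightarrow> J k x \<noteq> {}"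
    and Jsub: "\<And>k x y. x \<in> X k \<Longrightarrow> y \<in> ch k x \<Longrightarrow> J (Suc k) y \<subseteq> J k x"
    and bound: "\<And>r c. 0 < r \<Longrightarrow> r \<le> rmax \<Longrightarrow>
        \<exists>k. (\<Sum>x | x \<in> X k \<and> J k x \<inter> {c..c + r} \<noteq> {}. f k x) \<le> A * r powr s"
    and E: "(\<Inter>k. \<Union>x\<in>X k. J k x) \<subseteq> E"
  shows "hausdorff_measure s E \<noteq> 0"
proof
  assume H: "hausdorff_measure s E = 0"
  obtain \<mu> where \<mu>0: "\<And>x. x \<in> X 0 \<Longrightarrow> \<mu> 0 x = f 0 x"
    and \<mu>nn: "\<And>k x. x \<in> X k \<Longrightarrow> 0 \<le> \<mu> k x" and \<mu>le: "\<And>k x. x \<in> X k \<Longrightarrow> \<mu> k x \<le> f k x"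
    and \<mu>flow: "\<And>k x. x \<in> X k \<Longrightarrow> \<mu> k x = (\<Sum>y\<in>ch k x. \<mu> (Suc k) y)"
    using mass_distribution_on_tree[of X ch f, OF fin sub cov disj pos super] by blast
  have chfin: "finite (ch k x)" if "x \<in> X k" for k x
    using sub[OF that] fin finite_subset by blast
  define T where "T = (\<Sum>x\<in>X 0. f 0 x)"
  have T: "T > 0" unfolding T_def using ne fin pos by (intro sum_pos) auto
  have XS: "X (Suc k) = (\<Union>x\<in>X k. ch k x)" for k using sub cov by blast
  have sumS: "(\<Sum>y\<in>(\<Union>x\<in>Y. ch k x). \<mu> (Suc k) y) = (\<Sum>x\<in>Y. \<mu> k x)" if "Y \<subseteq> X k" for k Y
  proof -
    have "(\<Sum>y\<in>(\<Union>x\<in>Y. ch k x). \<mu> (Suc k) y) = (\<Sum>x\<in>Y. \<Sum>y\<in>ch k x. \<mu> (Suc k) y)"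
    proof (rule sum.UNION_disjoint)
      show "finite Y" using that fin finite_subset by blast
      show "\<forall>i\<in>Y. finite (ch k i)" using that chfin by blast
      show "\<forall>i\<in>Y. \<forall>j\<in>Y. i \<noteq> j \<longrightarrow> ch k i \<inter> ch k j = {}"
        using that disj by (simp add: subset_iff)
    qed
    also have "\<dots> = (\<Sum>x\<in>Y. \<mu> k x)"
      using that \<mu>flow by (intro sum.cong) auto
    finally show ?thesis .
  qed
  have total: "(\<Sum>x\<in>X k. \<mu> k x) = T" for k
  proof (induction k)
    case 0 show ?case by (simp add: T_def \<mu>0)
  next
    case (Suc k) then show ?case using sumS[of "X k" k] by (simp add: XS)
  qed
  define K where "K k = (\<Union>x\<in>X k. J k x)" for k
  define Mt where "Mt S k = (\<Sum>x | x \<in> X k \<and> J k x \<inter> S \<noteq> {}. \<mu> k x)" for S k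
  have Kdec: "K (Suc k) \<subseteq> K k" for k
    unfolding K_def XS using Jsub by blast
  then have decK: "decseq K" by (rule decseq_SucI)
  have Mdec: "decseq (Mt S)" for S
  proof (rule decseq_SucI)
    fix k
    let ?Y = "{x \<in> X k. J k x \<inter> S \<noteq> {}}"
    have "{x \<in> X (Suc k). J (Suc k) x \<inter> S \<noteq> {}} \<subseteq> (\<Union>x\<in>?Y. ch k x)"
      unfolding XS using Jsub by blast
    then have "Mt S (Suc k) \<le> (\<Sum>y\<in>(\<Union>x\<in>?Y. ch k x). \<mu> (Suc k) y)"
      unfolding Mt_def
    proof (rule sum_mono2[rotated])
      show "finite (\<Union>x\<in>?Y. ch k x)" using fin chfin by auto
      fix b assume "b \<in> (\<Union>x\<in>?Y. ch k x) - {x \<in> X (Suc k). J (Suc k) x \<inter> S \<noteq> {}}"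
      then show "0 \<le> \<mu> (Suc k) b" using \<mu>nn sub by blast
    qed
    also have "\<dots> = Mt S k" unfolding Mt_def by (rule sumS) auto
    finally show "Mt S (Suc k) \<le> Mt S k" .
  qed
  have XK: "X k \<noteq> {}" for k using total[of k] T by auto
  have Kcomp: "compact (K k)" for k unfolding K_def using fin J by (intro compact_UN) auto
  \<comment> \<open>The first entry makes the mass of the cover smaller than the total mass
    \<open>T\<close>, the second makes every interval short enough for \<open>bound\<close>.\<close>
  define \<epsilon> where "\<epsilon> = min (T / (2 * (A * 2 powr s) + 1)) (rmax powr s / 2 powr s) / 4"
  have e: "\<epsilon> > 0" using T A rmax by (simp add: \<epsilon>_def add_pos_pos)
  obtain U :: "nat \<Rightarrow> real set" where U: "E \<subseteq> (\<Union>i. U i)" "\<And>i. bounded (U i)"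
    "(\<Sum>i. ennreal (diameter (U i) powr s)) < ennreal \<epsilon>"
    using hausdorff_measure_eq_0_imp_cover[OF H e] by blast
  define d where "d i = diameter (U i) powr s" for i
  have dsum: "summable d" and dsuminf: "suminf d \<le> \<epsilon>"
  proof -
    have nn: "\<And>i. 0 \<le> d i" by (simp add: d_def)
    have "(\<Sum>i. ennreal (d i)) < ennreal \<epsilon>" using U(3) by (simp add: d_def)
    then have "(\<Sum>i. ennreal (d i)) \<noteq> top" by (auto simp: less_top[symmetric])
    then show "summable d" using nn by (intro summable_suminf_not_top)
    then have "ennreal (suminf d) = (\<Sum>i. ennreal (d i))" using nn by (intro suminf_ennreal2[symmetric])
    then have "ennreal (suminf d) \<le> ennreal \<epsilon>" using \<open>(\<Sum>i. ennreal (d i)) < ennreal \<epsilon>\<close> by simp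
    then show "suminf d \<le> \<epsilon>" using e by simp
  qed
  \<comment> \<open>Slightly more than the diameter: an open interval of this radius contains
    \<open>U i\<close> even if that is a single point, and all the enlargements together cost at
    most \<open>\<epsilon>\<close>.\<close>
  define R where "R i = (d i + \<epsilon> * (1/2) ^ Suc i) powr (1 / s)" for i
  have dpos: "d i + \<epsilon> * (1/2) ^ Suc i > 0" for i
    using e by (intro add_nonneg_pos) (auto simp: d_def)
  have Rs: "R i powr s = d i + \<epsilon> * (1/2) ^ Suc i" for i
    using dpos[of i] s by (simp add: R_def powr_powr)
  have Rpos: "R i > 0" for i using dpos[of i] by (simp add: R_def)
  have "diameter (U i) < R i" for i
  proof (rule ccontr)
    assume "\<not> diameter (U i) < R i"
    then have "R i powr s \<le> diameter (U i) powr s" using Rpos[of i] s by (intro powr_mono2) auto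
    moreover have "\<epsilon> * (1/2) ^ Suc i > 0" using e by simp
    ultimately show False unfolding Rs d_def by linarith
  qed
  note Rdiam = this
  have "\<exists>c. U i \<subseteq> {c - R i<..<c + R i}" for i
  proof (cases "U i = {}")
    case False
    then obtain u where u: "u \<in> U i" by blast
    have "U i \<subseteq> {u - R i<..<u + R i}"
    proof
      fix v assume "v \<in> U i"
      then have "dist v u \<le> diameter (U i)" using U(2) u diameter_bounded_bound by blast
      then show "v \<in> {u - R i<..<u + R i}" using Rdiam[of i] by (auto simp: dist_real_def abs_le_iff)
    qed
    then show ?thesis by blast
  qed auto
  then obtain c where c: "\<And>i. U i \<subseteq> {c i - R i<..<c i + R i}" by metis
  define V where "V i = {c i - R i<..<c i + R i}" for i
  \<comment> \<open>Otherwise the sets \<open>K n\<close> minus the first \<open>n\<close> intervals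
    form a decreasing family of nonempty compact sets; a common point would lie in \<open>E\<close>
    but in none of the intervals.\<close>
  have "\<exists>k n. K k \<subseteq> (\<Union>i<n. V i)"
  proof (rule ccontr)
    assume neg: "\<not> (\<exists>k n. K k \<subseteq> (\<Union>i<n. V i))"
    have "K 0 \<inter> (\<Inter>n. K n - (\<Union>i<n. V i)) \<noteq> {}"
    proof (rule compact_imp_fip_image)
      show "compact (K 0)" by (rule Kcomp)
      show "closed (K n - (\<Union>i<n. V i))" for n
        using Kcomp[of n] by (intro closed_Diff compact_imp_closed open_UN) (auto simp: V_def)
      fix S :: "nat set" assume S: "finite S"
      define N where "N = Max (insert 0 S)"
      have N: "n \<le> N" if "n \<in> S" for n using S that by (simp add: N_def)
      obtain y where y: "y \<in> K N" "y \<notin> (\<Union>i<N. V i)" using neg by blast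
      have "y \<in> K n - (\<Union>i<n. V i)" if "n \<in> S" for n
        using y N[OF that] decseqD[OF decK N[OF that]] by auto
      moreover have "y \<in> K 0" using y decseqD[OF decK, of 0 N] by auto
      ultimately show "K 0 \<inter> (\<Inter>n\<in>S. K n - (\<Union>i<n. V i)) \<noteq> {}" by blast
    qed
    then obtain y where y: "\<And>n. y \<in> K n" "\<And>n. y \<notin> (\<Union>i<n. V i)" by blast
    then have "y \<in> E" using E by (auto simp: K_def)
    then obtain i where "y \<in> V i" using U(1) c unfolding V_def by blast
    then show False using y(2)[of "Suc i"] by blast
  qed
  then obtain k0 n where kn: "K k0 \<subseteq> (\<Union>i<n. V i)" by blast
  have sumR: "(\<Sum>i<n. R i powr s) \<le> 2 * \<epsilon>"
  proof -
    have "(\<Sum>i<n. R i powr s) = (\<Sum>i<n. d i) + \<epsilon> * (\<Sum>i<n. (1/2) ^ Suc i)"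
      unfolding Rs by (simp only: sum.distrib sum_distrib_left)
    also have "(\<Sum>i<n. d i) \<le> suminf d"
      by (intro sum_le_suminf dsum) (auto simp: d_def)
    also have "(\<Sum>i<n. (1/2) ^ Suc i :: real) \<le> 1"
      using sum_le_suminf[OF sums_summable[OF power_half_series], of "{..<n}"]
        sums_unique[OF power_half_series] by simp
    finally show ?thesis using dsuminf e by simp
  qed
  have "\<exists>k. Mt (V i) k \<le> A * (2 * R i) powr s" if "i < n" for i
  proof -
    have "R i powr s \<le> (\<Sum>i<n. R i powr s)"
      using that by (intro member_le_sum) auto
    then have "2 powr s * R i powr s \<le> 2 powr s * (2 * \<epsilon>)" using sumR by simp
    also have "\<dots> \<le> rmax powr s" 
    proof -
      have "4 * \<epsilon> \<le> rmax powr s / 2 powr s" by (simp add: \<epsilon>_def)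
      then have "2 powr s * (4 * \<epsilon>) \<le> rmax powr s" by (simp add: field_simps)
      moreover have "2 powr s * (2 * \<epsilon>) \<le> 2 powr s * (4 * \<epsilon>)" using e by simp
      ultimately show ?thesis by linarith
    qed
    finally have "(2 * R i) powr s \<le> rmax powr s" using Rpos[of i] by (simp add: powr_mult)
    then have "2 * R i \<le> rmax"
      using powr_less_mono2[of s rmax "2 * R i"] s rmax by (meson less_imp_le not_le)
    then obtain k where k: "(\<Sum>x | x \<in> X k \<and> J k x \<inter> {c i - R i..(c i - R i) + 2 * R i} \<noteq> {}. f k x)
        \<le> A * (2 * R i) powr s"
      using bound[of "2 * R i" "c i - R i"] Rpos[of i] by auto
    have "Mt (V i) k \<le> (\<Sum>x | x \<in> X k \<and> J k x \<inter> {c i - R i..(c i - R i) + 2 * R i} \<noteq> {}. \<mu> k x)"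
      unfolding Mt_def
      by (rule sum_mono2) (use fin \<mu>nn in \<open>auto simp: V_def\<close>)
    also have "\<dots> \<le> (\<Sum>x | x \<in> X k \<and> J k x \<inter> {c i - R i..(c i - R i) + 2 * R i} \<noteq> {}. f k x)"
      by (intro sum_mono) (use \<mu>le in auto)
    finally show ?thesis using k by (intro exI[of _ k]) linarith
  qed
  then obtain kk where kk: "\<And>i. i < n \<Longrightarrow> Mt (V i) (kk i) \<le> A * (2 * R i) powr s" by metis
  define N where "N = Max (insert k0 (kk ` {..<n}))"
  have N: "k0 \<le> N" "\<And>i. i < n \<Longrightarrow> kk i \<le> N" by (auto simp: N_def)
  have "T = (\<Sum>x\<in>X N. \<mu> N x)" by (simp add: total)
  also have "\<dots> \<le> (\<Sum>x\<in>(\<Union>i<n. {x \<in> X N. J N x \<inter> V i \<noteq> {}}). \<mu> N x)"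
  proof (rule sum_mono2)
    show "X N \<subseteq> (\<Union>i<n. {x \<in> X N. J N x \<inter> V i \<noteq> {}})"
    proof
      fix x assume x: "x \<in> X N"
      then obtain y where y: "y \<in> J N x" using J(2) by blast
      then have "y \<in> K N" using x by (auto simp: K_def)
      then have "y \<in> (\<Union>i<n. V i)" using kn decseqD[OF decK N(1)] by blast
      then show "x \<in> (\<Union>i<n. {x \<in> X N. J N x \<inter> V i \<noteq> {}})" using x y by blast
    qed
  qed (use fin \<mu>nn in auto)
  also have "\<dots> \<le> (\<Sum>i<n. Mt (V i) N)"
    unfolding Mt_def by (rule sum_UN_le) (use fin \<mu>nn in auto)
  also have "\<dots> \<le> (\<Sum>i<n. A * (2 * R i) powr s)"
    using order_trans[OF decseqD[OF Mdec N(2)] kk] by (intro sum_mono) auto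
  also have "\<dots> = A * 2 powr s * (\<Sum>i<n. R i powr s)"
    using Rpos by (simp add: powr_mult sum_distrib_left less_imp_le mult.assoc)
  also have "\<dots> \<le> A * 2 powr s * (2 * \<epsilon>)" using sumR A by (intro mult_left_mono) auto
  also have "\<dots> < T"
  proof -
    have "4 * \<epsilon> \<le> T / (2 * (A * 2 powr s) + 1)" by (simp add: \<epsilon>_def)
    then have "4 * \<epsilon> * (2 * (A * 2 powr s) + 1) \<le> T"
      using A by (subst (asm) pos_le_divide_eq) (auto intro: add_pos_pos)
    moreover have "A * 2 powr s * (2 * \<epsilon>) < 4 * \<epsilon> * (2 * (A * 2 powr s) + 1)"
      using e A by (simp add: algebra_simps add_pos_pos)
    ultimately show ?thesis by linarith
  qed
  finally show False by simp
qed

section \<open>Continued fractions\<close>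

text \<open>Indices are shifted by one against the usual convention: \<open>cf_den \<theta> n\<close> is the denominator
  \<open>q\<^sub>n\<^sub>-\<^sub>1\<close> of the continued fraction of \<open>\<theta>\<close>, and \<open>cf_err \<theta> n\<close> is \<open>\<bar>q\<^sub>n\<^sub>-\<^sub>1 \<theta> - p\<^sub>n\<^sub>-\<^sub>1\<bar>\<close>.\<close>

fun cf_err :: "real \<Rightarrow> nat \<Rightarrow> real" where
  "cf_err \<theta> 0 = 1"
| "cf_err \<theta> (Suc 0) = \<theta>"
| "cf_err \<theta> (Suc (Suc n)) = cf_err \<theta> n - of_int \<lfloor>cf_err \<theta> n / cf_err \<theta> (Suc n)\<rfloor> * cf_err \<theta> (Suc n)"

text \<open>The errors run the Euclidean algorithm on 1 and \<open>\<theta>\<close>; this is its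
  quotient number \<open>n\<close>, the partial quotient with index \<open>n+1\<close> when the
  expansion is written [0; a_1, a_2, ...].\<close>

definition cf_quot :: "real \<Rightarrow> nat \<Rightarrow> nat" where
  "cf_quot \<theta> n = nat \<lfloor>cf_err \<theta> n / cf_err \<theta> (Suc n)\<rfloor>"

fun cf_den :: "real \<Rightarrow> nat \<Rightarrow> nat" where
  "cf_den \<theta> 0 = 0"
| "cf_den \<theta> (Suc 0) = 1"
| "cf_den \<theta> (Suc (Suc n)) = cf_quot \<theta> n * cf_den \<theta> (Suc n) + cf_den \<theta> n"

locale irrational_rotation =
  fixes \<theta> :: real
  assumes \<theta>_pos: "0 < \<theta>" and \<theta>_less_1: "\<theta> < 1" and \<theta>_irr: "\<theta> \<notin> \<rat>"
begin

abbreviation "D \<equiv> cf_err \<theta>"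
abbreviation "Q \<equiv> cf_den \<theta>"
abbreviation "a \<equiv> cf_quot \<theta>"

lemma irrational_multiple: "0 < j \<Longrightarrow> real j * \<theta> \<notin> \<int>"
proof
  assume j: "0 < j" and "real j * \<theta> \<in> \<int>"
  then obtain m where "real j * \<theta> = of_int m" by (auto elim: Ints_cases)
  then have "\<theta> = of_int m / of_nat j" using j by (simp add: field_simps)
  then show False using \<theta>_irr by (metis Rats_divide Rats_of_int Rats_of_nat)
qed

text \<open>The claims depend on each other and go through one induction: that the new error is
  nonzero follows from irrationality, by way of the congruence for the new denominator. The sign
  \<open>(-1) ^ n\<close> records that successive denominators approximate from opposite
  sides.\<close>

lemma cf_basic:
  "0 < D n \<and> 0 < D (Suc n) \<and> D (Suc n) < D n \<and> 0 < Q (Suc n) \<and>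
   real (Q (Suc n)) * \<theta> - (-1) ^ n * D (Suc n) \<in> \<int> \<and>
   real (Q n) * \<theta> + (-1) ^ n * D n \<in> \<int>"
proof (induction n)
  case 0
  then show ?case using \<theta>_pos \<theta>_less_1 by simp
next
  case (Suc n)
  let ?x = "D n / D (Suc n)"
  have x1: "1 < ?x" using Suc by simp
  then have fl: "1 \<le> \<lfloor>?x\<rfloor>" by (simp add: le_floor_iff)
  have an: "of_int \<lfloor>?x\<rfloor> = real (a n)" using fl by (simp add: cf_quot_def)
  have rec: "D (Suc (Suc n)) = D n - real (a n) * D (Suc n)" by (simp add: an)
  have "D (Suc (Suc n)) = frac ?x * D (Suc n)"
    using Suc by (simp add: frac_def left_diff_distrib)
  then have D2: "0 \<le> D (Suc (Suc n))" "D (Suc (Suc n)) < D (Suc n)"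
    using Suc frac_lt_1[of ?x] frac_ge_0[of ?x] by auto
  have Q2: "0 < Q (Suc (Suc n))" using Suc fl by (simp add: cf_quot_def)
  have "real (Q (Suc (Suc n))) * \<theta> - (-1) ^ Suc n * D (Suc (Suc n)) =
    real (a n) * (real (Q (Suc n)) * \<theta> - (-1) ^ n * D (Suc n)) + (real (Q n) * \<theta> + (-1) ^ n * D n)"
    unfolding rec by (simp add: algebra_simps)
  also have "\<dots> \<in> \<int>"
    by (rule Ints_add[OF Ints_mult[OF Ints_of_nat]]) (use Suc in blast)+
  finally have I: "real (Q (Suc (Suc n))) * \<theta> - (-1) ^ Suc n * D (Suc (Suc n)) \<in> \<int>" .
  have "D (Suc (Suc n)) \<noteq> 0"
  proof
    assume "D (Suc (Suc n)) = 0"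
    with I have "real (Q (Suc (Suc n))) * \<theta> \<in> \<int>" by simp
    with irrational_multiple[OF Q2] show False by simp
  qed
  with D2 Suc Q2 I show ?case by (simp del: cf_err.simps cf_den.simps)
qed

lemma D_pos: "0 < D n" and D_decr: "D (Suc n) < D n" and Q_pos: "0 < Q (Suc n)"
  using cf_basic[of n] by auto

lemma Q_cong: "real (Q (Suc n)) * \<theta> - (-1) ^ n * D (Suc n) \<in> \<int>"
  and Q_cong': "real (Q n) * \<theta> + (-1) ^ n * D n \<in> \<int>"
  using cf_basic[of n] by auto

lemma a_pos: "1 \<le> a n"
proof -
  have "1 < D n / D (Suc n)" using D_pos[of "Suc n"] D_decr[of n] by simp
  then have "1 \<le> \<lfloor>D n / D (Suc n)\<rfloor>" by (simp add: le_floor_iff)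
  then show ?thesis unfolding cf_quot_def by linarith
qed

lemma D_rec: "D n = real (a n) * D (Suc n) + D (Suc (Suc n))"
proof -
  have "1 \<le> \<lfloor>D n / D (Suc n)\<rfloor>" using a_pos[of n] unfolding cf_quot_def by linarith
  then have "of_int \<lfloor>D n / D (Suc n)\<rfloor> = real (a n)" by (simp add: cf_quot_def)
  then show ?thesis by simp
qed

lemma Q_rec: "Q (Suc (Suc n)) = a n * Q (Suc n) + Q n"
  by simp

declare cf_err.simps(3) [simp del] cf_den.simps(3) [simp del]

lemma Q_mono: "Q n \<le> Q (Suc n)"
proof (cases n)
  case (Suc m)
  have "1 * Q (Suc m) \<le> a m * Q (Suc m)" by (rule mult_right_mono[OF a_pos]) simp
  then show ?thesis unfolding Suc Q_rec by linarith
qed simp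

lemma Q_mono_le: "m \<le> n \<Longrightarrow> Q m \<le> Q n"
  using Q_mono by (rule lift_Suc_mono_le)

lemma Q_ge: "n \<le> Q (Suc n)"
proof (induction n)
  case (Suc n)
  show ?case
  proof (cases n)
    case 0 then show ?thesis using Q_pos[of 1] by simp
  next
    case (Suc m)
    have "1 * Q (Suc n) \<le> a n * Q (Suc n)" by (rule mult_right_mono[OF a_pos]) simp
    moreover have "0 < Q n" using Q_pos[of m] Suc by simp
    ultimately show ?thesis using Suc.IH unfolding Q_rec by linarith
  qed
qed simp

lemma filterlim_Q: "filterlim (\<lambda>n. real (Q (Suc n))) at_top sequentially"
  by (rule filterlim_at_top_mono[OF filterlim_real_sequentially]) (simp add: Q_ge)

text \<open>Up to sign this is the determinant of two consecutive lattice vectors (denominator,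
  signed error), which every step of the Euclidean algorithm preserves. It pins \<open>D n\<close>
  down to \<open>1 / Q (n+1)\<close> up to a factor 2.\<close>

lemma det_identity: "real (Q (Suc n)) * D n + real (Q n) * D (Suc n) = 1"
proof (induction n)
  case (Suc n)
  have "real (Q (Suc (Suc n))) * D (Suc n) + real (Q (Suc n)) * D (Suc (Suc n)) =
     real (Q (Suc n)) * (real (a n) * D (Suc n) + D (Suc (Suc n))) + real (Q n) * D (Suc n)"
    by (simp add: Q_rec algebra_simps)
  then show ?case using Suc D_rec[of n] by simp
qed simp

lemma D_le: "D n \<le> 1 / real (Q (Suc n))"
  and QD_le: "real (Q (Suc n)) * D n \<le> 1"
proof -
  have "0 \<le> real (Q n) * D (Suc n)" using D_pos[of "Suc n"] by simp
  then show *: "real (Q (Suc n)) * D n \<le> 1" using det_identity[of n] by linarith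
  then show "D n \<le> 1 / real (Q (Suc n))" using Q_pos[of n] by (simp add: field_simps)
qed

lemma D_ge: "1 / (2 * real (Q (Suc n))) \<le> D n"
proof -
  have "real (Q n) * D (Suc n) \<le> real (Q (Suc n)) * D n"
    using Q_mono[of n] D_decr[of n] D_pos[of "Suc n"] by (intro mult_mono) auto
  then have "1 / 2 \<le> real (Q (Suc n)) * D n" using det_identity[of n] by linarith
  then show "1 / (2 * real (Q (Suc n))) \<le> D n" using Q_pos[of n] by (simp add: field_simps)
qed

text \<open>The vectors \<open>(Q n, \<plusminus>D n)\<close> and \<open>(Q (n+1), \<mp>D (n+1))\<close> form a lattice basis. A lattice vector with
  abscissa strictly between \<open>0\<close> and \<open>Q (n+1)\<close> has coefficients \<open>\<alpha>\<close>, \<open>\<beta>\<close> of opposite signs, so that both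
  contributions to the ordinate have the same sign.\<close>

lemma best_approximation:
  assumes j: "0 < j" "j < Q (Suc n)"
  shows "D n \<le> dist_int (real j * \<theta>)"
proof -
  obtain P1 where P1: "real (Q (Suc n)) * \<theta> - (-1) ^ n * D (Suc n) = of_int P1"
    using Q_cong[of n] by (auto elim: Ints_cases)
  obtain P0 where P0: "real (Q n) * \<theta> + (-1) ^ n * D n = of_int P0"
    using Q_cong'[of n] by (auto elim: Ints_cases)
  define m where "m = round (real j * \<theta>)"
  define t where "t = real j * \<theta> - of_int m"
  define e :: int where "e = (-1) ^ n"
  have e: "real_of_int e * real_of_int e = 1" "e = 1 \<or> e = -1"
    by (auto simp: e_def power_mult_distrib[symmetric] minus_one_power_iff)
  \<comment> \<open>Cramer's rule for \<open>(j, m)\<close> in terms of \<open>(Q (n+1), P1)\<close>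
    and \<open>(Q n, P0)\<close>: the determinant \<open>Q (n+1) * P0 - Q n * P1\<close> equals
    \<open>e\<close>, so the coefficients are integers.\<close>
  define \<alpha> where "\<alpha> = e * (int j * P0 - m * int (Q n))"
  define \<beta> where "\<beta> = e * (m * int (Q (Suc n)) - int j * P1)"
  have P0': "of_int P0 = real (Q n) * \<theta> + of_int e * D n" using P0 by (simp add: e_def)
  have P1': "of_int P1 = real (Q (Suc n)) * \<theta> - of_int e * D (Suc n)" using P1 by (simp add: e_def)
  have \<alpha>: "of_int \<alpha> = real j * D n + of_int e * t * real (Q n)"
  proof -
    have "of_int \<alpha> = of_int e * (real j * (real (Q n) * \<theta> + of_int e * D n) - of_int m * real (Q n))"
      by (simp add: \<alpha>_def P0')
    also have "\<dots> = real j * ((of_int e * of_int e) * D n) + of_int e * t * real (Q n)"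
      by (simp add: t_def algebra_simps)
    finally show ?thesis by (simp add: e)
  qed
  have \<beta>: "of_int \<beta> = real j * D (Suc n) - of_int e * t * real (Q (Suc n))"
  proof -
    have "of_int \<beta> = of_int e * (of_int m * real (Q (Suc n)) - real j * (real (Q (Suc n)) * \<theta> - of_int e * D (Suc n)))"
      by (simp add: \<beta>_def P1')
    also have "\<dots> = real j * ((of_int e * of_int e) * D (Suc n)) - of_int e * t * real (Q (Suc n))"
      by (simp add: t_def algebra_simps)
    finally show ?thesis by (simp add: e)
  qed
  have "of_int \<alpha> * real (Q (Suc n)) + of_int \<beta> * real (Q n) =
      real j * (real (Q (Suc n)) * D n + real (Q n) * D (Suc n))"
    unfolding \<alpha> \<beta> by (simp add: algebra_simps)
  then have "real_of_int (\<alpha> * int (Q (Suc n)) + \<beta> * int (Q n)) = real_of_int (int j)"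
    by (simp add: det_identity)
  then have jeq: "\<alpha> * int (Q (Suc n)) + \<beta> * int (Q n) = int j" by (simp only: of_int_eq_iff)
  have teq: "of_int e * t = of_int \<alpha> * D (Suc n) - of_int \<beta> * D n"
  proof -
    have "of_int \<alpha> * D (Suc n) - of_int \<beta> * D n =
      of_int e * t * (real (Q (Suc n)) * D n + real (Q n) * D (Suc n))"
      unfolding \<alpha> \<beta> by (simp add: algebra_simps)
    then show ?thesis by (simp add: det_identity)
  qed
  have "D n \<le> \<bar>of_int e * t\<bar>"
  proof (cases "\<alpha> \<ge> 1")
    case True
    have "\<beta> < 0"
    proof (rule ccontr)
      assume "\<not> \<beta> < 0"
      then have "0 \<le> \<beta> * int (Q n)" by simp
      moreover have "1 * int (Q (Suc n)) \<le> \<alpha> * int (Q (Suc n))"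
        using True by (intro mult_right_mono) auto
      ultimately show False using jeq j by linarith
    qed
    then have "1 * D n \<le> (- of_int \<beta>) * D n" using D_pos[of n]
      by (intro mult_right_mono) auto
    moreover have "0 \<le> of_int \<alpha> * D (Suc n)" using True D_pos[of "Suc n"] by simp
    ultimately show ?thesis unfolding teq by linarith
  next
    case False
    have "\<beta> > 0"
    proof (rule ccontr)
      assume "\<not> \<beta> > 0"
      then have "\<beta> * int (Q n) \<le> 0" by (simp add: mult_nonpos_nonneg)
      moreover have "\<alpha> * int (Q (Suc n)) \<le> 0" using False by (simp add: mult_nonpos_nonneg)
      ultimately show False using jeq j by linarith
    qed
    then have "1 * D n \<le> of_int \<beta> * D n" using D_pos[of n]
      by (intro mult_right_mono) auto
    moreover have "of_int \<alpha> * D (Suc n) \<le> 0" using False D_pos[of "Suc n"] by (simp add: mult_nonpos_nonneg)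
    ultimately show ?thesis unfolding teq by linarith
  qed
  also have "\<dots> = \<bar>t\<bar>" using e(2) by auto
  finally show ?thesis by (simp add: dist_int_def t_def m_def)
qed

lemma dist_int_Q: "dist_int (real (Q (Suc n)) * \<theta>) \<le> D (Suc n)"
proof -
  have "dist_int (real (Q (Suc n)) * \<theta>) \<le> \<bar>(-1) ^ n * D (Suc n)\<bar>"
    by (rule dist_int_le_if_Ints[OF Q_cong])
  then show ?thesis using D_pos[of "Suc n"] by (simp add: abs_mult)
qed

lemma orbit_separated:
  assumes "i \<in> {1..Q (Suc n)}" "j \<in> {1..Q (Suc n)}" "i \<noteq> j"
  shows "D n \<le> dist_int (real i * \<theta> - real j * \<theta>)"
proof -
  have *: "D n \<le> dist_int (real i * \<theta> - real j * \<theta>)"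
    if "j < i" "1 \<le> j" "i \<le> Q (Suc n)" for i j :: nat
  proof -
    have "D n \<le> dist_int (real (i - j) * \<theta>)" by (rule best_approximation) (use that in auto)
    then show ?thesis using that by (simp add: of_nat_diff left_diff_distrib)
  qed
  show ?thesis
  proof (cases "j < i")
    case True then show ?thesis using * assms by auto
  next
    case False
    then have "D n \<le> dist_int (real j * \<theta> - real i * \<theta>)" using * assms by auto
    then show ?thesis by (simp add: dist_int_commute)
  qed
qed

section \<open>Irrationality exponent and growth of the denominators\<close>

lemma frequently_dist_int_less:
  assumes "0 < s" "ereal s < irr_exponent \<theta>"
  shows "\<exists>j\<ge>N. 0 < j \<and> dist_int (real j * \<theta>) < real j powr (- s)"
proof -
  obtain s' where s': "s < s'" "liminf (\<lambda>j::nat. ereal (real j powr s' * dist_int (real j * \<theta>))) = 0"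
    using assms(2) unfolding irr_exponent_def less_Sup_iff by auto
  have "\<not> (\<forall>\<^sub>F j in sequentially. 1 \<le> ereal (real j powr s' * dist_int (real j * \<theta>)))"
  proof
    assume "\<forall>\<^sub>F j in sequentially. 1 \<le> ereal (real j powr s' * dist_int (real j * \<theta>))"
    then have "1 \<le> liminf (\<lambda>j::nat. ereal (real j powr s' * dist_int (real j * \<theta>)))"
      by (rule Liminf_bounded)
    then show False using s'(2) by simp
  qed
  then obtain j where j: "j \<ge> max N 1" "\<not> 1 \<le> ereal (real j powr s' * dist_int (real j * \<theta>))"
    unfolding eventually_sequentially by blast
  then have j1: "1 \<le> real j" and "real j powr s' * dist_int (real j * \<theta>) < 1" by auto
  moreover have "real j powr s \<le> real j powr s'" using j1 s' by (intro powr_mono) auto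
  then have "real j powr s * dist_int (real j * \<theta>) \<le> real j powr s' * dist_int (real j * \<theta>)"
    using dist_int_nonneg by (intro mult_right_mono) auto
  ultimately have "real j powr s * dist_int (real j * \<theta>) < 1" by linarith
  then have "dist_int (real j * \<theta>) < real j powr (- s)"
    using j1 by (simp add: powr_minus field_simps)
  then show ?thesis using j by auto
qed

text \<open>Between the exponent and \<open>u\<close> there is room for an \<open>s\<close> with
  positive lower limit, so \<open>Q (n+2)\<close> is at most a constant times
  \<open>Q (n+1) powr s\<close>; the constant is swallowed by
  \<open>Q (n+1) powr (u - s)\<close>.\<close>

lemma eventually_Q_le:
  assumes u: "0 < u" "irr_exponent \<theta> < ereal u"
  shows "\<forall>\<^sub>F n in sequentially. real (Q (Suc (Suc n))) \<le> real (Q (Suc n)) powr u"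
proof -
  let ?L = "\<lambda>s. liminf (\<lambda>j::nat. ereal (real j powr s * dist_int (real j * \<theta>)))"
  obtain s where s: "irr_exponent \<theta> < ereal s" "0 < s" "s < u"
  proof -
    have "max (irr_exponent \<theta>) 0 < ereal u" using u by simp
    then obtain z where "max (irr_exponent \<theta>) 0 < z" "z < ereal u" using dense by blast
    then show ?thesis using that by (cases z) auto
  qed
  have "?L s \<noteq> 0"
  proof
    assume "?L s = 0"
    then have "ereal s \<le> irr_exponent \<theta>"
      unfolding irr_exponent_def using s by (intro Sup_upper) auto
    then show False using s(1) by simp
  qed
  moreover have "0 \<le> ?L s"
    by (rule Liminf_bounded) (simp add: dist_int_nonneg)
  ultimately have "0 < ?L s" by simp
  then obtain z where z: "0 < z" "z < ?L s" using dense by blast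
  then obtain c where c: "0 < c" "ereal c \<le> z" by (metis ereal_dense2 less_imp_le less_ereal.simps(1) zero_ereal_def)
  have "\<forall>\<^sub>F j in sequentially. z < ereal (real j powr s * dist_int (real j * \<theta>))"
    using z(2) by (rule less_LiminfD)
  then have "\<forall>\<^sub>F n in sequentially. z < ereal (real (Q (Suc n)) powr s * dist_int (real (Q (Suc n)) * \<theta>))"
    by (rule eventually_compose_filterlim)
       (rule filterlim_at_top_mono[OF filterlim_ident], simp add: Q_ge)
  moreover have "\<forall>\<^sub>F n in sequentially. (1 / c) powr (1 / (u - s)) \<le> real (Q (Suc n))"
    using filterlim_Q by (simp add: filterlim_at_top)
  ultimately show ?thesis
  proof eventually_elim
    case (elim n)
    let ?q = "real (Q (Suc n))"
    have q: "?q > 0" using Q_pos[of n] by simp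
    have "c < ?q powr s * dist_int (?q * \<theta>)" using elim(1) c(2) by (metis le_less_trans less_ereal.simps(1))
    also have "\<dots> \<le> ?q powr s * (1 / real (Q (Suc (Suc n))))"
      using dist_int_Q[of n] D_le[of "Suc n"] by (intro mult_left_mono) auto
    finally have "real (Q (Suc (Suc n))) * c < ?q powr s"
      using Q_pos[of "Suc n"] by (simp add: field_simps)
    then have "real (Q (Suc (Suc n))) < ?q powr s * (1 / c)" using c by (simp add: field_simps)
    also have "1 / c = ((1 / c) powr (1 / (u - s))) powr (u - s)"
      using c s by (simp add: powr_powr)
    also have "\<dots> \<le> ?q powr (u - s)"
      using elim(2) s by (intro powr_mono2) auto
    also have "?q powr s * ?q powr (u - s) = ?q powr u" by (simp add: powr_add[symmetric])
    finally show ?case by (simp add: mult_left_mono)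
  qed
qed

text \<open>A well-approximated \<open>j\<close> is placed between consecutive denominators. By best
  approximation it does no better than \<open>D (n+1)\<close>, which is at least
  \<open>1 / (2 * Q (n+2))\<close>; this is where the 2 comes from.\<close>

lemma frequently_Q_ge:
  assumes "0 < s" "ereal s < irr_exponent \<theta>"
  shows "\<exists>n\<ge>N. real (Q (Suc n)) powr s \<le> 2 * real (Q (Suc (Suc n)))"
proof -
  obtain j where j: "j \<ge> Q (Suc N)" "0 < j" "dist_int (real j * \<theta>) < real j powr (- s)"
    using frequently_dist_int_less[OF assms] by blast
  define n where "n = (LEAST n. j < Q (Suc (Suc n)))"
  have "j < Q (Suc (Suc j))" using Q_ge[of "Suc j"] by simp
  then have n: "j < Q (Suc (Suc n))" unfolding n_def by (rule LeastI)
  have nN: "N \<le> n"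
  proof (rule ccontr)
    assume "\<not> N \<le> n"
    then have "Q (Suc (Suc n)) \<le> Q (Suc N)" by (intro Q_mono_le) simp
    then show False using n j by simp
  qed
  have "Q (Suc n) \<le> j"
  proof (cases n)
    case 0
    then show ?thesis using j by simp
  next
    case (Suc m)
    then show ?thesis using not_less_Least[of m "\<lambda>n. j < Q (Suc (Suc n))"] by (auto simp: n_def)
  qed
  then have "real (Q (Suc n)) powr s \<le> real j powr s" using assms by (intro powr_mono2) auto
  moreover have "1 / (2 * real (Q (Suc (Suc n)))) < real j powr (- s)"
    using D_ge[of "Suc n"] best_approximation[OF j(2) n] j(3) by linarith
  then have "real j powr s < 2 * real (Q (Suc (Suc n)))"
    using j(2) Q_pos[of "Suc n"] by (simp add: powr_minus field_simps)
  ultimately show ?thesis using nN by (intro exI[of _ n]) simp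
qed

end

section \<open>Upper bounds\<close>

lemma eventually_mult_powr_neg_le:
  fixes c e \<epsilon> :: real
  assumes "e > 0" "\<epsilon> > 0"
  shows "\<forall>\<^sub>F x in at_top. c * x powr (- e) \<le> \<epsilon>"
proof -
  have "((\<lambda>x::real. c * x powr (- e)) \<longlongrightarrow> c * 0) at_top"
    using assms by (intro tendsto_mult tendsto_const tendsto_neg_powr filterlim_ident) auto
  then have "\<forall>\<^sub>F x in at_top. c * x powr (- e) < \<epsilon>"
    using assms by (intro order_tendstoD) auto
  then show ?thesis by eventually_elim simp
qed

lemma eventually_le_powr:
  fixes c e :: real
  assumes "e > 0"
  shows "\<forall>\<^sub>F x in at_top. c \<le> x powr e"
proof -
  have "\<forall>\<^sub>F x::real in at_top. (\<bar>c\<bar> + 1) powr (1 / e) \<le> x" by (rule eventually_ge_at_top)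
  then show ?thesis
  proof eventually_elim
    case (elim x)
    have "c \<le> ((\<bar>c\<bar> + 1) powr (1 / e)) powr e" using assms by (simp add: powr_powr)
    also have "\<dots> \<le> x powr e" using elim assms by (intro powr_mono2) auto
    finally show ?case .
  qed
qed

text \<open>Rounding down \<open>(z x - c) / \<delta>\<close> is injective on \<open>A\<close>, so
  finiteness comes out together with the count.\<close>

lemma card_le_of_separated:
  fixes z :: "'s \<Rightarrow> real"
  assumes \<delta>: "\<delta> > 0" and z: "\<And>x. x \<in> A \<Longrightarrow> z x \<in> {c..c + L}"
    and sep: "\<And>x y. x \<in> A \<Longrightarrow> y \<in> A \<Longrightarrow> x \<noteq> y \<Longrightarrow> \<delta> \<le> \<bar>z x - z y\<bar>" and L: "0 \<le> L"
  shows "finite A \<and> real (card A) \<le> L / \<delta> + 1"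
proof -
  define g where "g x = \<lfloor>(z x - c) / \<delta>\<rfloor>" for x
  have inj: "inj_on g A"
  proof (rule inj_onI, rule ccontr)
    fix x y assume xy: "x \<in> A" "y \<in> A" "g x = g y" "x \<noteq> y"
    have "\<bar>(z x - c) / \<delta> - (z y - c) / \<delta>\<bar> < 1"
      using xy(3) unfolding g_def by linarith
    moreover have "(z x - c) / \<delta> - (z y - c) / \<delta> = (z x - z y) / \<delta>" by (simp add: diff_divide_distrib)
    ultimately have "\<bar>z x - z y\<bar> < \<delta>" using \<delta> by (simp add: abs_divide)
    then show False using sep[OF xy(1,2,4)] by simp
  qed
  have "g ` A \<subseteq> {0..\<lfloor>L / \<delta>\<rfloor>}"
  proof
    fix k assume "k \<in> g ` A"
    then obtain x where x: "x \<in> A" "k = g x" by blast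
    have "(z x - c) / \<delta> \<le> L / \<delta>" "0 \<le> (z x - c) / \<delta>"
      using z[OF x(1)] \<delta> by (auto intro!: divide_right_mono)
    then have "\<lfloor>(z x - c) / \<delta>\<rfloor> \<le> \<lfloor>L / \<delta>\<rfloor>" "0 \<le> \<lfloor>(z x - c) / \<delta>\<rfloor>"
      by (simp_all only: floor_mono zero_le_floor)
    then show "k \<in> {0..\<lfloor>L / \<delta>\<rfloor>}" unfolding x(2) g_def by simp
  qed
  then have "finite (g ` A)" "card (g ` A) \<le> card {0..\<lfloor>L / \<delta>\<rfloor>}"
    by (rule finite_subset[OF _ finite_atLeastAtMost_int], rule card_mono[OF finite_atLeastAtMost_int])
  moreover have "real (card {0..\<lfloor>L / \<delta>\<rfloor>}) \<le> L / \<delta> + 1"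
  proof -
    have "0 \<le> \<lfloor>L / \<delta>\<rfloor>" using L \<delta> by simp
    then have "real (card {0..\<lfloor>L / \<delta>\<rfloor>}) = of_int \<lfloor>L / \<delta>\<rfloor> + 1" by simp
    then show ?thesis using of_int_floor_le[of "L / \<delta>"] by linarith
  qed
  ultimately show ?thesis using inj by (auto simp: card_image finite_image_iff)
qed

text \<open>Remainders run from 1 to \<open>q\<close> instead of from 0, because only positive
  indices are allowed in the approximation.\<close>

lemma residue_in_1_to:
  fixes m q :: nat
  assumes "1 \<le> m" "0 < q"
  obtains b i where "m = b * q + i" "i \<in> {1..q}"
proof (rule that)
  show "m = (m - 1) div q * q + ((m - 1) mod q + 1)"
    using div_mult_mod_eq[of "m - 1" q] assms(1) by linarith
  show "(m - 1) mod q + 1 \<in> {1..q}" using mod_less_divisor[OF assms(2), of "m - 1"] by simp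
qed

text \<open>The uniform set is the countable union of these over integer thresholds. On each of them
  the approximation holds from a common \<open>T\<close> on, which makes covers at a single scale
  possible.\<close>

definition unif_from :: "real \<Rightarrow> real \<Rightarrow> real \<Rightarrow> real set" where
  "unif_from \<tau> \<theta> T = {y \<in> {0..<1}. \<forall>X\<ge>T. \<exists>n::nat. 1 \<le> n \<and> real n \<le> X \<and> dist_int (real n * \<theta> - y) < X powr (- \<tau>)}"

lemma unif_fromE:
  assumes "y \<in> unif_from \<tau> \<theta> T" "T \<le> X"
  obtains n :: nat where "1 \<le> n" "real n \<le> X" "dist_int (real n * \<theta> - y) < X powr (- \<tau>)"
  using assms by (auto simp: unif_from_def)

lemma unif_set_eq: "unif_set \<tau> \<theta> = (\<Union>K::nat. unif_from \<tau> \<theta> (real K))"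
proof -
  have "\<exists>K::nat. y \<in> unif_from \<tau> \<theta> (real K)" if "y \<in> unif_from \<tau> \<theta> T" for y T
  proof -
    obtain K :: nat where "T \<le> real K" using real_arch_simple by blast
    then have "y \<in> unif_from \<tau> \<theta> (real K)" using that unfolding unif_from_def by auto
    then show ?thesis ..
  qed
  then have "(\<Union>T. unif_from \<tau> \<theta> T) = (\<Union>K::nat. unif_from \<tau> \<theta> (real K))" by blast
  moreover have "unif_set \<tau> \<theta> = (\<Union>T. unif_from \<tau> \<theta> T)"
    by (simp add: unif_set_def unif_from_def set_eq_iff)
  ultimately show ?thesis by simp
qed

section \<open>Covers at a single scale\<close>

context irrational_rotation begin

text \<open>Any well-approximated \<open>j\<close> can take the place of a denominator: indices up
  to \<open>X\<close> are reduced modulo \<open>j\<close>, which moves the point by at most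
  \<open>(X / j) * j powr (- \<sigma>)\<close>. The exponent \<open>p\<close> makes this equal to
  \<open>X powr (- \<tau>)\<close>, so \<open>j\<close> balls of radius
  \<open>2 * X powr (- \<tau>)\<close> suffice; the exponent \<open>e\<close> in the resulting sum
  is positive exactly by the assumption on \<open>s\<close>.\<close>

lemma hausdorff_measure_unif_set_eq_0:
  assumes \<tau>: "\<tau> > 0" and \<sigma>: "\<sigma> > 0" "ereal \<sigma> < irr_exponent \<theta>" and s: "(1 / \<tau> + 1) / (\<sigma> + 1) < s"
  shows "hausdorff_measure s (unif_set \<tau> \<theta>) = 0"
  unfolding unif_set_eq
proof (rule hausdorff_measure_torus_eq_0I[where x = "\<lambda>i. real i * \<theta>"])
  show s0: "s > 0"
  proof -
    have "0 < (1 / \<tau> + 1) / (\<sigma> + 1)" using \<tau> \<sigma> by (intro divide_pos_pos add_pos_pos) auto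
    then show ?thesis using s by linarith
  qed
  show "unif_from \<tau> \<theta> (real K) \<subseteq> {0..<1}" for K by (auto simp: unif_from_def)
  fix K :: nat and \<epsilon> :: real assume \<epsilon>: "\<epsilon> > 0"
  define p where "p = (\<sigma> + 1) / (1 + \<tau>)"
  define e where "e = p * \<tau> * s - 1"
  have p: "p > 0" using \<tau> \<sigma> by (simp add: p_def)
  have "1 / \<tau> + 1 < s * (\<sigma> + 1)" using s \<sigma> by (simp add: pos_divide_less_eq)
  then have "(1 / \<tau> + 1) * \<tau> < s * (\<sigma> + 1) * \<tau>" using \<tau> by (rule mult_strict_right_mono)
  then have "1 + \<tau> < s * (\<sigma> + 1) * \<tau>" using \<tau> by (simp add: algebra_simps)
  then have e: "e > 0" using \<tau> by (simp add: e_def p_def pos_less_divide_eq algebra_simps)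
  have "\<forall>\<^sub>F x in at_top. real K \<le> x powr p \<and> 2 powr s * x powr (- e) \<le> \<epsilon>"
    by (intro eventually_conj eventually_le_powr eventually_mult_powr_neg_le p e \<epsilon>)
  then obtain x0 where x0: "\<And>x. x \<ge> x0 \<Longrightarrow> real K \<le> x powr p \<and> 2 powr s * x powr (- e) \<le> \<epsilon>"
    unfolding eventually_at_top_linorder by blast
  obtain j where j: "j \<ge> nat \<lceil>x0\<rceil>" "0 < j" "dist_int (real j * \<theta>) < real j powr (- \<sigma>)"
    using frequently_dist_int_less[OF \<sigma>] by blast
  define X where "X = real j powr p"
  have jx: "real K \<le> X" "2 powr s * real j powr (- e) \<le> \<epsilon>"
    using x0[of "real j"] j(1) by (auto simp: X_def nat_ceiling_le_eq)
  have X: "X > 0" using j by (simp add: X_def)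
  have Xp: "X * real j powr (- \<sigma> - 1) = X powr (- \<tau>)"
  proof -
    have "p + (- \<sigma> - 1) = p * (- \<tau>)" using \<tau> by (simp add: p_def field_simps)
    then show ?thesis by (simp add: X_def powr_powr powr_add[symmetric])
  qed
  show "\<exists>I R. finite I \<and> R \<ge> 0 \<and> real (card I) * R powr s \<le> \<epsilon> \<and>
        (\<forall>y\<in>unif_from \<tau> \<theta> (real K). \<exists>i\<in>I. dist_int (real i * \<theta> - y) \<le> R)"
  proof (intro exI[of _ "{1..j}"] exI[of _ "2 * X powr (- \<tau>)"] conjI ballI)
    have "real (card {1..j}) * (2 * X powr (- \<tau>)) powr s = 2 powr s * (real j powr 1 * real j powr (p * (- \<tau>) * s))"
      using j by (simp add: powr_mult X_def powr_powr mult_ac)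
    also have "\<dots> = 2 powr s * real j powr (- e)"
      by (simp only: powr_add[symmetric]) (simp add: e_def)
    finally show "real (card {1..j}) * (2 * X powr (- \<tau>)) powr s \<le> \<epsilon>" using jx by simp
    fix y assume "y \<in> unif_from \<tau> \<theta> (real K)"
    then obtain m where m: "1 \<le> m" "real m \<le> X" "dist_int (real m * \<theta> - y) < X powr (- \<tau>)"
      using jx(1) by (rule unif_fromE)
    obtain b i where bi: "m = b * j + i" "i \<in> {1..j}" using residue_in_1_to[OF m(1) j(2)] by blast
    have "dist_int (real i * \<theta> - real m * \<theta>) = dist_int (real b * (real j * \<theta>))"
      by (subst dist_int_commute) (simp add: bi algebra_simps)
    also have "\<dots> \<le> real b * dist_int (real j * \<theta>)" by (rule dist_int_multiple)
    also have "\<dots> \<le> (X / real j) * real j powr (- \<sigma>)"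
    proof (rule mult_mono)
      have "real b * real j \<le> real m" by (simp add: bi)
      then show "real b \<le> X / real j" using m j by (simp add: pos_le_divide_eq)
    qed (use j X dist_int_nonneg in auto)
    also have "\<dots> = X * real j powr (- \<sigma> - 1)" using j by (simp add: powr_diff)
    finally have "dist_int (real i * \<theta> - real m * \<theta>) \<le> X powr (- \<tau>)" by (simp only: Xp)
    then have "dist_int (real i * \<theta> - y) \<le> 2 * X powr (- \<tau>)"
      using dist_int_diff_triangle[of "real i * \<theta>" y "real m * \<theta>"] m(3) by linarith
    then show "\<exists>i\<in>{1..j}. dist_int (real i * \<theta> - y) \<le> 2 * X powr (- \<tau>)" using bi by blast
  qed auto
qed

text \<open>The first \<open>X\<close> orbit points form \<open>Q (n+1)\<close> clusters of length about \<open>X / (Q (n+1) * Q (n+2))\<close>.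
  \<open>crit_scale\<close> is the \<open>X\<close> for which this equals the radius \<open>X powr (-\<tau>)\<close>.\<close>

definition crit_scale :: "real \<Rightarrow> nat \<Rightarrow> real" where
  "crit_scale \<tau> n = (real (Q (Suc n)) * real (Q (Suc (Suc n)))) powr (1 / (1 + \<tau>))"

lemma crit_scale_pos: "crit_scale \<tau> n > 0"
  using Q_pos[of n] Q_pos[of "Suc n"] by (simp add: crit_scale_def)

lemma crit_scale_powr:
  assumes "\<tau> > 0"
  shows "crit_scale \<tau> n powr (1 + \<tau>) = real (Q (Suc n)) * real (Q (Suc (Suc n)))"
  using assms Q_pos[of n] Q_pos[of "Suc n"] by (simp add: crit_scale_def powr_powr)

text \<open>The orbit point that serves \<open>y\<close> at the critical scale is reduced modulo
  \<open>Q (n+1)\<close>, at a cost of at most \<open>X powr (- \<tau>)\<close>. By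
  \<open>small\<close> the reduced index \<open>k\<close> and \<open>i\<close> give points closer
  than the gap \<open>D n\<close>, so \<open>k = i\<close>: the ball around \<open>i\<close> shrinks
  from the scale \<open>Q (n+1)\<close> to the critical one.\<close>

lemma localization:
  assumes \<tau>: "\<tau> > 0" and y: "y \<in> unif_from \<tau> \<theta> T" "T \<le> crit_scale \<tau> n"
    and i: "i \<in> {1..Q (Suc n)}" "dist_int (real i * \<theta> - y) < real (Q (Suc n)) powr (- \<tau>)"
    and small: "2 * crit_scale \<tau> n powr (- \<tau>) + real (Q (Suc n)) powr (- \<tau>) \<le> 1 / (2 * real (Q (Suc n)))"
  shows "dist_int (real i * \<theta> - y) \<le> 2 * crit_scale \<tau> n powr (- \<tau>)"
proof -
  define X where "X = crit_scale \<tau> n"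
  let ?q = "real (Q (Suc n))" and ?q' = "real (Q (Suc (Suc n)))"
  have X: "X > 0" by (simp add: X_def crit_scale_pos)
  have q: "?q > 0" "?q' > 0" using Q_pos[of n] Q_pos[of "Suc n"] by auto
  have Xq: "X / (?q * ?q') = X powr (- \<tau>)"
  proof -
    have "X powr 1 = X powr (1 + \<tau>) * X powr (- \<tau>)" by (simp add: powr_add[symmetric])
    then show ?thesis using X q by (simp add: crit_scale_powr[OF \<tau>] X_def field_simps)
  qed
  obtain m where m: "1 \<le> m" "real m \<le> X" "dist_int (real m * \<theta> - y) < X powr (- \<tau>)"
    using y unfolding X_def by (rule unif_fromE)
  obtain b k where bk: "m = b * Q (Suc n) + k" "k \<in> {1..Q (Suc n)}"
    using residue_in_1_to[OF m(1) Q_pos] by blast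
  have "dist_int (real k * \<theta> - real m * \<theta>) = dist_int (real b * (?q * \<theta>))"
    by (subst dist_int_commute) (simp add: bk algebra_simps)
  also have "\<dots> \<le> real b * dist_int (?q * \<theta>)" by (rule dist_int_multiple)
  also have "\<dots> \<le> (X / ?q) * (1 / ?q')"
  proof (rule mult_mono)
    have "real b * ?q \<le> real m" by (simp add: bk)
    then show "real b \<le> X / ?q" using m q by (simp add: pos_le_divide_eq)
    show "dist_int (?q * \<theta>) \<le> 1 / ?q'" using dist_int_Q[of n] D_le[of "Suc n"] by linarith
  qed (use X q dist_int_nonneg in auto)
  finally have "dist_int (real k * \<theta> - real m * \<theta>) \<le> X powr (- \<tau>)" by (simp add: Xq)
  then have ky: "dist_int (real k * \<theta> - y) < 2 * X powr (- \<tau>)"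
    using dist_int_diff_triangle[of "real k * \<theta>" y "real m * \<theta>"] m(3) by linarith
  have "dist_int (real k * \<theta> - real i * \<theta>) \<le> dist_int (real k * \<theta> - y) + dist_int (real i * \<theta> - y)"
    using dist_int_diff_triangle[of "real k * \<theta>" "real i * \<theta>" y] dist_int_commute[of y] by simp
  then have "dist_int (real k * \<theta> - real i * \<theta>) < D n"
    using ky i(2) small D_ge[of n] unfolding X_def by linarith
  then have "k = i" using orbit_separated[OF bk(2) i(1)] by linarith
  then show ?thesis using ky by (simp add: X_def)
qed

text \<open>The clusters of stage \<open>n\<close> that still meet the set. For
  \<open>\<tau> > 1\<close> these are much fewer than \<open>Q (n+1)\<close>, and their number is
  followed from stage to stage.\<close>

definition survivors :: "real \<Rightarrow> real \<Rightarrow> nat \<Rightarrow> nat set" where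
  "survivors \<tau> T n = {i \<in> {1..Q (Suc n)}. \<exists>y\<in>unif_from \<tau> \<theta> T. dist_int (real i * \<theta> - y) < real (Q (Suc n)) powr (- \<tau>)}"

lemma survivors_finite: "finite (survivors \<tau> T n)"
  by (simp add: survivors_def)

lemma survivor_near:
  assumes "y \<in> unif_from \<tau> \<theta> T" "T \<le> real (Q (Suc n))"
  obtains i where "i \<in> survivors \<tau> T n" "dist_int (real i * \<theta> - y) < real (Q (Suc n)) powr (- \<tau>)"
proof -
  obtain m where m: "1 \<le> m" "real m \<le> real (Q (Suc n))" "dist_int (real m * \<theta> - y) < real (Q (Suc n)) powr (- \<tau>)"
    using assms by (rule unif_fromE)
  show ?thesis using m assms by (intro that[of m]) (auto simp: survivors_def)
qed

lemma card_near_point: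
  assumes "R \<ge> 0"
  shows "real (card {i \<in> {1..Q (Suc n)}. dist_int (real i * \<theta> - x) \<le> R}) \<le> 4 * real (Q (Suc n)) * R + 1"
proof -
  let ?q = "real (Q (Suc n))"
  \<comment> \<open>The signed distance to the nearest integer moves the nearby orbit points into
    one interval of the line, and no two of them come closer than their torus distance.\<close>
  define z where "z i = real i * \<theta> - x - of_int (round (real i * \<theta> - x))" for i :: nat
  have q: "?q > 0" using Q_pos[of n] by simp
  have "real (card {i \<in> {1..Q (Suc n)}. dist_int (real i * \<theta> - x) \<le> R}) \<le> 2 * R / (1 / (2 * ?q)) + 1"
  proof (rule card_le_of_separated[where z = z and c = "- R", THEN conjunct2])
    fix i assume "i \<in> {i \<in> {1..Q (Suc n)}. dist_int (real i * \<theta> - x) \<le> R}"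
    then show "z i \<in> {- R..- R + 2 * R}" by (auto simp: z_def dist_int_def abs_le_iff)
  next
    fix i j assume "i \<in> {i \<in> {1..Q (Suc n)}. dist_int (real i * \<theta> - x) \<le> R}"
      "j \<in> {i \<in> {1..Q (Suc n)}. dist_int (real i * \<theta> - x) \<le> R}" "i \<noteq> j"
    then have "D n \<le> dist_int (real i * \<theta> - real j * \<theta>)" by (intro orbit_separated) auto
    also have "\<dots> \<le> \<bar>z i - z j\<bar>"
    proof -
      have "real i * \<theta> - real j * \<theta> - (z i - z j) = of_int (round (real i * \<theta> - x) - round (real j * \<theta> - x))"
        by (simp add: z_def)
      then show ?thesis by (intro dist_int_le_if_Ints) (metis Ints_of_int)
    qed
    finally show "1 / (2 * ?q) \<le> \<bar>z i - z j\<bar>" using D_ge[of n] by linarith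
  qed (use assms q in auto)
  then show ?thesis by (simp add: mult_ac)
qed

text \<open>A point that witnesses a survivor of stage \<open>n+1\<close> also lies near some
  survivor of stage \<open>n\<close>, so \<open>F\<close> lists the possible successors and
  \<open>B\<close> bounds the branching.\<close>

lemma card_survivors_Suc_le:
  assumes T: "T \<le> real (Q (Suc n))" and B: "B \<ge> 0"
    and F: "\<And>y i i'. y \<in> unif_from \<tau> \<theta> T \<Longrightarrow> i \<in> {1..Q (Suc n)} \<Longrightarrow> i' \<in> {1..Q (Suc (Suc n))} \<Longrightarrow>
       dist_int (real i * \<theta> - y) < real (Q (Suc n)) powr (- \<tau>) \<Longrightarrow>
       dist_int (real i' * \<theta> - y) < real (Q (Suc (Suc n))) powr (- \<tau>) \<Longrightarrow> i' \<in> F i"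
    and fin: "\<And>i. finite (F i)" and card: "\<And>i. real (card (F i)) \<le> B"
  shows "real (card (survivors \<tau> T (Suc n))) \<le> real (card (survivors \<tau> T n)) * B"
proof -
  have "survivors \<tau> T (Suc n) \<subseteq> (\<Union>i\<in>survivors \<tau> T n. F i)"
  proof
    fix i' assume "i' \<in> survivors \<tau> T (Suc n)"
    then obtain y where y: "i' \<in> {1..Q (Suc (Suc n))}" "y \<in> unif_from \<tau> \<theta> T"
      "dist_int (real i' * \<theta> - y) < real (Q (Suc (Suc n))) powr (- \<tau>)" by (auto simp: survivors_def)
    obtain i where i: "i \<in> survivors \<tau> T n" "dist_int (real i * \<theta> - y) < real (Q (Suc n)) powr (- \<tau>)"
      using y(2) T by (rule survivor_near)
    have "i' \<in> F i" using i y by (intro F[of y]) (auto simp: survivors_def)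
    then show "i' \<in> (\<Union>i\<in>survivors \<tau> T n. F i)" using i by blast
  qed
  then have "card (survivors \<tau> T (Suc n)) \<le> card (\<Union>i\<in>survivors \<tau> T n. F i)"
    by (intro card_mono finite_UN_I survivors_finite fin)
  also have "\<dots> \<le> (\<Sum>i\<in>survivors \<tau> T n. card (F i))" by (rule card_UN_le[OF survivors_finite])
  finally have "real (card (survivors \<tau> T (Suc n))) \<le> (\<Sum>i\<in>survivors \<tau> T n. real (card (F i)))"
    using of_nat_mono by fastforce
  also have "\<dots> \<le> (\<Sum>i\<in>survivors \<tau> T n. B)" by (intro sum_mono card)
  finally show ?thesis by simp
qed

end

text \<open>Logarithmic form of the branching estimate, with \<open>L = ln q\<close> and
  \<open>L' = ln q'\<close>: the number of successors is about \<open>crit_scale / q\<close>, whose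
  logarithm is \<open>(L' - \<tau> * L) / (1 + \<tau>)\<close>. For \<open>\<tau> > 1\<close> the
  ratio of this to \<open>L' - L\<close> increases with \<open>L'\<close>, so
  \<open>L' = u * L\<close> is the extreme case; \<open>c\<close> stands for the logarithm of the
  constant.\<close>

lemma growth_exponent_bound:
  fixes L L' :: real
  assumes "1 < \<tau>" "\<tau> < u" "0 \<le> \<epsilon>" "L' \<le> u * L" "c \<le> \<epsilon> * (L' - L)"
  shows "c + (L' - \<tau> * L) / (1 + \<tau>) \<le> ((u - \<tau>) / ((1 + \<tau>) * (u - 1)) + \<epsilon>) * (L' - L)"
proof -
  have "0 \<le> (\<tau> - 1) * (u * L - L')" using assms by simp
  also have "\<dots> = (u - \<tau>) * (L' - L) - (L' - \<tau> * L) * (u - 1)" by (simp add: algebra_simps)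
  finally have "(L' - \<tau> * L) * (u - 1) \<le> (u - \<tau>) * (L' - L)" by simp
  then have "(L' - \<tau> * L) * (u - 1) / ((1 + \<tau>) * (u - 1)) \<le> (u - \<tau>) * (L' - L) / ((1 + \<tau>) * (u - 1))"
    using assms by (intro divide_right_mono) auto
  then have "(L' - \<tau> * L) / (1 + \<tau>) \<le> (u - \<tau>) / ((1 + \<tau>) * (u - 1)) * (L' - L)"
    using assms by simp
  then show ?thesis using assms by (simp add: distrib_right)
qed

section \<open>Growth of the number of survivors for \<open>\<tau> > 1\<close>\<close>

context irrational_rotation begin

lemma crit_scale_ge:
  assumes \<tau>: "\<tau> > 0" and q': "real (Q (Suc n)) powr \<tau> \<le> 4 * real (Q (Suc (Suc n)))"
  shows "real (Q (Suc n)) / 4 \<le> crit_scale \<tau> n"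
proof -
  let ?q = "real (Q (Suc n))"
  have q: "?q > 0" using Q_pos[of n] by simp
  have "(?q / 4) powr (1 + \<tau>) = ?q * ?q powr \<tau> / 4 powr (1 + \<tau>)"
    using q by (simp add: powr_divide powr_add)
  also have "\<dots> \<le> ?q * ?q powr \<tau> / 4 powr 1"
    using q \<tau> by (intro divide_left_mono powr_mono mult_pos_pos) auto
  also have "\<dots> \<le> ?q * (4 * real (Q (Suc (Suc n)))) / 4"
    using mult_left_mono[OF q', of ?q] by simp
  also have "\<dots> = crit_scale \<tau> n powr (1 + \<tau>)" by (simp add: crit_scale_powr[OF \<tau>])
  finally have le: "(?q / 4) powr (1 + \<tau>) \<le> crit_scale \<tau> n powr (1 + \<tau>)" .
  show ?thesis
  proof (rule ccontr)
    assume "\<not> ?q / 4 \<le> crit_scale \<tau> n"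
    then have "crit_scale \<tau> n powr (1 + \<tau>) < (?q / 4) powr (1 + \<tau>)"
      using \<tau> crit_scale_pos[of \<tau> n] by (intro powr_less_mono2) auto
    then show False using le by simp
  qed
qed

text \<open>If \<open>Q (n+2)\<close> is less than about \<open>Q (n+1) powr \<tau>\<close>, the balls are shorter than the new gaps and every
  survivor has at most one successor; otherwise it has about \<open>crit_scale \<tau> n / Q (n+1)\<close> of them. Since the
  constant 16 only enters in the second case, it is absorbed by the growth of \<open>Q\<close>.\<close>

lemma card_survivors_step:
  assumes \<tau>: "\<tau> > 1" and u: "\<tau> < u" and \<epsilon>: "\<epsilon> > 0"
    and q1: "4 * T \<le> real (Q (Suc n))" "T \<le> real (Q (Suc n))"
    and q'u: "real (Q (Suc (Suc n))) \<le> real (Q (Suc n)) powr u"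
    and small: "2 * (4 powr \<tau> * real (Q (Suc n)) powr (- \<tau>)) + real (Q (Suc n)) powr (- \<tau>) \<le> 1 / (2 * real (Q (Suc n)))"
    and large: "(16 powr (1 / \<epsilon>) * 4) \<le> real (Q (Suc n)) powr (\<tau> - 1)"
  defines "\<nu> \<equiv> (u - \<tau>) / ((1 + \<tau>) * (u - 1)) + \<epsilon>"
  shows "real (card (survivors \<tau> T (Suc n))) \<le>
    real (card (survivors \<tau> T n)) * (real (Q (Suc (Suc n))) / real (Q (Suc n))) powr \<nu>"
proof (cases "4 * real (Q (Suc (Suc n))) \<le> real (Q (Suc n)) powr \<tau>")
  case True
  let ?q = "real (Q (Suc n))" and ?q' = "real (Q (Suc (Suc n)))"
  have q: "0 < ?q" "?q \<le> ?q'" using Q_pos[of n] Q_mono[of "Suc n"] by auto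
  have \<nu>: "\<nu> \<ge> 0" using \<tau> u \<epsilon> by (simp add: \<nu>_def)
  have "real (card (survivors \<tau> T (Suc n))) \<le> real (card (survivors \<tau> T n)) * 1"
  proof (rule card_survivors_Suc_le[where F = "\<lambda>i. {i}"])
    fix y i i'
    assume A: "i \<in> {1..Q (Suc n)}" "i' \<in> {1..Q (Suc (Suc n))}"
       "dist_int (real i * \<theta> - y) < ?q powr (- \<tau>)" "dist_int (real i' * \<theta> - y) < ?q' powr (- \<tau>)"
    have "?q' powr (- \<tau>) \<le> ?q powr (- \<tau>)" using q \<tau> by (intro powr_mono2') auto
    moreover have "dist_int (real i' * \<theta> - real i * \<theta>) \<le> dist_int (real i' * \<theta> - y) + dist_int (real i * \<theta> - y)"
      using dist_int_diff_triangle[of "real i' * \<theta>" "real i * \<theta>" y] dist_int_commute[of y] by simp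
    ultimately have "dist_int (real i' * \<theta> - real i * \<theta>) < 2 * ?q powr (- \<tau>)" using A by linarith
    also have "2 * ?q powr (- \<tau>) \<le> 1 / (2 * ?q')"
      using True q by (simp add: powr_minus field_simps)
    also have "\<dots> \<le> D (Suc n)" by (rule D_ge)
    finally have "dist_int (real i' * \<theta> - real i * \<theta>) < D (Suc n)" .
    moreover have "i \<in> {1..Q (Suc (Suc n))}" using A(1) Q_mono[of "Suc n"] by auto
    ultimately show "i' \<in> {i}" using orbit_separated[OF A(2), of i] by fastforce
  qed (use q1 in auto)
  also have "\<dots> \<le> real (card (survivors \<tau> T n)) * (?q' / ?q) powr \<nu>"
    using q \<nu> by (intro mult_left_mono ge_one_powr_ge_zero) auto
  finally show ?thesis .
next
  case False
  let ?q = "real (Q (Suc n))" and ?q' = "real (Q (Suc (Suc n)))"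
  define X where "X = crit_scale \<tau> n"
  have q: "0 < ?q" "?q \<le> ?q'" "0 < ?q'" "1 \<le> ?q'" using Q_pos[of n] Q_pos[of "Suc n"] Q_mono[of "Suc n"] by auto
  have Xq: "?q / 4 \<le> X" unfolding X_def using False \<tau> by (intro crit_scale_ge) auto
  have X: "X > 0" by (simp add: X_def crit_scale_pos)
  have Xp: "X powr (1 + \<tau>) = ?q * ?q'" using \<tau> by (simp add: X_def crit_scale_powr)
  have Xt: "X powr (- \<tau>) = X / (?q * ?q')"
    using Xp X q by (simp add: powr_minus powr_add field_simps)
  have "X powr (- \<tau>) \<le> (?q / 4) powr (- \<tau>)" using q Xq \<tau> by (intro powr_mono2') auto
  also have "\<dots> = 4 powr \<tau> * ?q powr (- \<tau>)" using q by (simp add: powr_minus powr_divide field_simps)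
  finally have sm: "2 * X powr (- \<tau>) + ?q powr (- \<tau>) \<le> 1 / (2 * ?q)" using small by linarith
  have Xq': "X \<le> ?q'"
  proof (rule ccontr)
    assume "\<not> X \<le> ?q'"
    then have "?q' powr (1 + \<tau>) < X powr (1 + \<tau>)" using q \<tau> by (intro powr_less_mono2) auto
    also have "\<dots> \<le> ?q' powr 1 * ?q' powr 1" using Xp q by simp
    also have "\<dots> = ?q' powr 2" by (simp only: powr_add[symmetric]) simp
    also have "\<dots> \<le> ?q' powr (1 + \<tau>)" using q \<tau> by (intro powr_mono) auto
    finally show False by simp
  qed
  \<comment> \<open>Two of the three radii come from \<open>localization\<close> at stage
    \<open>n\<close>, the third from the ball of stage \<open>n+1\<close>, whose radius is at most
    \<open>X powr (- \<tau>)\<close> because \<open>X \<le> q'\<close>.\<close>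
  define F where "F i = {i' \<in> {1..Q (Suc (Suc n))}. dist_int (real i' * \<theta> - real i * \<theta>) \<le> 3 * X powr (- \<tau>)}" for i
  define Y where "Y = X / ?q"
  have "real (card (survivors \<tau> T (Suc n))) \<le> real (card (survivors \<tau> T n)) * (16 * Y)"
  proof (rule card_survivors_Suc_le[where F = F])
    fix y i i'
    assume A: "y \<in> unif_from \<tau> \<theta> T" "i \<in> {1..Q (Suc n)}" "i' \<in> {1..Q (Suc (Suc n))}"
       "dist_int (real i * \<theta> - y) < ?q powr (- \<tau>)" "dist_int (real i' * \<theta> - y) < ?q' powr (- \<tau>)"
    have "dist_int (real i * \<theta> - y) \<le> 2 * X powr (- \<tau>)"
      unfolding X_def using A \<tau> q1 Xq sm by (intro localization[of \<tau> y T]) (auto simp: X_def)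
    moreover have "?q' powr (- \<tau>) \<le> X powr (- \<tau>)" using X Xq' \<tau> by (intro powr_mono2') auto
    moreover have "dist_int (real i' * \<theta> - real i * \<theta>) \<le> dist_int (real i' * \<theta> - y) + dist_int (real i * \<theta> - y)"
      using dist_int_diff_triangle[of "real i' * \<theta>" "real i * \<theta>" y] dist_int_commute[of y] by simp
    ultimately show "i' \<in> F i" using A by (simp add: F_def)
  next
    fix i
    have "real (card (F i)) \<le> 4 * ?q' * (3 * X powr (- \<tau>)) + 1"
      unfolding F_def by (rule card_near_point) simp
    also have "4 * ?q' * (3 * X powr (- \<tau>)) = 12 * Y" using q by (simp add: Xt Y_def)
    \<comment> \<open>From \<open>X \<ge> q / 4\<close> follows \<open>Y \<ge> 1/4\<close>, so the
      additional 1 is at most \<open>4 * Y\<close>.\<close>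
    also have "12 * Y + 1 \<le> 16 * Y" using Xq q by (simp add: Y_def field_simps)
    finally show "real (card (F i)) \<le> 16 * Y" .
  qed (use q1 X q in \<open>auto simp: Y_def F_def\<close>)
  also have "\<dots> \<le> real (card (survivors \<tau> T n)) * (?q' / ?q) powr \<nu>"
  proof (rule mult_left_mono)
    have Yp: "Y > 0" using X q by (simp add: Y_def)
    have qq: "?q' / ?q > 0" using q by simp
    define L where "L = ln ?q"
    define L' where "L' = ln ?q'"
    have lnX: "(1 + \<tau>) * ln X = L + L'"
      using arg_cong[OF Xp, of ln] q X by (simp add: ln_mult L_def L'_def ln_powr)
    have lnY: "ln Y = (L' - \<tau> * L) / (1 + \<tau>)"
    proof -
      have "ln Y = ln X - L" using X q by (simp add: Y_def ln_div L_def)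
      then have "(1 + \<tau>) * ln Y = (1 + \<tau>) * ln X - (1 + \<tau>) * L" by (simp only: right_diff_distrib)
      then have "(1 + \<tau>) * ln Y = L' - \<tau> * L" unfolding lnX by (simp add: algebra_simps)
      then show ?thesis using \<tau> by (simp add: field_simps)
    qed
    \<comment> \<open>In this case \<open>q'\<close> exceeds \<open>q powr \<tau> / 4\<close>, so by
      \<open>large\<close> the quotient \<open>q' / q\<close> is at least
      \<open>16 powr (1 / \<epsilon>)\<close>: the constant costs only the part
      \<open>\<epsilon>\<close> of the exponent \<open>\<nu>\<close>.\<close>
    have "ln 16 \<le> \<epsilon> * (L' - L)"
    proof -
      have "16 powr (1 / \<epsilon>) * ?q \<le> ?q' "
      proof -
        have "16 powr (1 / \<epsilon>) * 4 * ?q \<le> ?q powr (\<tau> - 1) * ?q" using large q by (intro mult_right_mono) auto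
        also have "\<dots> = ?q powr \<tau>" using q by (simp add: powr_diff)
        finally show ?thesis using False by simp
      qed
      then have "ln (16 powr (1 / \<epsilon>) * ?q) \<le> L'" unfolding L'_def using q by (intro ln_mono) auto
      then have "1 / \<epsilon> * ln 16 + L \<le> L'" using q by (simp add: ln_mult L_def ln_powr)
      then have "\<epsilon> * (1 / \<epsilon> * ln 16) \<le> \<epsilon> * (L' - L)" using \<epsilon> by (intro mult_left_mono) auto
      then show ?thesis using \<epsilon> by simp
    qed
    moreover have "L' \<le> u * L"
    proof -
      have "L' \<le> ln (?q powr u)" unfolding L'_def using q'u q by (intro ln_mono) auto
      then show ?thesis using q by (simp add: L_def ln_powr)
    qed
    ultimately have "ln 16 + ln Y \<le> \<nu> * (L' - L)"
      unfolding lnY \<nu>_def using \<tau> u \<epsilon> by (intro growth_exponent_bound) auto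
    then have "ln (16 * Y) \<le> ln ((?q' / ?q) powr \<nu>)"
      using Yp q qq by (simp add: ln_mult ln_powr ln_div L_def L'_def)
    moreover have "0 < 16 * Y" "0 < (?q' / ?q) powr \<nu>" using Yp q by simp_all
    ultimately show "16 * Y \<le> (?q' / ?q) powr \<nu>" using ln_le_cancel_iff by blast
  qed simp
  finally show ?thesis .
qed

text \<open>The two exponents have different tasks. With \<open>u\<close> the step estimates
  telescope to a count of survivors of order \<open>q powr \<nu>\<close> at every late stage; with
  \<open>\<sigma>\<close> there are infinitely many stages where \<open>q'\<close> is large and
  hence the arcs are short. The assumption on \<open>s\<close> lets the second effect win.\<close>

lemma hausdorff_measure_unif_set_eq_0':
  assumes \<tau>: "\<tau> > 1" and u: "\<tau> < u" "irr_exponent \<theta> < ereal u"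
    and \<sigma>: "\<sigma> > 0" "ereal \<sigma> < irr_exponent \<theta>"
    and s: "(u - \<tau>) / ((1 + \<tau>) * (u - 1)) < s * \<tau> * (1 + \<sigma>) / (1 + \<tau>)" and s0: "s > 0"
  shows "hausdorff_measure s (unif_set \<tau> \<theta>) = 0"
  unfolding unif_set_eq
proof (rule hausdorff_measure_torus_eq_0I[where x = "\<lambda>i. real i * \<theta>"])
  show "s > 0" by (rule s0)
  show "unif_from \<tau> \<theta> (real K) \<subseteq> {0..<1}" for K by (auto simp: unif_from_def)
  fix K :: nat and \<eta> :: real assume \<eta>: "\<eta> > 0"
  define T where "T = real K"
  \<comment> \<open>Half of the available slack enters \<open>\<nu>\<close> to absorb the branching
    constant; the other half remains as the power \<open>q powr (- \<epsilon>)\<close> that makes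
    the final sum small.\<close>
  define \<epsilon> where "\<epsilon> = (s * \<tau> * (1 + \<sigma>) / (1 + \<tau>) - (u - \<tau>) / ((1 + \<tau>) * (u - 1))) / 2"
  define \<nu> where "\<nu> = (u - \<tau>) / ((1 + \<tau>) * (u - 1)) + \<epsilon>"
  have \<epsilon>: "\<epsilon> > 0" using s by (simp add: \<epsilon>_def)
  have \<nu>: "\<nu> > 0" using \<tau> u \<epsilon> by (simp add: \<nu>_def add_nonneg_pos)
  have slack: "s * \<tau> * (1 + \<sigma>) / (1 + \<tau>) - \<nu> = \<epsilon>" by (simp add: \<nu>_def \<epsilon>_def field_simps)
  let ?q = "\<lambda>n. real (Q (Suc n))"
  have "\<forall>\<^sub>F x in at_top. (2 * 4 powr \<tau> + 1) * x powr (- (\<tau> - 1)) \<le> 1 / 2 \<and>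
      (16 powr (1 / \<epsilon>) * 4) \<le> x powr (\<tau> - 1) \<and> 4 * T \<le> x"
    using \<tau> by (intro eventually_conj eventually_le_powr eventually_mult_powr_neg_le eventually_ge_at_top) auto
  then have "\<forall>\<^sub>F n in sequentially. (2 * 4 powr \<tau> + 1) * ?q n powr (- (\<tau> - 1)) \<le> 1 / 2 \<and>
      (16 powr (1 / \<epsilon>) * 4) \<le> ?q n powr (\<tau> - 1) \<and> 4 * T \<le> ?q n"
    using filterlim_Q by (rule eventually_compose_filterlim)
  moreover have "\<forall>\<^sub>F n in sequentially. ?q (Suc n) \<le> ?q n powr u"
    using u \<tau> by (intro eventually_Q_le) auto
  ultimately have "\<forall>\<^sub>F n in sequentially. ((2 * 4 powr \<tau> + 1) * ?q n powr (- (\<tau> - 1)) \<le> 1 / 2 \<and>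
      (16 powr (1 / \<epsilon>) * 4) \<le> ?q n powr (\<tau> - 1) \<and> 4 * T \<le> ?q n) \<and> ?q (Suc n) \<le> ?q n powr u"
    by (rule eventually_conj)
  then obtain n0 where n0: "\<And>n. n \<ge> n0 \<Longrightarrow> (2 * 4 powr \<tau> + 1) * ?q n powr (- (\<tau> - 1)) \<le> 1 / 2"
    "\<And>n. n \<ge> n0 \<Longrightarrow> (16 powr (1 / \<epsilon>) * 4) \<le> ?q n powr (\<tau> - 1)" "\<And>n. n \<ge> n0 \<Longrightarrow> 4 * T \<le> ?q n"
    "\<And>n. n \<ge> n0 \<Longrightarrow> ?q (Suc n) \<le> ?q n powr u"
    unfolding eventually_sequentially by blast
  have T0: "T \<ge> 0" by (simp add: T_def)
  have qpos: "?q n > 0" for n using Q_pos[of n] by simp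
  have small: "2 * (4 powr \<tau> * ?q n powr (- \<tau>)) + ?q n powr (- \<tau>) \<le> 1 / (2 * ?q n)" if "n \<ge> n0" for n
  proof -
    have "(2 * 4 powr \<tau> + 1) * ?q n powr (- (\<tau> - 1)) / ?q n \<le> 1 / 2 / ?q n"
      using n0(1)[OF that] qpos[of n] by (intro divide_right_mono) auto
    moreover have "?q n powr (- (\<tau> - 1)) / ?q n = ?q n powr (- \<tau>)"
      using qpos[of n] by (simp add: powr_minus powr_diff field_simps)
    moreover have "(2 * 4 powr \<tau> + 1) * ?q n powr (- (\<tau> - 1)) / ?q n
        = (2 * 4 powr \<tau> + 1) * (?q n powr (- (\<tau> - 1)) / ?q n)" by simp
    ultimately have "(2 * 4 powr \<tau> + 1) * ?q n powr (- \<tau>) \<le> 1 / 2 / ?q n" by (simp only:)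
    then show ?thesis by (simp add: algebra_simps)
  qed
  define B where "B = real (card (survivors \<tau> T n0))"
  have count: "real (card (survivors \<tau> T n)) \<le> B * ?q n powr \<nu>" if "n \<ge> n0" for n
    using that
  proof (induction n rule: dec_induct)
    case base
    have "1 \<le> ?q n0 powr \<nu>" using Q_pos[of n0] \<nu> by (intro ge_one_powr_ge_zero) auto
    then have "B * 1 \<le> B * ?q n0 powr \<nu>" by (intro mult_left_mono) (auto simp: B_def)
    then show ?case by (simp add: B_def)
  next
    case (step n)
    have "real (card (survivors \<tau> T (Suc n))) \<le> real (card (survivors \<tau> T n)) * (?q (Suc n) / ?q n) powr \<nu>"
      unfolding \<nu>_def using step.hyps T0 n0[of n] small[of n] \<tau> u \<epsilon>
      by (intro card_survivors_step) auto
    also have "\<dots> \<le> B * ?q n powr \<nu> * (?q (Suc n) / ?q n) powr \<nu>"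
      by (rule mult_right_mono[OF step.IH]) simp
    also have "\<dots> = B * ?q (Suc n) powr \<nu>"
      using qpos[of n] qpos[of "Suc n"] by (simp add: powr_divide)
    finally show ?case .
  qed
  define \<kappa> where "\<kappa> = s * \<tau> / (1 + \<tau>)"
  have \<kappa>: "\<kappa> > 0" using s0 \<tau> by (simp add: \<kappa>_def)
  have "\<forall>\<^sub>F x in at_top. (B * 2 powr s * 2 powr \<kappa>) * x powr (- \<epsilon>) \<le> \<eta>"
    using \<epsilon> \<eta> by (rule eventually_mult_powr_neg_le)
  then have "\<forall>\<^sub>F n in sequentially. (B * 2 powr s * 2 powr \<kappa>) * ?q n powr (- \<epsilon>) \<le> \<eta>"
    using filterlim_Q by (rule eventually_compose_filterlim)
  then obtain n1 where n1: "\<And>n. n \<ge> n1 \<Longrightarrow> (B * 2 powr s * 2 powr \<kappa>) * ?q n powr (- \<epsilon>) \<le> \<eta>"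
    unfolding eventually_sequentially by blast
  obtain n where n: "n \<ge> max n0 n1" "?q n powr \<sigma> \<le> 2 * ?q (Suc n)"
    using frequently_Q_ge[OF \<sigma>] by blast
  define X where "X = crit_scale \<tau> n"
  have X: "X > 0" by (simp add: X_def crit_scale_pos)
  have near: "\<exists>i\<in>survivors \<tau> T n. dist_int (real i * \<theta> - y) \<le> 2 * X powr (- \<tau>)"
    if y: "y \<in> unif_from \<tau> \<theta> T" for y
  proof -
    have "T \<le> ?q n" using n0(3)[of n] n T0 by simp
    with y obtain i where i: "i \<in> survivors \<tau> T n" "dist_int (real i * \<theta> - y) < ?q n powr (- \<tau>)"
      by (rule survivor_near)
    show ?thesis
    proof (cases "?q n \<le> X")
      case True
      have "dist_int (real i * \<theta> - y) \<le> 2 * X powr (- \<tau>)"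
      proof -
        have "1 \<le> (4::real) powr \<tau>" using \<tau> by (intro ge_one_powr_ge_zero) auto
        then have "1 * ?q n powr (- \<tau>) \<le> 4 powr \<tau> * ?q n powr (- \<tau>)" by (intro mult_right_mono) auto
        moreover have "X powr (- \<tau>) \<le> ?q n powr (- \<tau>)" using True qpos[of n] \<tau> by (intro powr_mono2') auto
        ultimately have "2 * X powr (- \<tau>) + ?q n powr (- \<tau>) \<le> 1 / (2 * ?q n)"
          using small[of n] n by linarith
        then show ?thesis
          using i y \<tau> True \<open>T \<le> ?q n\<close> unfolding X_def
          by (intro localization[of \<tau> y T]) (auto simp: survivors_def)
      qed
      then show ?thesis using i by blast
    next
      case False
      then have "?q n powr (- \<tau>) \<le> X powr (- \<tau>)" using X \<tau> by (intro powr_mono2') auto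
      moreover have "X powr (- \<tau>) > 0" using X by simp
      ultimately show ?thesis using i by (intro bexI[of _ i]) linarith+
    qed
  qed
  have "(X powr (- \<tau>)) powr s = (?q n * ?q (Suc n)) powr (- \<kappa>)"
    by (simp add: X_def crit_scale_def powr_powr \<kappa>_def mult_ac)
  also have "\<dots> \<le> (?q n powr (1 + \<sigma>) / 2) powr (- \<kappa>)"
  proof (rule powr_mono2')
    have "?q n * (?q n powr \<sigma> / 2) \<le> ?q n * ?q (Suc n)" using n by (intro mult_left_mono) auto
    then show "?q n powr (1 + \<sigma>) / 2 \<le> ?q n * ?q (Suc n)" using qpos[of n] by (simp add: powr_add)
  qed (use \<kappa> qpos[of n] in auto)
  also have "\<dots> = 2 powr \<kappa> * ?q n powr (- ((1 + \<sigma>) * \<kappa>))"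
  proof -
    have "(?q n powr (1 + \<sigma>) / 2) powr (- \<kappa>) = (?q n powr (1 + \<sigma>)) powr (- \<kappa>) / 2 powr (- \<kappa>)"
      using qpos[of n] by (simp add: powr_divide)
    also have "\<dots> = (?q n powr (1 + \<sigma>)) powr (- \<kappa>) * 2 powr \<kappa>"
      by (simp add: powr_minus_divide)
    also have "(?q n powr (1 + \<sigma>)) powr (- \<kappa>) = ?q n powr (- ((1 + \<sigma>) * \<kappa>))"
      by (simp only: powr_powr mult_minus_right)
    finally show ?thesis by (simp only: mult.commute)
  qed
  finally have Xs: "(X powr (- \<tau>)) powr s \<le> 2 powr \<kappa> * ?q n powr (- ((1 + \<sigma>) * \<kappa>))" .
  have "real (card (survivors \<tau> T n)) * (2 * X powr (- \<tau>)) powr s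
      = real (card (survivors \<tau> T n)) * (2 powr s * (X powr (- \<tau>)) powr s)"
    by (simp add: powr_mult)
  also have "\<dots> \<le> (B * ?q n powr \<nu>) * (2 powr s * (2 powr \<kappa> * ?q n powr (- ((1 + \<sigma>) * \<kappa>))))"
    using count[of n] n Xs by (intro mult_mono) (auto simp: B_def)
  also have "\<dots> = (B * 2 powr s * 2 powr \<kappa>) * (?q n powr \<nu> * ?q n powr (- ((1 + \<sigma>) * \<kappa>)))"
    by (simp add: mult_ac)
  also have "?q n powr \<nu> * ?q n powr (- ((1 + \<sigma>) * \<kappa>)) = ?q n powr (- \<epsilon>)"
  proof -
    have "(1 + \<sigma>) * \<kappa> - \<nu> = \<epsilon>" using slack by (simp add: \<kappa>_def mult_ac)
    then have "\<nu> - (1 + \<sigma>) * \<kappa> = - \<epsilon>" by linarith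
    then show ?thesis by (simp add: powr_add[symmetric])
  qed
  also have "(B * 2 powr s * 2 powr \<kappa>) * ?q n powr (- \<epsilon>) \<le> \<eta>" using n1 n by simp
  finally have "real (card (survivors \<tau> T n)) * (2 * X powr (- \<tau>)) powr s \<le> \<eta>" .
  then show "\<exists>I R. finite I \<and> R \<ge> 0 \<and> real (card I) * R powr s \<le> \<eta> \<and>
        (\<forall>y\<in>unif_from \<tau> \<theta> (real K). \<exists>i\<in>I. dist_int (real i * \<theta> - y) \<le> R)"
    using near survivors_finite X unfolding T_def
    by (intro exI[of _ "survivors \<tau> (real K) n"] exI[of _ "2 * X powr (- \<tau>)"]) auto
qed

end

section \<open>Lower bound\<close>

lemma mult_add_unique:
  fixes i i' b b' q :: nat
  assumes "i + b * q = i' + b' * q" "i \<in> {1..q}" "i' \<in> {1..q}"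
  shows "i = i' \<and> b = b'"
proof -
  have q: "q > 0" using assms by auto
  have eq: "(i - 1) + b * q = (i' - 1) + b' * q" using assms by auto
  have lt: "i - 1 < q" "i' - 1 < q" using assms by auto
  have "((i - 1) + b * q) div q = b" "((i' - 1) + b' * q) div q = b'"
    using lt q by (simp_all add: div_less)
  then have "b = b'" using eq by simp
  then show ?thesis using assms(1) by simp
qed

context irrational_rotation begin

section \<open>Arcs between orbit points and their subdivision\<close>

definition orbit_pt :: "nat \<Rightarrow> real" where
  "orbit_pt i = frac (real i * \<theta>)"

text \<open>The sign orients stage \<open>n\<close> such that the points with indices
  \<open>i + b * Q (n+1)\<close> sit at the increasing coordinates
  \<open>b * D (n+1)\<close>.\<close>

definition coord :: "nat \<Rightarrow> nat \<Rightarrow> real \<Rightarrow> real" where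
  "coord n i y = (-1) ^ n * (y - orbit_pt i)"

text \<open>Among the first \<open>Q (n+1)\<close> orbit points on the circle, the gap starting at
  \<open>i\<close> has length \<open>D n\<close> if \<open>Q n < i\<close>, and length
  \<open>D n + D (n+1)\<close> if \<open>i \<le> Q n\<close>. The node is the whole gap in the first
  case and its part next to \<open>i\<close> in the second, so that all nodes of a stage have the
  same length.\<close>

definition node :: "nat \<Rightarrow> nat \<Rightarrow> real set" where
  "node n i = {y. 0 \<le> coord n i y \<and> coord n i y \<le> D n}"

lemma sign_square: "(-1) ^ n * (-1) ^ n = (1::real)"
  by (simp add: power_mult_distrib[symmetric])

lemma sign_cancel: "(-1) ^ n * ((-1) ^ n * x) = (x::real)"
  by (simp only: mult.assoc[symmetric] sign_square mult_1_left)

lemma abs_sign_mult: "\<bar>(-1) ^ n * x\<bar> = \<bar>x::real\<bar>"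
  by (simp add: abs_mult)

lemma node_eq: "node n i = (if even n then {orbit_pt i..orbit_pt i + D n} else {orbit_pt i - D n..orbit_pt i})"
  by (auto simp: node_def coord_def)

lemma compact_node: "compact (node n i)"
  by (simp add: node_eq)

lemma orbit_pt_in_node: "orbit_pt i \<in> node n i"
  using D_pos[of n] by (simp add: node_def coord_def less_imp_le)

lemma node_subset_near:
  assumes "y \<in> node n i" shows "\<bar>y - orbit_pt i\<bar> \<le> D n"
proof -
  have "\<bar>coord n i y\<bar> \<le> D n" using assms by (simp add: node_def)
  then show ?thesis by (simp add: coord_def abs_sign_mult)
qed

text \<open>\<open>anchor n i j c\<close>: the \<open>j\<close>-th orbit point has coordinate \<open>c\<close> relative to the \<open>i\<close>-th one, modulo 1.\<close>

definition anchor :: "nat \<Rightarrow> nat \<Rightarrow> nat \<Rightarrow> real \<Rightarrow> bool" where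
  "anchor n i j c \<longleftrightarrow> real j * \<theta> - (orbit_pt i + (-1) ^ n * c) \<in> \<int>"

lemma orbit_pt_Ints: "real i * \<theta> - orbit_pt i \<in> \<int>"
  by (simp add: orbit_pt_def frac_def)

lemma anchor_add: "anchor n i (i + b * Q (Suc n)) (real b * D (Suc n))"
proof -
  have "real (i + b * Q (Suc n)) * \<theta> - (orbit_pt i + (-1) ^ n * (real b * D (Suc n))) =
    (real i * \<theta> - orbit_pt i) + real b * (real (Q (Suc n)) * \<theta> - (-1) ^ n * D (Suc n))"
    by (simp add: algebra_simps)
  then show ?thesis unfolding anchor_def
    by (simp only:) (rule Ints_add[OF orbit_pt_Ints Ints_mult[OF Ints_of_nat Q_cong]])
qed

lemma anchor_self: "anchor n i i 0"
  using anchor_add[of n i 0] by simp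

lemma anchor_diff:
  assumes "Q n \<le> i" shows "anchor n i (i - Q n) (D n)"
proof -
  have "real (i - Q n) * \<theta> - (orbit_pt i + (-1) ^ n * D n) =
    (real i * \<theta> - orbit_pt i) - (real (Q n) * \<theta> + (-1) ^ n * D n)"
    using assms by (simp add: of_nat_diff algebra_simps)
  then show ?thesis unfolding anchor_def
    by (simp only:) (rule Ints_diff[OF orbit_pt_Ints Q_cong'])
qed

text \<open>For \<open>i \<le> Q n\<close> this is the far end of the long gap;
  \<open>i - Q n\<close> is then no admissible index, and \<open>Q (n+1)\<close> is added to make it
  one.\<close>

lemma anchor_add_diff: "anchor n i (i + Q (Suc n) - Q n) (D n + D (Suc n))"
proof -
  have "real (i + Q (Suc n) - Q n) * \<theta> - (orbit_pt i + (-1) ^ n * (D n + D (Suc n))) =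
    (real i * \<theta> - orbit_pt i) + ((real (Q (Suc n)) * \<theta> - (-1) ^ n * D (Suc n)) - (real (Q n) * \<theta> + (-1) ^ n * D n))"
    using Q_mono[of n] by (simp add: of_nat_diff algebra_simps)
  then show ?thesis unfolding anchor_def
    by (simp only:) (rule Ints_add[OF orbit_pt_Ints Ints_diff[OF Q_cong Q_cong']])
qed

lemma anchor_dist:
  assumes "anchor n i j c" shows "dist_int (real j * \<theta> - y) \<le> \<bar>coord n i y - c\<bar>"
proof -
  have "real j * \<theta> - y - (orbit_pt i + (-1) ^ n * c - y) \<in> \<int>"
    using assms by (simp add: anchor_def algebra_simps)
  then have "dist_int (real j * \<theta> - y) \<le> \<bar>orbit_pt i + (-1) ^ n * c - y\<bar>" by (rule dist_int_le_if_Ints)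
  also have "\<bar>orbit_pt i + (-1) ^ n * c - y\<bar> = \<bar>(-1) ^ n * (orbit_pt i + (-1) ^ n * c - y)\<bar>"
    by (simp only: abs_sign_mult)
  also have "(-1) ^ n * (orbit_pt i + (-1) ^ n * c - y) = c - coord n i y"
  proof -
    have "(-1) ^ n * (orbit_pt i + (-1) ^ n * c - y) = (-1) ^ n * ((-1) ^ n * c) - (-1) ^ n * (y - orbit_pt i)"
      by (simp only: right_diff_distrib distrib_left) 
    then show ?thesis by (simp only: sign_cancel coord_def)
  qed
  finally show ?thesis by (simp add: abs_minus_commute)
qed

text \<open>Positions are known modulo 1 only. As long as the node stays inside the open unit
  interval there is no wrap-around, and the congruence becomes an equation; all cells of the tree
  are kept there for this purpose.\<close>

lemma anchor_coord:
  assumes "anchor n i j c" "node n i \<subseteq> {0<..<1}" "0 \<le> c" "c \<le> D n"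
  shows "coord n j y = coord n i y - c"
proof -
  have "coord n i (orbit_pt i + (-1) ^ n * c) = c" by (simp add: coord_def sign_cancel)
  then have "orbit_pt i + (-1) ^ n * c \<in> node n i" using assms by (simp add: node_def)
  then have "orbit_pt i + (-1) ^ n * c \<in> {0<..<1}" using assms by blast
  then have "orbit_pt j = orbit_pt i + (-1) ^ n * c"
    using assms(1) unfolding anchor_def orbit_pt_def[of j] frac_unique_iff by simp
  then have "coord n j y = (-1) ^ n * (y - orbit_pt i) - (-1) ^ n * ((-1) ^ n * c)"
    unfolding coord_def by (simp only:) (simp only: right_diff_distrib distrib_left diff_diff_eq)
  then show ?thesis by (simp only: sign_cancel coord_def)
qed

lemma coord_Suc: "coord (Suc n) j y = - coord n j y"
  by (simp add: coord_def)

text \<open>\<open>node n i\<close> has length \<open>D n = a n * D (n+1) + D (n+2)\<close> and splits into \<open>a n\<close> nodes of stage \<open>n+1\<close>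
  and one node of stage \<open>n+2\<close>; \<open>kids\<close> keeps \<open>M\<close> of the former and, if \<open>W\<close> holds, a piece of stage \<open>n+2\<close>
  next to them. To keep the levels of the tree uniform, the latter waits for one level, as the
  state \<open>(i, True)\<close>.\<close>

fun cell :: "nat \<Rightarrow> nat \<times> bool \<Rightarrow> real set" where
  "cell n (i, w) = node (if w then Suc n else n) i"

fun kids :: "nat \<Rightarrow> nat \<Rightarrow> bool \<Rightarrow> nat \<times> bool \<Rightarrow> (nat \<times> bool) set" where
  "kids n M W (i, True) = {(i, False)}"
| "kids n M W (i, False) = (if i \<le> Q n
    then (\<lambda>b. (i + b * Q (Suc n), False)) ` {1..M} \<union> (if W then {(i + M * Q (Suc n), True)} else {})
    else (\<lambda>b. (i + b * Q (Suc n), False)) ` {1..M - 1} \<union> {(i - Q n, False)} \<union>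
      (if W then {(i + (M - 1) * Q (Suc n), True)} else {}))"

lemma kids_cases:
  assumes "x \<in> kids n M W (i, False)"
  obtains (step) b where "x = (i + b * Q (Suc n), False)" "1 \<le> b" "b \<le> M" "i \<le> Q n \<or> b \<le> M - 1"
  | (far) "x = (i - Q n, False)" "Q n < i"
  | (wait) b where "x = (i + b * Q (Suc n), True)" "W" "i \<le> Q n \<and> b = M \<or> Q n < i \<and> b = M - 1"
proof (cases "i \<le> Q n")
  case True
  then have "(\<exists>b\<in>{1..M}. x = (i + b * Q (Suc n), False)) \<or> W \<and> x = (i + M * Q (Suc n), True)"
    using assms by (force split: if_splits)
  then show ?thesis using True step wait by (metis atLeastAtMost_iff)
next
  case False
  then have "(\<exists>b\<in>{1..M - 1}. x = (i + b * Q (Suc n), False)) \<or> x = (i - Q n, False) \<or>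
      W \<and> x = (i + (M - 1) * Q (Suc n), True)"
    using assms by (force split: if_splits)
  then show ?thesis using False step far wait by (metis atLeastAtMost_iff diff_le_self le_trans not_le)
qed

text \<open>The child hangs at the orbit point with coordinate \<open>b * D (n+1)\<close>; since the
  orientation changes with the stage, it extends back towards the base point of the parent.\<close>

lemma cell_step:
  assumes "node n i \<subseteq> {0<..<1}" "1 \<le> b" "b \<le> a n"
  shows "cell (Suc n) (i + b * Q (Suc n), False) =
    {y. (real b - 1) * D (Suc n) \<le> coord n i y \<and> coord n i y \<le> real b * D (Suc n)}"
proof -
  have "real b * D (Suc n) \<le> real (a n) * D (Suc n)" using assms D_pos[of "Suc n"] by simp
  then have "real b * D (Suc n) \<le> D n" using D_rec[of n] D_pos[of "Suc (Suc n)"] by linarith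
  then have eq: "coord n (i + b * Q (Suc n)) y = coord n i y - real b * D (Suc n)" for y
    using assms D_pos[of "Suc n"] by (intro anchor_coord[OF anchor_add]) auto
  show ?thesis by (auto simp: node_def coord_Suc eq left_diff_distrib)
qed

text \<open>For \<open>Q n < i\<close> the index \<open>i + a n * Q (n+1)\<close> exceeds
  \<open>Q (n+2)\<close>, so the last child hangs at the other end of the gap instead, at the point
  \<open>i - Q n\<close>.\<close>

lemma cell_back:
  assumes "node n i \<subseteq> {0<..<1}" "Q n < i"
  shows "cell (Suc n) (i - Q n, False) = {y. D n - D (Suc n) \<le> coord n i y \<and> coord n i y \<le> D n}"
proof -
  have eq: "coord n (i - Q n) y = coord n i y - D n" for y
    using assms D_pos[of n] by (intro anchor_coord[OF anchor_diff]) auto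
  show ?thesis by (auto simp: node_def coord_Suc eq left_diff_distrib)
qed

text \<open>Two stages restore the orientation, so the waiting piece extends forwards from its orbit
  point. If \<open>M = a n\<close>, it fills exactly the rest of length \<open>D (n+2)\<close> that
  the other children leave over.\<close>

lemma cell_wait:
  assumes "node n i \<subseteq> {0<..<1}" "b \<le> a n"
  shows "cell (Suc n) (i + b * Q (Suc n), True) =
    {y. real b * D (Suc n) \<le> coord n i y \<and> coord n i y \<le> real b * D (Suc n) + D (Suc (Suc n))}"
proof -
  have "real b * D (Suc n) \<le> real (a n) * D (Suc n)" using assms D_pos[of "Suc n"] by simp
  then have "real b * D (Suc n) \<le> D n" using D_rec[of n] D_pos[of "Suc (Suc n)"] by linarith
  then have eq: "coord n (i + b * Q (Suc n)) y = coord n i y - real b * D (Suc n)" for y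
    using assms D_pos[of "Suc n"] by (intro anchor_coord[OF anchor_add]) auto
  show ?thesis by (auto simp: node_def coord_Suc eq left_diff_distrib)
qed

lemma kids_cell_subset:
  assumes "cell n x \<subseteq> {0<..<1}" "1 \<le> M" "M \<le> a n" "z \<in> kids n M W x"
  shows "cell (Suc n) z \<subseteq> cell n x"
proof -
  obtain i w where x: "x = (i, w)" by (cases x)
  show ?thesis
  proof (cases w)
    case True
    then show ?thesis using assms(4) x by simp
  next
    case False
    have dpos: "D n > 0" "D (Suc n) > 0" "D (Suc (Suc n)) > 0" "D (Suc n) < D n"
      using D_pos D_decr[of n] by auto
    have nd: "node n i \<subseteq> {0<..<1}" and "z \<in> kids n M W (i, False)" using assms x False by auto
    have parent: "cell n x = {y. 0 \<le> coord n i y \<and> coord n i y \<le> D n}"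
      using x False by (simp add: node_def)
    from \<open>z \<in> kids n M W (i, False)\<close> show ?thesis
    proof (cases rule: kids_cases)
      case (step b)
      have "real b * D (Suc n) \<le> real (a n) * D (Suc n)" using step assms dpos by simp
      moreover have "0 \<le> (real b - 1) * D (Suc n)" using step dpos by simp
      moreover have "b \<le> a n" using step assms by simp
      then have "cell (Suc n) z = {y. (real b - 1) * D (Suc n) \<le> coord n i y \<and> coord n i y \<le> real b * D (Suc n)}"
        using cell_step[OF nd, of b] step by simp
      ultimately show ?thesis using dpos(3) D_rec[of n] unfolding parent by (smt (verit) Collect_mono)
    next
      case far
      then have "cell (Suc n) z = {y. D n - D (Suc n) \<le> coord n i y \<and> coord n i y \<le> D n}"
        using cell_back[OF nd] by simp
      then show ?thesis using dpos unfolding parent by (smt (verit) Collect_mono)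
    next
      case (wait b)
      have b: "b \<le> a n" using wait assms by auto
      then have "real b * D (Suc n) \<le> real (a n) * D (Suc n)" using dpos by simp
      moreover have "0 \<le> real b * D (Suc n)" using dpos by simp
      moreover have "cell (Suc n) z = {y. real b * D (Suc n) \<le> coord n i y \<and>
          coord n i y \<le> real b * D (Suc n) + D (Suc (Suc n))}"
        using cell_wait[OF nd b] wait by simp
      ultimately show ?thesis using dpos D_rec[of n] unfolding parent by (smt (verit) Collect_mono)
    qed
  qed
qed

lemma kids_index:
  assumes i: "fst x \<in> {1..Q (Suc n)}" and M: "1 \<le> M" "M \<le> a n" and z: "z \<in> kids n M W x"
  shows "fst z \<in> {1..Q (Suc (Suc n))}"
proof -
  obtain i w where x: "x = (i, w)" by (cases x)
  have mono: "Q (Suc n) \<le> Q (Suc (Suc n))" by (rule Q_mono)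
  show ?thesis
  proof (cases w)
    case True
    then show ?thesis using assms x mono by auto
  next
    case False
    have up: "i + b * Q (Suc n) \<le> Q (Suc (Suc n))" if "i \<le> Q n \<and> b \<le> a n \<or> Suc b \<le> a n" for b
      using that
    proof
      assume "i \<le> Q n \<and> b \<le> a n"
      then have "i + b * Q (Suc n) \<le> Q n + a n * Q (Suc n)" by (intro add_mono mult_right_mono) auto
      then show ?thesis by (simp add: Q_rec)
    next
      assume "Suc b \<le> a n"
      then have "Suc b * Q (Suc n) \<le> a n * Q (Suc n)" by (rule mult_right_mono) simp
      then show ?thesis using i x by (simp add: Q_rec)
    qed
    have "z \<in> kids n M W (i, False)" using z x False by simp
    then show ?thesis
    proof (cases rule: kids_cases)
      case (step b)
      then have "i \<le> Q n \<and> b \<le> a n \<or> Suc b \<le> a n" using M by linarith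
      then show ?thesis using up[of b] step i x by auto
    next
      case far
      then show ?thesis using mono i x by auto
    next
      case (wait b)
      then have "i \<le> Q n \<and> b \<le> a n \<or> Suc b \<le> a n" using M by linarith
      then show ?thesis using up[of b] wait i x by auto
    qed
  qed
qed

text \<open>\<open>separated_states\<close> prevents a waiting cell from being produced a second time, as the
  far end of another cell.\<close>

definition separated_states :: "nat \<Rightarrow> (nat \<times> bool) set \<Rightarrow> bool" where
  "separated_states n S \<longleftrightarrow> (\<forall>x\<in>S. fst x \<in> {1..Q (Suc n)}) \<and> (\<forall>i. (i, True) \<in> S \<longrightarrow> (i + Q n, False) \<notin> S)"

text \<open>An index \<open>i + b * Q (n+1)\<close> determines \<open>i\<close> and
  \<open>b\<close>, as \<open>i\<close> runs through 1 to \<open>Q (n+1)\<close>. Far children keep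
  an index below \<open>Q (n+1)\<close>, whereas steps with \<open>b \<ge> 1\<close> lie above
  it.\<close>

lemma kids_disjoint_step:
  assumes "i \<in> {1..Q (Suc n)}" "i' \<in> {1..Q (Suc n)}" "i \<noteq> i'"
  shows "kids n M W (i, False) \<inter> kids n M W (i', False) = {}"
proof -
  have neq: "i + b * Q (Suc n) \<noteq> i' + b' * Q (Suc n)" for b b'
    using mult_add_unique[of i b "Q (Suc n)" i' b'] assms by blast
  have gt: "j + b * Q (Suc n) \<noteq> k - Q n" if "j \<in> {1..Q (Suc n)}" "1 \<le> b" "k \<le> Q (Suc n)" for b j k :: nat
  proof -
    have "1 * Q (Suc n) \<le> b * Q (Suc n)" using that(2) by (rule mult_right_mono) simp
    moreover have "k - Q n \<le> k" by simp
    moreover have "1 \<le> j" using that by simp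
    ultimately show ?thesis using that(3) by linarith
  qed
  show ?thesis
  proof (rule ccontr)
    assume "kids n M W (i, False) \<inter> kids n M W (i', False) \<noteq> {}"
    then obtain z where z: "z \<in> kids n M W (i, False)" "z \<in> kids n M W (i', False)" by blast
    from z(1) show False
    proof (cases rule: kids_cases)
      case (step b)
      from z(2) show False
      proof (cases rule: kids_cases)
        case step' : (step b')
        then show False using step neq by auto
      next
        case far
        then show False using step gt[of i b i'] assms by auto
      qed (use step in auto)
    next
      case far
      from z(2) show False
      proof (cases rule: kids_cases)
        case (step b')
        then show False using far gt[of i' b' i] assms by auto
      next
        case far' : far
        then show False using far assms by auto
      qed (use far in auto)
    next
      case (wait b)
      from z(2) show False
      proof (cases rule: kids_cases)
        case wait' : (wait b')
        then show False using wait neq by auto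
      qed (use wait in auto)
    qed
  qed
qed

lemma kids_disjoint_wait:
  assumes S: "separated_states n S" "(i, True) \<in> S" "(i', False) \<in> S"
  shows "kids n M W (i, True) \<inter> kids n M W (i', False) = {}"
proof -
  have i: "i \<in> {1..Q (Suc n)}" "i' \<in> {1..Q (Suc n)}" "i' \<noteq> i + Q n"
    using S by (auto simp: separated_states_def)
  have "(i, False) \<notin> kids n M W (i', False)"
  proof
    assume "(i, False) \<in> kids n M W (i', False)"
    then show False
    proof (cases rule: kids_cases)
      case (step b)
      have "1 * Q (Suc n) \<le> b * Q (Suc n)" using step(2) by (rule mult_right_mono) simp
      moreover have "i = i' + b * Q (Suc n)" using step by simp
      moreover have "i \<le> Q (Suc n)" "1 \<le> i'" using i by auto
      ultimately show False by linarith
    qed (use i in auto)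
  qed
  then show ?thesis by simp
qed

lemma kids_disjoint:
  assumes S: "separated_states n S" "x \<in> S" "y \<in> S" "x \<noteq> y"
  shows "kids n M W x \<inter> kids n M W y = {}"
proof -
  obtain i w i' w' where xy: "x = (i, w)" "y = (i', w')" by (cases x, cases y)
  have i: "i \<in> {1..Q (Suc n)}" "i' \<in> {1..Q (Suc n)}" using S xy by (auto simp: separated_states_def)
  show ?thesis
    using kids_disjoint_step[OF i, of M W] kids_disjoint_wait[OF S(1), of i i' M W]
      kids_disjoint_wait[OF S(1), of i' i M W] S xy
    by (cases w; cases w') (auto simp del: kids.simps(2))
qed

lemma separated_states_kids:
  assumes S: "separated_states n S" and M: "1 \<le> M" "M \<le> a n"
  shows "separated_states (Suc n) (\<Union>x\<in>S. kids n M W x)"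
  unfolding separated_states_def
proof (intro conjI ballI allI impI notI)
  fix z assume "z \<in> (\<Union>x\<in>S. kids n M W x)"
  then show "fst z \<in> {1..Q (Suc (Suc n))}"
    using kids_index[OF _ M] S unfolding separated_states_def by blast
next
  fix j assume "(j, True) \<in> (\<Union>x\<in>S. kids n M W x)" and 2: "(j + Q (Suc n), False) \<in> (\<Union>x\<in>S. kids n M W x)"
  then obtain i w where i: "(i, w) \<in> S" "(j, True) \<in> kids n M W (i, w)" by auto
  have w: "\<not> w" using i by (cases w) auto
  have i1: "i \<in> {1..Q (Suc n)}" using S i by (auto simp: separated_states_def)
  from i(2) w obtain b where b: "j = i + b * Q (Suc n)" "i \<le> Q n \<and> b = M \<or> Q n < i \<and> b = M - 1"
    by (auto split: if_splits)
  obtain i' w' where i': "(i', w') \<in> S" "(j + Q (Suc n), False) \<in> kids n M W (i', w')" using 2 by auto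
  have i1': "i' \<in> {1..Q (Suc n)}" using S i' by (auto simp: separated_states_def)
  have j: "j \<ge> 1" using b i1 by auto
  show False
  proof (cases w')
    case True
    then show False using i' i1' j by auto
  next
    case False
    then have "(j + Q (Suc n), False) \<in> kids n M W (i', False)" using i' by simp
    then show False
    proof (cases rule: kids_cases)
      case (step b')
      \<comment> \<open>The waiting index uses the largest kept \<open>b\<close>, so a collision
        would be the step after the last one.\<close>
      then have "i + Suc b * Q (Suc n) = i' + b' * Q (Suc n)" using b by simp
      then have "i = i' \<and> Suc b = b'" using i1 i1' by (rule mult_add_unique)
      then show False using step b M by auto
    qed (use i1' j in auto)
  qed
qed

lemma sum_kids:
  assumes i: "i \<in> {1..Q (Suc n)}" and M: "1 \<le> M"
  shows "(\<Sum>z\<in>kids n M W (i, False). if snd z then p else r) = real M * r + (if W then p else (0::real))"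
proof -
  have inj: "inj_on (\<lambda>b. (i + b * Q (Suc n), False)) B" for B
    using Q_pos[of n] by (auto simp: inj_on_def)
  have img: "(\<Sum>z\<in>(\<lambda>b. (i + b * Q (Suc n), False)) ` B. if snd z then p else r) = real (card B) * r" for B
    by (subst sum.reindex[OF inj]) simp
  show ?thesis
  proof (cases "i \<le> Q n")
    case True
    let ?B = "(\<lambda>b. (i + b * Q (Suc n), False)) ` {1..M}"
    have "kids n M W (i, False) = (if W then insert (i + M * Q (Suc n), True) ?B else ?B)" using True by auto
    moreover have "(i + M * Q (Suc n), True) \<notin> ?B" by auto
    ultimately show ?thesis using img[of "{1..M}"] by (simp add: sum.insert del: One_nat_def)
  next
    case False
    let ?B = "(\<lambda>b. (i + b * Q (Suc n), False)) ` {1..M - 1}"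
    have nin: "(i - Q n, False) \<notin> ?B"
    proof
      assume "(i - Q n, False) \<in> ?B"
      then obtain b where b: "1 \<le> b" "i - Q n = i + b * Q (Suc n)" by auto
      have "1 * Q (Suc n) \<le> b * Q (Suc n)" using b(1) by (rule mult_right_mono) simp
      moreover have "i - Q n \<le> i" by simp
      ultimately show False using b(2) Q_pos[of n] by linarith
    qed
    have "(\<Sum>z\<in>insert (i - Q n, False) ?B. if snd z then p else r) = r + real (M - 1) * r"
      using img[of "{1..M - 1}"] nin by (subst sum.insert) auto
    also have "\<dots> = real M * r" using M by (simp add: of_nat_diff algebra_simps)
    finally have s: "(\<Sum>z\<in>insert (i - Q n, False) ?B. if snd z then p else r) = real M * r" .
    have "kids n M W (i, False) = (if W then insert (i + (M - 1) * Q (Suc n), True) (insert (i - Q n, False) ?B)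
        else insert (i - Q n, False) ?B)" using False by auto
    moreover have "(i + (M - 1) * Q (Suc n), True) \<notin> insert (i - Q n, False) ?B" by auto
    ultimately show ?thesis using s by (simp add: sum.insert)
  qed
qed

end

lemma min_le_powr_mult_powr:
  fixes A B s :: real
  assumes "A > 0" "B > 0" "0 \<le> s" "s \<le> 1"
  shows "min A B \<le> A powr (1 - s) * B powr s"
proof (cases "A \<le> B")
  case True
  have "A = A powr (1 - s) * A powr s" using assms by (simp add: powr_add[symmetric])
  also have "\<dots> \<le> A powr (1 - s) * B powr s" using True assms by (intro mult_left_mono powr_mono2) auto
  finally show ?thesis by simp
next
  case False
  have "B = B powr (1 - s) * B powr s" using assms by (simp add: powr_add[symmetric])
  also have "\<dots> \<le> A powr (1 - s) * B powr s" using False assms by (intro mult_right_mono powr_mono2) auto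
  finally show ?thesis by simp
qed

section \<open>Admissible stages and the mass of an interval\<close>

context irrational_rotation begin

definition covered :: "real \<Rightarrow> real \<Rightarrow> real \<Rightarrow> bool" where
  "covered \<tau> X y \<longleftrightarrow> (\<exists>m::nat. 1 \<le> m \<and> real m \<le> X \<and> dist_int (real m * \<theta> - y) < X powr (- \<tau>))"

text \<open>The interface between the tree, which is the same for all \<open>\<tau> \<le> 1\<close>,
  and the choice of \<open>M\<close> and \<open>W\<close>, which depends on \<open>\<tau>\<close>
  and on the size of \<open>Q (n+2)\<close>. Waiting states are absent because they keep their
  weight and are covered automatically.\<close>

definition admissible :: "real \<Rightarrow> real \<Rightarrow> nat \<Rightarrow> nat \<Rightarrow> bool \<Rightarrow> bool" where
  "admissible \<tau> \<nu> n M W \<longleftrightarrow> 1 \<le> M \<and> M \<le> a n \<and>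
     D n powr \<nu> \<le> real M * D (Suc n) powr \<nu> + (if W then D (Suc (Suc n)) powr \<nu> else 0) \<and>
     (\<forall>i\<in>{1..Q (Suc n)}. node n i \<subseteq> {0<..<1} \<longrightarrow>
        (\<forall>z\<in>kids n M W (i, False). \<forall>y\<in>cell (Suc n) z. \<forall>X.
           real (Q (Suc n)) \<le> X \<longrightarrow> X < real (Q (Suc (Suc n))) \<longrightarrow> covered \<tau> X y))"

lemma coveredI:
  assumes "anchor n i j c" "1 \<le> j" "real j \<le> X" "\<bar>coord n i y - c\<bar> < X powr (- \<tau>)"
  shows "covered \<tau> X y"
  unfolding covered_def using assms anchor_dist[OF assms(1), of y]
  by (intro exI[of _ j]) (auto intro: le_less_trans)

lemma covered_waiting:
  assumes \<tau>: "\<tau> \<le> 1" and i: "i \<in> {1..Q (Suc n)}" and y: "y \<in> node (Suc n) i"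
    and X: "real (Q (Suc n)) \<le> X" "X < real (Q (Suc (Suc n)))"
  shows "covered \<tau> X y"
proof (rule coveredI[OF anchor_self])
  show "1 \<le> i" "real i \<le> X" using i X by auto
  have X1: "X \<ge> 1" using X Q_pos[of n] by linarith
  have "\<bar>coord (Suc n) i y - 0\<bar> \<le> D (Suc n)" using y by (simp add: node_def)
  also have "\<dots> \<le> 1 / real (Q (Suc (Suc n)))" by (rule D_le)
  also have "\<dots> < 1 / X" using X X1 by (intro divide_strict_left_mono) auto
  also have "\<dots> = X powr (- 1)" using X1 by (simp add: powr_minus_divide)
  also have "\<dots> \<le> X powr (- \<tau>)" using X1 \<tau> by (intro powr_mono) auto
  finally show "\<bar>coord (Suc n) i y - 0\<bar> < X powr (- \<tau>)" .
qed

definition weight :: "real \<Rightarrow> nat \<Rightarrow> nat \<times> bool \<Rightarrow> real" where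
  "weight \<nu> n x = (if snd x then D (Suc n) else D n) powr \<nu>"

lemma weight_le: "0 \<le> \<nu> \<Longrightarrow> weight \<nu> n x \<le> D n powr \<nu>"
  using D_decr[of n] D_pos[of "Suc n"] by (auto simp: weight_def intro!: powr_mono2)

lemma weight_kids:
  assumes "admissible \<tau> \<nu> n M W" "fst x \<in> {1..Q (Suc n)}"
  shows "weight \<nu> n x \<le> (\<Sum>z\<in>kids n M W x. weight \<nu> (Suc n) z)"
proof -
  obtain i w where x: "x = (i, w)" by (cases x)
  show ?thesis
  proof (cases w)
    case True
    then show ?thesis by (simp add: x weight_def)
  next
    case False
    have "(\<Sum>z\<in>kids n M W x. weight \<nu> (Suc n) z) =
      (\<Sum>z\<in>kids n M W (i, False). if snd z then D (Suc (Suc n)) powr \<nu> else D (Suc n) powr \<nu>)"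
      using x False by (intro sum.cong) (auto simp: weight_def)
    also have "\<dots> = real M * D (Suc n) powr \<nu> + (if W then D (Suc (Suc n)) powr \<nu> else 0)"
      using assms x by (intro sum_kids) (auto simp: admissible_def)
    finally show ?thesis using assms x False by (simp add: weight_def admissible_def)
  qed
qed

text \<open>A cell that meets the interval has its base point within \<open>D n\<close> of it, and
  these base points are \<open>D n\<close>-separated; that gives at most \<open>r / D n + 3\<close>
  of them. The factor 2 accounts for the two flags.\<close>

lemma weight_of_interval:
  assumes S: "\<And>x. x \<in> S \<Longrightarrow> fst x \<in> {1..Q (Suc n)}" and \<nu>: "0 \<le> \<nu>" and r: "r \<ge> 0"
  shows "(\<Sum>x | x \<in> S \<and> cell n x \<inter> {c..c + r} \<noteq> {}. weight \<nu> n x) \<le> 2 * (r / D n + 3) * D n powr \<nu>"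
proof -
  have Dn: "D n > 0" by (rule D_pos)
  define A where "A = {i \<in> {1..Q (Suc n)}. orbit_pt i \<in> {c - D n..c - D n + (r + 2 * D n)}}"
  have cardA: "finite A \<and> real (card A) \<le> (r + 2 * D n) / D n + 1"
  proof (rule card_le_of_separated[where z = orbit_pt and c = "c - D n"])
    fix i j assume ij: "i \<in> A" "j \<in> A" "i \<noteq> j"
    then have "D n \<le> dist_int (real i * \<theta> - real j * \<theta>)"
      by (intro orbit_separated) (auto simp: A_def)
    also have "\<dots> \<le> \<bar>orbit_pt i - orbit_pt j\<bar>"
    proof (rule dist_int_le_if_Ints)
      have "(real i * \<theta> - orbit_pt i) - (real j * \<theta> - orbit_pt j) \<in> \<int>"
        by (intro Ints_diff orbit_pt_Ints)
      then show "real i * \<theta> - real j * \<theta> - (orbit_pt i - orbit_pt j) \<in> \<int>" by (simp add: algebra_simps)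
    qed
    finally show "D n \<le> \<bar>orbit_pt i - orbit_pt j\<bar>" .
  qed (use Dn r in \<open>auto simp: A_def\<close>)
  let ?S = "{x. x \<in> S \<and> cell n x \<inter> {c..c + r} \<noteq> {}}"
  have "?S \<subseteq> A \<times> UNIV"
  proof
    fix x assume x: "x \<in> ?S"
    obtain i w where xw: "x = (i, w)" by (cases x)
    from x obtain y where "y \<in> cell n x" and yc: "y \<in> {c..c + r}" by blast
    then have y: "y \<in> node (if w then Suc n else n) i" using xw by simp
    have "\<bar>y - orbit_pt i\<bar> \<le> D n"
      using node_subset_near[OF y] D_decr[of n] by (auto split: if_splits)
    then show "x \<in> A \<times> UNIV" using yc S[of x] x xw by (auto simp: A_def abs_le_iff)
  qed
  then have "card ?S \<le> card (A \<times> (UNIV :: bool set))"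
    using cardA by (intro card_mono) auto
  then have cardS: "real (card ?S) \<le> 2 * real (card A)" by (simp add: card_cartesian_product)
  have "(\<Sum>x\<in>?S. weight \<nu> n x) \<le> (\<Sum>x\<in>?S. D n powr \<nu>)"
    by (intro sum_mono weight_le \<nu>)
  also have "\<dots> = real (card ?S) * D n powr \<nu>" by simp
  also have "\<dots> \<le> (2 * ((r + 2 * D n) / D n + 1)) * D n powr \<nu>"
  proof (rule mult_right_mono)
    show "real (card ?S) \<le> 2 * ((r + 2 * D n) / D n + 1)"
      using cardS mult_left_mono[OF conjunct2[OF cardA], of 2] by (rule order_trans) simp
  qed simp
  also have "(r + 2 * D n) / D n + 1 = r / D n + 3" using Dn by (simp add: add_divide_distrib)
  finally show ?thesis .
qed

lemma D_ge_powr: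
  assumes "real (Q (Suc (Suc n))) \<le> real (Q (Suc n)) powr u" "0 \<le> u"
  shows "D n powr u / 2 \<le> D (Suc n)"
proof -
  have q: "real (Q (Suc n)) > 0" "real (Q (Suc (Suc n))) > 0" using Q_pos[of n] Q_pos[of "Suc n"] by auto
  have "D n powr u \<le> (1 / real (Q (Suc n))) powr u"
    using D_le[of n] D_pos[of n] assms by (intro powr_mono2) auto
  also have "\<dots> = 1 / real (Q (Suc n)) powr u" using q by (simp add: powr_divide)
  also have "\<dots> \<le> 1 / real (Q (Suc (Suc n)))" using assms q by (intro divide_left_mono) auto
  finally show ?thesis using D_ge[of "Suc n"] by simp
qed

text \<open>The minimum is at most the geometric mean with weights \<open>1 - s\<close> and
  \<open>s\<close>. After \<open>D (n+1)\<close> is replaced by its lower bound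
  \<open>D n powr u / 2\<close>, the remaining exponent of \<open>D n\<close> is
  \<open>\<nu> - s * (\<nu> + u * (1 - \<nu>))\<close>, which is nonnegative by assumption, and
  \<open>D n \<le> 1\<close>.\<close>

lemma interval_mass_bound:
  assumes \<nu>: "0 < \<nu>" "\<nu> \<le> 1" and u: "0 \<le> u" and s: "0 < s" "s * (\<nu> + u * (1 - \<nu>)) \<le> \<nu>"
    and q: "real (Q (Suc (Suc n))) \<le> real (Q (Suc n)) powr u" and r: "r > 0"
  shows "min (D n powr \<nu>) (r * D (Suc n) powr (\<nu> - 1)) \<le> 2 * r powr s"
proof -
  have Dn: "0 < D n" "0 < D (Suc n)" by (rule D_pos)+
  have D1: "D n \<le> 1"
    by (induction n) (use D_decr in \<open>auto intro: order_trans[OF less_imp_le]\<close>)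
  have s1: "s \<le> 1"
  proof (rule ccontr)
    assume "\<not> s \<le> 1"
    then have "1 * \<nu> < s * \<nu>" using \<nu> by (intro mult_strict_right_mono) auto
    moreover have "0 \<le> s * (u * (1 - \<nu>))" using s u \<nu> by simp
    ultimately show False using s(2) by (simp add: algebra_simps)
  qed
  have "D (Suc n) powr (\<nu> - 1) \<le> (D n powr u / 2) powr (\<nu> - 1)"
    using D_ge_powr[OF q u] \<nu> Dn by (intro powr_mono2') auto
  also have "\<dots> = D n powr (u * (\<nu> - 1)) * 2 powr (1 - \<nu>)"
    using Dn powr_minus_divide[of 2 "1 - \<nu>"] by (simp add: powr_divide powr_powr)
  finally have d: "D (Suc n) powr (\<nu> - 1) \<le> D n powr (u * (\<nu> - 1)) * 2 powr (1 - \<nu>)" .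
  have "min (D n powr \<nu>) (r * D (Suc n) powr (\<nu> - 1))
      \<le> (D n powr \<nu>) powr (1 - s) * (r * D (Suc n) powr (\<nu> - 1)) powr s"
    using Dn r s s1 by (intro min_le_powr_mult_powr) auto
  also have "\<dots> \<le> (D n powr \<nu>) powr (1 - s) * (r * (D n powr (u * (\<nu> - 1)) * 2 powr (1 - \<nu>))) powr s"
    using d r s by (intro mult_left_mono powr_mono2) auto
  also have "\<dots> = D n powr (\<nu> - s * (\<nu> + u * (1 - \<nu>))) * 2 powr ((1 - \<nu>) * s) * r powr s"
  proof -
    have "D n powr (\<nu> * (1 - s)) * D n powr (u * (\<nu> - 1) * s) = D n powr (\<nu> - s * (\<nu> + u * (1 - \<nu>)))"
      unfolding powr_add[symmetric] by (simp add: algebra_simps)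
    then show ?thesis using r by (simp add: powr_mult powr_powr mult_ac)
  qed
  also have "\<dots> \<le> 1 * 2 powr 1 * r powr s"
  proof (intro mult_right_mono mult_mono)
    show "D n powr (\<nu> - s * (\<nu> + u * (1 - \<nu>))) \<le> 1"
      using powr_mono2[of "\<nu> - s * (\<nu> + u * (1 - \<nu>))" "D n" 1] D1 Dn s by simp
    have "(1 - \<nu>) * s \<le> 1 * 1" using \<nu> s s1 by (intro mult_mono) auto
    then show "2 powr ((1 - \<nu>) * s) \<le> 2 powr (1::real)" by (intro powr_mono) auto
  qed auto
  finally show ?thesis by simp
qed

lemma tendsto_D: "D \<longlonglongrightarrow> 0"
proof (rule tendsto_sandwich[of "\<lambda>_. 0" D sequentially "\<lambda>n. 1 / real (Q (Suc n))"])
  show "(\<lambda>n. 1 / real (Q (Suc n))) \<longlonglongrightarrow> 0"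
    using filterlim_Q by (intro tendsto_divide_0[OF tendsto_const] filterlim_at_top_imp_at_infinity)
qed (intro always_eventually allI less_imp_le D_pos D_le tendsto_const)+

lemma scale_exists:
  assumes "0 < r" "r < D n0"
  obtains n where "n0 \<le> n" "D (Suc n) \<le> r" "r < D n"
proof -
  have anti: "D k \<le> D m" if "m \<le> k" for m k
    by (rule lift_Suc_antimono_le[of D, OF less_imp_le[OF D_decr] that])
  have "\<forall>\<^sub>F n in sequentially. D n < r" using tendsto_D assms by (intro order_tendstoD)
  then obtain N where "\<And>n. N \<le> n \<Longrightarrow> D n < r" unfolding eventually_sequentially by blast
  then have ex: "D (Suc N) \<le> r" by (meson le_Suc_eq less_imp_le order_refl)
  define n where "n = (LEAST n. D (Suc n) \<le> r)"
  have n: "D (Suc n) \<le> r" unfolding n_def using ex by (rule LeastI)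
  have n0: "n0 \<le> n"
  proof (rule ccontr)
    assume "\<not> n0 \<le> n"
    then have "D n0 \<le> D (Suc n)" by (intro anti) simp
    then show False using n assms by simp
  qed
  have "r < D n"
  proof (cases n)
    case 0 then show ?thesis using n0 assms by simp
  next
    case (Suc m)
    then show ?thesis using not_less_Least[of m "\<lambda>n. D (Suc n) \<le> r"] by (simp add: n_def)
  qed
  with n0 n show ?thesis by (intro that)
qed

text \<open>The root is the node with index 1, based at \<open>\<theta>\<close> itself; once
  \<open>D n0 < min \<theta> (1 - \<theta>)\<close> it lies in the open unit interval, and the whole
  tree with it. The constant 16 is the product of 8 from counting cells and 2 from
  \<open>interval_mass_bound\<close>.\<close>

lemma hausdorff_measure_unif_set_neq_0:
  assumes \<tau>: "\<tau> \<le> 1" and \<nu>: "0 < \<nu>" "\<nu> \<le> 1" and u: "0 \<le> u" "irr_exponent \<theta> < ereal u" "0 < u"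
    and s: "0 < s" "s * (\<nu> + u * (1 - \<nu>)) \<le> \<nu>"
    and adm: "\<forall>\<^sub>F n in sequentially. \<exists>M W. admissible \<tau> \<nu> n M W"
  shows "hausdorff_measure s (unif_set \<tau> \<theta>) \<noteq> 0"
proof -
  have "\<forall>\<^sub>F n in sequentially. D n < min \<theta> (1 - \<theta>)"
    using tendsto_D \<theta>_pos \<theta>_less_1 by (intro order_tendstoD) auto
  with adm eventually_Q_le[OF u(3,2)]
  have "\<forall>\<^sub>F n in sequentially. (\<exists>M W. admissible \<tau> \<nu> n M W) \<and>
      real (Q (Suc (Suc n))) \<le> real (Q (Suc n)) powr u \<and> D n < min \<theta> (1 - \<theta>)"
    by eventually_elim auto
  then obtain n0 where n0: "\<And>n. n0 \<le> n \<Longrightarrow> \<exists>M W. admissible \<tau> \<nu> n M W"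
    "\<And>n. n0 \<le> n \<Longrightarrow> real (Q (Suc (Suc n))) \<le> real (Q (Suc n)) powr u"
    "\<And>n. n0 \<le> n \<Longrightarrow> D n < min \<theta> (1 - \<theta>)"
    unfolding eventually_sequentially by blast
  obtain M W where MW: "\<And>n. n0 \<le> n \<Longrightarrow> admissible \<tau> \<nu> n (M n) (W n)" using n0(1) by metis
  define ch where "ch k = kids (n0 + k) (M (n0 + k)) (W (n0 + k))" for k
  define S where "S = rec_nat {(1::nat, False)} (\<lambda>k S. \<Union>x\<in>S. ch k x)"
  have S0: "S 0 = {(1, False)}" and SS: "S (Suc k) = (\<Union>x\<in>S k. ch k x)" for k by (auto simp: S_def)
  have M: "1 \<le> M (n0 + k)" "M (n0 + k) \<le> a (n0 + k)" for k using MW[of "n0 + k"] by (auto simp: admissible_def)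
  have orbit1: "orbit_pt 1 = \<theta>" using \<theta>_pos \<theta>_less_1 by (simp add: orbit_pt_def frac_eq)
  have inv: "separated_states (n0 + k) (S k) \<and> (\<forall>x\<in>S k. cell (n0 + k) x \<subseteq> {0<..<1})" for k
  proof (induction k)
    case 0
    have "cell n0 (1, False) \<subseteq> {0<..<1}"
    proof
      fix y assume "y \<in> cell n0 (1, False)"
      then have "\<bar>y - \<theta>\<bar> \<le> D n0" using node_subset_near[of y n0 1] orbit1 by simp
      then show "y \<in> {0<..<1}" using n0(3)[of n0] by (auto simp: abs_le_iff)
    qed
    then show ?case using Q_pos[of n0] by (simp add: S0 separated_states_def Suc_le_eq)
  next
    case (Suc k)
    then have "separated_states (Suc (n0 + k)) (\<Union>x\<in>S k. kids (n0 + k) (M (n0 + k)) (W (n0 + k)) x)"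
      using M by (intro separated_states_kids) auto
    moreover have "cell (Suc (n0 + k)) z \<subseteq> {0<..<1}" if "x \<in> S k" "z \<in> ch k x" for x z
      using kids_cell_subset[OF _ M[of k], of x z "W (n0 + k)"] Suc that unfolding ch_def by blast
    ultimately show ?case unfolding SS by (auto simp: ch_def)
  qed
  have idx: "fst x \<in> {1..Q (Suc (n0 + k))}" if "x \<in> S k" for x k
    using inv[of k] that by (auto simp: separated_states_def)
  have Jin: "cell (n0 + k) x \<subseteq> {0<..<1}" if "x \<in> S k" for x k using inv[of k] that by blast
  show ?thesis
  proof (rule hausdorff_measure_tree_neq_0[where X = S and ch = ch and f = "\<lambda>k. weight \<nu> (n0 + k)"
        and J = "\<lambda>k. cell (n0 + k)" and rmax = "D n0 / 2" and A = 16])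
    show "finite (S k)" for k
      by (rule finite_subset[of _ "{1..Q (Suc (n0 + k))} \<times> UNIV"]) (use idx[of _ k] in auto)
    show "S 0 \<noteq> {}" by (simp add: S0)
    show "x \<in> S k \<Longrightarrow> ch k x \<subseteq> S (Suc k)" for k x by (auto simp: SS)
    show "S (Suc k) \<subseteq> (\<Union>x\<in>S k. ch k x)" for k by (simp add: SS)
    show "x \<in> S k \<Longrightarrow> y \<in> S k \<Longrightarrow> x \<noteq> y \<Longrightarrow> ch k x \<inter> ch k y = {}" for k x y
      unfolding ch_def using inv[of k] by (intro kids_disjoint) auto
    show "x \<in> S k \<Longrightarrow> 0 < weight \<nu> (n0 + k) x" for k x
      using D_pos[of "n0 + k"] D_pos[of "Suc (n0 + k)"] by (simp add: weight_def)
    show "x \<in> S k \<Longrightarrow> weight \<nu> (n0 + k) x \<le> (\<Sum>y\<in>ch k x. weight \<nu> (n0 + Suc k) y)" for k x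
      using weight_kids[OF MW[of "n0 + k"] idx] by (simp add: ch_def)
    show "compact (cell (n0 + k) x)" for k x by (cases x) (simp add: compact_node)
    show "cell (n0 + k) x \<noteq> {}" for k x using orbit_pt_in_node by (cases x) auto
    show "x \<in> S k \<Longrightarrow> y \<in> ch k x \<Longrightarrow> cell (n0 + Suc k) y \<subseteq> cell (n0 + k) x" for k x y
      using kids_cell_subset[OF Jin M] by (simp add: ch_def)
    show "0 < D n0 / 2" using D_pos by simp
    show "0 < s" by (rule s)
    show "\<exists>k. (\<Sum>x | x \<in> S k \<and> cell (n0 + k) x \<inter> {c..c + r} \<noteq> {}. weight \<nu> (n0 + k) x) \<le> 16 * r powr s"
      if r: "0 < r" "r \<le> D n0 / 2" for r c
    proof -
      have "r < D n0" using r D_pos[of n0] by simp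
      \<comment> \<open>\<open>r\<close> lies between two consecutive node lengths. Level
        \<open>n\<close> gives the bound \<open>D n powr \<nu>\<close>, level \<open>n+1\<close> the
        bound \<open>r * D (n+1) powr (\<nu> - 1)\<close>, and the smaller of them is used.\<close>
      then obtain n where n: "n0 \<le> n" "D (Suc n) \<le> r" "r < D n" using r scale_exists by blast
      define k where "k = n - n0"
      have nk: "n0 + k = n" "n0 + Suc k = Suc n" using n by (auto simp: k_def)
      have Dp: "0 < D n" "0 < D (Suc n)" by (rule D_pos)+
      let ?m = "\<lambda>k. \<Sum>x | x \<in> S k \<and> cell (n0 + k) x \<inter> {c..c + r} \<noteq> {}. weight \<nu> (n0 + k) x"
      have "?m k \<le> 2 * (r / D n + 3) * D n powr \<nu>"
        unfolding nk by (rule weight_of_interval) (use idx[of _ k] nk \<nu> r in auto)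
      also have "\<dots> \<le> 8 * D n powr \<nu>"
      proof (rule mult_right_mono)
        have "r / D n \<le> 1" using n Dp by simp
        moreover have "2 * (x + 3) \<le> 8" if "x \<le> 1" for x :: real using that by simp
        ultimately show "2 * (r / D n + 3) \<le> 8" by blast
      qed simp
      finally have m1: "?m k \<le> 8 * D n powr \<nu>" .
      have "?m (Suc k) \<le> 2 * (r / D (Suc n) + 3) * D (Suc n) powr \<nu>"
        unfolding nk by (rule weight_of_interval) (use idx[of _ "Suc k"] nk \<nu> r in auto)
      also have "\<dots> \<le> (8 * (r / D (Suc n))) * D (Suc n) powr \<nu>"
      proof (rule mult_right_mono)
        have "1 \<le> r / D (Suc n)" using n Dp by simp
        moreover have "2 * (x + 3) \<le> 8 * x" if "1 \<le> x" for x :: real using that by simp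
        ultimately show "2 * (r / D (Suc n) + 3) \<le> 8 * (r / D (Suc n))" by blast
      qed simp
      also have "\<dots> = 8 * (r * D (Suc n) powr (\<nu> - 1))" using Dp by (simp add: powr_diff)
      finally have m2: "?m (Suc k) \<le> 8 * (r * D (Suc n) powr (\<nu> - 1))" .
      have "min (D n powr \<nu>) (r * D (Suc n) powr (\<nu> - 1)) \<le> 2 * r powr s"
        by (rule interval_mass_bound[OF \<nu> u(1) s n0(2)[OF n(1)] r(1)])
      then consider "D n powr \<nu> \<le> 2 * r powr s" | "r * D (Suc n) powr (\<nu> - 1) \<le> 2 * r powr s"
        by linarith
      then show ?thesis
      proof cases
        case 1
        then show ?thesis using m1 by (intro exI[of _ k]) linarith
      next
        case 2
        then show ?thesis using m2 by (intro exI[of _ "Suc k"]) linarith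
      qed
    qed
    show "(\<Inter>k. \<Union>x\<in>S k. cell (n0 + k) x) \<subseteq> unif_set \<tau> \<theta>"
    proof
      fix y assume y: "y \<in> (\<Inter>k. \<Union>x\<in>S k. cell (n0 + k) x)"
      have "covered \<tau> X y" if X: "real (Q (Suc n0)) \<le> X" for X
      proof -
        \<comment> \<open>This is the stage with \<open>Q (n+1) \<le> X < Q (n+2)\<close>;
          \<open>admissible\<close> covers its children, so the cell of the next level containing
          \<open>y\<close> is the relevant one.\<close>
        define n where "n = (LEAST n. X < real (Q (Suc (Suc n))))"
        obtain N :: nat where "X < real N" using reals_Archimedean2 by blast
        then have "X < real (Q (Suc (Suc N)))" using Q_ge[of "Suc N"] by linarith
        then have n: "X < real (Q (Suc (Suc n)))" unfolding n_def by (rule LeastI)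
        have nn0: "n0 \<le> n"
        proof (rule ccontr)
          assume "\<not> n0 \<le> n"
          then have "Q (Suc (Suc n)) \<le> Q (Suc n0)" by (intro Q_mono_le) simp
          then show False using n X by linarith
        qed
        have nX: "real (Q (Suc n)) \<le> X"
        proof (cases n)
          case 0 then show ?thesis using nn0 X by simp
        next
          case (Suc m)
          then show ?thesis using not_less_Least[of m "\<lambda>n. X < real (Q (Suc (Suc n)))"] by (simp add: n_def)
        qed
        define k where "k = n - n0"
        have nk: "n0 + k = n" "n0 + Suc k = Suc n" using nn0 by (auto simp: k_def)
        obtain z where z: "z \<in> S (Suc k)" "y \<in> cell (Suc n) z" using y nk by (metis INT_E UNIV_I UN_E)
        then obtain x where x: "x \<in> S k" "z \<in> ch k x" by (auto simp: SS)
        obtain i w where iw: "x = (i, w)" by (cases x)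
        have i: "i \<in> {1..Q (Suc n)}" using idx[OF x(1)] iw nk by simp
        show ?thesis
        proof (cases w)
          case True
          then have "y \<in> node (Suc n) i" using x z iw by (simp add: ch_def)
          then show ?thesis using covered_waiting[OF \<tau> i _ nX n] by blast
        next
          case False
          have "node n i \<subseteq> {0<..<1}" using Jin[OF x(1)] iw False nk by simp
          moreover have "z \<in> kids n (M n) (W n) (i, False)" using x iw False nk by (simp add: ch_def)
          ultimately show ?thesis using MW[OF nn0] i z nX n unfolding admissible_def by blast
        qed
      qed
      moreover have "y \<in> {0..<1}"
      proof -
        obtain x where "x \<in> S 0" "y \<in> cell (n0 + 0) x" using y by blast
        then show ?thesis using Jin[of x 0] by (auto simp: subset_iff)
      qed
      ultimately show "y \<in> unif_set \<tau> \<theta>" unfolding unif_set_def covered_def by blast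
    qed
  qed simp
qed

end

lemma powr_add_subadditive:
  fixes x y \<nu> :: real
  assumes "0 < x" "0 < y" "0 < \<nu>" "\<nu> \<le> 1"
  shows "(x + y) powr \<nu> \<le> x powr \<nu> + y powr \<nu>"
proof -
  have ge: "z \<le> z powr \<nu>" if "0 < z" "z \<le> 1" for z :: real
    using powr_mono'[of \<nu> 1 z] that assms by simp
  have "1 = x / (x + y) + y / (x + y)" using assms by (simp add: add_divide_distrib[symmetric])
  also have "\<dots> \<le> (x / (x + y)) powr \<nu> + (y / (x + y)) powr \<nu>"
    using assms by (intro add_mono ge) auto
  also have "\<dots> = (x powr \<nu> + y powr \<nu>) / (x + y) powr \<nu>"
    using assms by (simp add: powr_divide add_divide_distrib)
  finally show ?thesis using assms by (simp add: pos_le_divide_eq)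
qed

section \<open>Admissible stages at \<open>\<tau> = 1\<close>\<close>

lemma floor_step:
  fixes X :: real and i q :: nat
  assumes "real i \<le> X" "0 < q"
  obtains j :: nat where "real (i + j * q) \<le> X" "X < real (i + Suc j * q)"
proof (rule that[of "nat \<lfloor>(X - real i) / real q\<rfloor>"])
  let ?z = "(X - real i) / real q"
  have z: "0 \<le> ?z" using assms by simp
  then have j: "real (nat \<lfloor>?z\<rfloor>) = of_int \<lfloor>?z\<rfloor>" by simp
  have "of_int \<lfloor>?z\<rfloor> \<le> ?z" by (rule of_int_floor_le)
  then have "of_int \<lfloor>?z\<rfloor> * real q \<le> ?z * real q" by (rule mult_right_mono) simp
  then have "of_int \<lfloor>?z\<rfloor> * real q \<le> X - real i" using assms by simp
  then show "real (i + nat \<lfloor>?z\<rfloor> * q) \<le> X" using j by simp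
  have "?z < of_int \<lfloor>?z\<rfloor> + 1" by linarith
  then have "?z * real q < (of_int \<lfloor>?z\<rfloor> + 1) * real q" by (rule mult_strict_right_mono) (use assms in simp)
  then have "X - real i < (of_int \<lfloor>?z\<rfloor> + 1) * real q" using assms by simp
  then show "X < real (i + Suc (nat \<lfloor>?z\<rfloor>) * q)" using j by (simp add: algebra_simps)
qed

lemma four_mult_le_square: "4 * (k * l) \<le> (k + l)\<^sup>2" for k l :: nat
proof -
  have "0 \<le> (int k - int l)\<^sup>2" by simp
  then have "int (4 * (k * l)) \<le> int ((k + l)\<^sup>2)" by (simp add: power2_eq_square algebra_simps)
  then show ?thesis by (simp only: of_nat_le_iff)
qed

text \<open>At \<open>\<tau> = 1\<close> the kept children must satisfy \<open>sqrt (D n) \<le> \<Sum> sqrt (length)\<close> without any loss of constants,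
  which forces about \<open>sqrt (a n)\<close> of them. Only \<open>a n = 1\<close> and \<open>a n = 4\<close> need the additional waiting cell.\<close>

lemma digit_count_exists:
  fixes A :: nat
  assumes "1 \<le> A"
  obtains M W where "1 \<le> M" "M \<le> A" "\<And>j. 1 \<le> j \<Longrightarrow> j < M \<Longrightarrow> (M - j) * (j + 2) \<le> A + 1"
    "W \<Longrightarrow> (M = 1 \<or> M = 2 \<and> A = 4) \<and> A = M\<^sup>2" "\<not> W \<Longrightarrow> A + 1 \<le> M\<^sup>2"
proof -
  have small: "A = 1 \<or> A = 4 \<or> A = 2 \<or> A = 3 \<or> (5 \<le> A \<and> A \<le> 8) \<or> 9 \<le> A" using assms by linarith
  then show ?thesis
  proof (elim disjE)
    assume "A = 1" then show ?thesis by (intro that[of 1 True]) auto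
  next
    assume A: "A = 4"
    have "(2 - j) * (j + 2) \<le> A + 1" if "1 \<le> j" "j < 2" for j :: nat
    proof -
      have "j = 1" using that by linarith
      then show ?thesis using A by simp
    qed
    then show ?thesis using A by (intro that[of 2 True]) auto
  next
    assume A: "A = 2"
    have "(2 - j) * (j + 2) \<le> A + 1" if "1 \<le> j" "j < 2" for j :: nat
    proof -
      have "j = 1" using that by linarith
      then show ?thesis using A by simp
    qed
    then show ?thesis using A by (intro that[of 2 False]) auto
  next
    assume A: "A = 3"
    have "(2 - j) * (j + 2) \<le> A + 1" if "1 \<le> j" "j < 2" for j :: nat
    proof -
      have "j = 1" using that by linarith
      then show ?thesis using A by simp
    qed
    then show ?thesis using A by (intro that[of 2 False]) auto
  next
    assume A: "5 \<le> A \<and> A \<le> 8"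
    have "(3 - j) * (j + 2) \<le> A + 1" if "1 \<le> j" "j < 3" for j :: nat
    proof -
      have "j = 1 \<or> j = 2" using that by linarith
      then show ?thesis using A by auto
    qed
    then show ?thesis using A by (intro that[of 3 False]) auto
  next
    assume A: "9 \<le> A"
    define M where "M = (LEAST M. A + 1 \<le> M\<^sup>2)"
    have "A + 1 \<le> (A + 1)\<^sup>2" by (simp add: power2_eq_square)
    then have M1: "A + 1 \<le> M\<^sup>2" unfolding M_def by (rule LeastI)
    then obtain m where m: "M = Suc m" by (cases M) auto
    then have "\<not> A + 1 \<le> m\<^sup>2" using not_less_Least[of m "\<lambda>M. A + 1 \<le> M\<^sup>2"] by (simp add: M_def)
    then have mA: "m * m \<le> A" by (simp add: power2_eq_square)
    \<comment> \<open>By the inequality of the means \<open>(M - j) * (j + 2)\<close> is at most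
      \<open>(M + 2)^2 / 4\<close>, so this one estimate settles all \<open>j\<close> at
      once.\<close>
    have sq: "(M + 2)\<^sup>2 \<le> 4 * (A + 1)" and MA: "M \<le> A"
    proof -
      have e: "(M + 2)\<^sup>2 = m * m + 6 * m + 9" by (simp add: m power2_eq_square algebra_simps)
      have "m * m + 6 * m + 9 \<le> 4 * (A + 1) \<and> Suc m \<le> A"
      proof (cases "m \<le> 3")
        case True
        then have "m * m \<le> 3 * 3" by (intro mult_mono) auto
        then show ?thesis using True A by simp
      next
        case False
        then have "4 * m \<le> m * m" by (intro mult_right_mono) simp_all
        moreover have "t + 6 * m + 9 \<le> 4 * (A + 1) \<and> Suc m \<le> A" if "4 * m \<le> t" "t \<le> A" for t
          using that A by auto
        ultimately show ?thesis using mA by blast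
      qed
      then show "(M + 2)\<^sup>2 \<le> 4 * (A + 1)" "M \<le> A" using e m by simp_all
    qed
    have "(M - j) * (j + 2) \<le> A + 1" if "1 \<le> j" "j < M" for j
      using four_mult_le_square[of "M - j" "j + 2"] sq that by simp
    then show ?thesis using M1 MA m by (intro that[of M False]) auto
  qed
qed

context irrational_rotation begin

text \<open>Once an orbit point within \<open>D (n+1)\<close> of \<open>y\<close> is available, it
  serves all later \<open>X\<close> of the stage, because
  \<open>D (n+1) \<le> 1 / Q (n+2) < 1 / X\<close>. The last step to
  \<open>X powr (- \<tau>)\<close> is where \<open>\<tau> \<le> 1\<close> enters.\<close>

lemma covered_late:
  assumes \<tau>: "\<tau> \<le> 1" and j: "anchor n i j c" "1 \<le> j" "real j \<le> X"
    and X: "X < real (Q (Suc (Suc n)))" and t: "\<bar>coord n i y - c\<bar> \<le> D (Suc n)"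
  shows "covered \<tau> X y"
proof (rule coveredI[OF j])
  have X1: "X \<ge> 1" using j by linarith
  note t
  also have "D (Suc n) \<le> 1 / real (Q (Suc (Suc n)))" by (rule D_le)
  also have "\<dots> < 1 / X" using X X1 by (intro divide_strict_left_mono) auto
  also have "\<dots> = X powr (- 1)" using X1 by (simp add: powr_minus_divide)
  also have "\<dots> \<le> X powr (- \<tau>)" using X1 \<tau> by (intro powr_mono) auto
  finally show "\<bar>coord n i y - c\<bar> < X powr (- \<tau>)" .
qed

lemma covered_1I:
  assumes "anchor n i j c" "1 \<le> j" "real j \<le> X" "\<bar>coord n i y - c\<bar> * X < 1"
  shows "covered 1 X y"
proof (rule coveredI[OF assms(1-3)])
  have X: "X \<ge> 1" using assms(2,3) by linarith
  then have "\<bar>coord n i y - c\<bar> < 1 / X" using assms(4) by (simp add: pos_less_divide_eq)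
  then show "\<bar>coord n i y - c\<bar> < X powr (- 1)" using X by (simp add: powr_minus_divide)
qed

text \<open>Before the next orbit point \<open>i + Q (n+1)\<close> enters the gap containing \<open>y\<close>, the balls around both
  ends of the gap cover it; for a long gap this uses \<open>(Q (n+1) - Q n) (D n - D (n+1)) \<ge> 0\<close>.\<close>

lemma covered_early:
  assumes i: "i \<in> {1..Q (Suc n)}" and y: "0 \<le> coord n i y" "coord n i y \<le> D n"
    and X: "real (Q (Suc n)) \<le> X" "X < real (i + Q (Suc n))"
  shows "covered 1 X y"
proof -
  let ?q = "real (Q (Suc n))" and ?p = "real (Q n)"
  let ?t = "coord n i y"
  have X0: "X > 0" using X Q_pos[of n] by linarith
  have d: "D n > 0" "D (Suc n) > 0" "D (Suc n) < D n" using D_pos D_decr by auto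
  have two_sided: "covered 1 X y"
    if L: "anchor n i j L" "1 \<le> j" "j \<le> Q (Suc n)" "L * X < 2" "?t \<le> L" for j L
  proof (cases "?t \<le> L / 2")
    case True
    then have "?t * X \<le> L / 2 * X" using X0 by (intro mult_right_mono) auto
    then have "?t * X < 1" using L by simp
    then show ?thesis using i y X by (intro covered_1I[OF anchor_self[of n i]]) auto
  next
    case False
    then have "(L - ?t) * X \<le> L / 2 * X" using X0 by (intro mult_right_mono) auto
    then have "(L - ?t) * X < 1" using L by simp
    then show ?thesis using L X y by (intro covered_1I[OF L(1)]) auto
  qed
  show ?thesis
  proof (cases "Q n < i")
    case True
    have "D n * X < D n * (2 * ?q)" using X i d by (intro mult_strict_left_mono) auto
    also have "\<dots> \<le> 2" using QD_le[of n] by (simp add: mult_ac)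
    finally have "D n * X < 2" .
    then show ?thesis using True i y by (intro two_sided[of "i - Q n" "D n"] anchor_diff) auto
  next
    case False
    have "(D n + D (Suc n)) * X < (D n + D (Suc n)) * (?p + ?q)"
      using X False d by (intro mult_strict_left_mono) auto
    also have "\<dots> \<le> 2"
    proof -
      have "0 \<le> (?q - ?p) * (D n - D (Suc n))" using Q_mono[of n] d by simp
      moreover have "?q * D n + ?p * D (Suc n) = 1" by (rule det_identity)
      ultimately show ?thesis by (simp add: algebra_simps)
    qed
    finally have "(D n + D (Suc n)) * X < 2" .
    moreover have "1 \<le> i + Q (Suc n) - Q n" "i + Q (Suc n) - Q n \<le> Q (Suc n)"
      using False i Q_mono[of n] by auto
    ultimately show ?thesis
      using y d by (intro two_sided[of "i + Q (Suc n) - Q n" "D n + D (Suc n)"] anchor_add_diff) auto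
  qed
qed

text \<open>While \<open>i + j * q \<le> X < i + (j+1) * q\<close>, the latest point in the
  direction of \<open>y\<close> is number \<open>j\<close>, at distance at most
  \<open>(b - j) * D (n+1)\<close>. It covers \<open>y\<close> if
  \<open>(b - j) * (i + (j+1) * q)\<close> is at most \<open>Q (n+2)\<close>, and the condition on
  \<open>(M - j) * (j + 2)\<close> is made for this. The start \<open>j = 0\<close> is
  \<open>covered_early\<close>, the end \<open>j \<ge> b\<close> is
  \<open>covered_late\<close>.\<close>

lemma covered_step:
  assumes i: "i \<in> {1..Q (Suc n)}" and y: "0 \<le> coord n i y" "coord n i y \<le> D n"
    and M: "\<And>j. 1 \<le> j \<Longrightarrow> j < M \<Longrightarrow> (M - j) * (j + 2) \<le> a n + 1"
    and b: "1 \<le> b" "b \<le> M" "i \<le> Q n \<or> b \<le> M - 1"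
    and t: "(real b - 1) * D (Suc n) \<le> coord n i y" "coord n i y \<le> real b * D (Suc n)"
    and X: "real (Q (Suc n)) \<le> X" "X < real (Q (Suc (Suc n)))"
  shows "covered 1 X y"
proof -
  let ?q = "Q (Suc n)" and ?p = "Q n" and ?d = "D (Suc n)"
  have d: "?d > 0" by (rule D_pos)
  have iX: "real i \<le> X" using i X by auto
  obtain j where j: "real (i + j * ?q) \<le> X" "X < real (i + Suc j * ?q)"
    using floor_step[OF iX Q_pos] by blast
  show ?thesis
  proof (cases "j = 0")
    case True
    then show ?thesis using j X by (intro covered_early[OF i y]) auto
  next
    case False
    show ?thesis
    proof (cases "b \<le> j")
      case True
      then have "b * ?q \<le> j * ?q" by (rule mult_right_mono) simp
      then have "real (i + b * ?q) \<le> real (i + j * ?q)" unfolding of_nat_le_iff by linarith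
      then have "real (i + b * ?q) \<le> X" using j by linarith
      moreover have "\<bar>coord n i y - real b * ?d\<bar> \<le> ?d" using t by (simp add: left_diff_distrib)
      ultimately show ?thesis using i X by (intro covered_late[OF _ anchor_add]) auto
    next
      case jb: False
      define k where "k = M - j"
      have k: "1 \<le> k" "b - j \<le> k" "k * (j + 2) \<le> a n + 1"
        using M[of j] False jb b by (auto simp: k_def)
      \<comment> \<open>For \<open>i \<le> Q n\<close> one summand \<open>Q n\<close> is kept and
        the other \<open>k - 1\<close> are enlarged to \<open>Q (n+1)\<close>, leaving
        \<open>k * (j + 2) - 1 \<le> a n\<close> multiples of \<open>Q (n+1)\<close>. For larger
        \<open>i\<close> the bound \<open>b \<le> M - 1\<close> saves one unit of \<open>k\<close>
        instead.\<close>
      have main: "(b - j) * (i + Suc j * ?q) \<le> Q (Suc (Suc n))"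
      proof (cases "i \<le> ?p")
        case True
        obtain k' where k': "k = Suc k'" using k(1) by (cases k) auto
        have "(b - j) * (i + Suc j * ?q) \<le> k * (?p + Suc j * ?q)"
          using True k(2) by (intro mult_mono add_mono) auto
        also have "\<dots> = ?p + k' * ?p + k * Suc j * ?q" by (simp add: k' algebra_simps)
        also have "\<dots> \<le> ?p + k' * ?q + k * Suc j * ?q" using Q_mono[of n] by simp
        also have "\<dots> = ?p + (k' + k * Suc j) * ?q" by (simp add: algebra_simps)
        also have "\<dots> \<le> ?p + a n * ?q"
        proof -
          have "k' + k * Suc j \<le> a n" using k(3) by (simp add: k' algebra_simps)
          then show ?thesis by (intro add_left_mono mult_right_mono) auto
        qed
        finally show ?thesis by (simp add: Q_rec)
      next
        case False
        then have bM: "b \<le> M - 1" using b by simp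
        obtain k' where k': "k = Suc k'" using k(1) by (cases k) auto
        have "b - j \<le> k'" using bM k' by (simp add: k_def)
        then have "(b - j) * (i + Suc j * ?q) \<le> k' * (?q + Suc j * ?q)"
          using i by (intro mult_mono add_mono) auto
        also have "\<dots> = (k' * (j + 2)) * ?q" by (simp add: algebra_simps)
        also have "\<dots> \<le> a n * ?q"
        proof -
          have "k' * (j + 2) \<le> a n" using k(3) by (simp add: k' algebra_simps)
          then show ?thesis by (intro mult_right_mono) auto
        qed
        finally show ?thesis by (simp add: Q_rec)
      qed
      have bj: "real (b - j) = real b - real j" using jb by (simp add: of_nat_diff)
      have "0 \<le> (real b - 1 - real j) * ?d" using jb d by simp
      then have t0: "0 \<le> coord n i y - real j * ?d" using t by (simp add: left_diff_distrib)
      have "(coord n i y - real j * ?d) * X \<le> (real (b - j) * ?d) * X"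
        using t iX unfolding bj by (intro mult_right_mono) (auto simp: left_diff_distrib)
      also have "\<dots> < (real (b - j) * ?d) * real (i + Suc j * ?q)"
        using j jb d by (intro mult_strict_left_mono) auto
      also have "\<dots> = ?d * real ((b - j) * (i + Suc j * ?q))" by (simp only: of_nat_mult mult_ac)
      also have "\<dots> \<le> ?d * real (Q (Suc (Suc n)))" using main d by (intro mult_left_mono) (auto simp only: of_nat_le_iff less_imp_le)
      also have "\<dots> \<le> 1" using QD_le[of "Suc n"] by (simp add: mult.commute)
      finally have "(coord n i y - real j * ?d) * X < 1" .
      then show ?thesis using t0 i j by (intro covered_1I[OF anchor_add[of n i j]]) auto
    qed
  qed
qed

text \<open>\<open>covered_early\<close> and \<open>covered_late\<close> leave a window only for
  \<open>M = 2\<close>, \<open>a n = 4\<close> and \<open>i \<le> Q n\<close>: between the arrivals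
  of the first and the second step point. There the first step point must reach as far as
  \<open>D (n+1) + D (n+2)\<close>, which the determinant identity with
  \<open>Q (n+2) = 4 * Q (n+1) + Q n\<close> permits.\<close>

lemma covered_wait:
  assumes i: "i \<in> {1..Q (Suc n)}" and y: "0 \<le> coord n i y" "coord n i y \<le> D n"
    and M: "M = 1 \<or> M = 2 \<and> a n = 4" and b: "i \<le> Q n \<and> b = M \<or> Q n < i \<and> b = M - 1"
    and t: "real b * D (Suc n) \<le> coord n i y" "coord n i y \<le> real b * D (Suc n) + D (Suc (Suc n))"
    and X: "real (Q (Suc n)) \<le> X" "X < real (Q (Suc (Suc n)))"
  shows "covered 1 X y"
proof -
  let ?q = "real (Q (Suc n))" and ?p = "real (Q n)" and ?d = "D (Suc n)" and ?d' = "D (Suc (Suc n))"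
  have d: "?d > 0" "?d' > 0" "?d' < ?d" using D_pos D_decr by auto
  have late: "covered 1 X y" if "real (i + b * Q (Suc n)) \<le> X"
    using t d i X that by (intro covered_late[OF _ anchor_add]) auto
  consider "X < real (i + Q (Suc n))" | "real (i + b * Q (Suc n)) \<le> X"
    | "real (i + Q (Suc n)) \<le> X" "X < real (i + b * Q (Suc n))" by linarith
  then show ?thesis
  proof cases
    case 1
    then show ?thesis using covered_early[OF i y X(1)] by simp
  next
    case 2
    then show ?thesis by (rule late)
  next
    case 3
    have "b \<noteq> 0"
    proof
      assume "b = 0"
      then show False using 3 by simp
    qed
    moreover have "b \<noteq> 1" using 3 by auto
    ultimately have Mb: "b = 2" "a n = 4" "i \<le> Q n" using M b by auto
    have q': "real (Q (Suc (Suc n))) = 4 * ?q + ?p" using Mb by (simp add: Q_rec)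
    have det: "(4 * ?q + ?p) * ?d + ?q * ?d' = 1" using det_identity[of "Suc n"] q' by simp
    have "(coord n i y - 1 * ?d) * X \<le> (?d + ?d') * X"
      using t Mb X by (intro mult_right_mono) auto
    also have "\<dots> < (?d + ?d') * (2 * ?q + ?p)"
      using 3 Mb d by (intro mult_strict_left_mono) auto
    also have "\<dots> \<le> 1"
    proof -
      have "?p * ?d' \<le> ?q * ?d" using Q_mono[of n] d by (intro mult_mono) auto
      moreover have "?q * ?d' \<le> ?q * ?d" using d by (intro mult_left_mono) auto
      ultimately show ?thesis using det by (simp add: algebra_simps)
    qed
    finally have "(coord n i y - 1 * ?d) * X < 1" .
    moreover have "0 \<le> coord n i y - 1 * ?d" using t Mb d by simp
    ultimately show ?thesis using 3 i by (intro covered_1I[OF anchor_add[of n i 1]]) auto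
  qed
qed

lemma kids_coord:
  assumes "node n i \<subseteq> {0<..<1}" "1 \<le> M" "M \<le> a n" "z \<in> kids n M W (i, False)" "y \<in> cell (Suc n) z"
  obtains (step) b where "1 \<le> b" "b \<le> M" "i \<le> Q n \<or> b \<le> M - 1"
      "(real b - 1) * D (Suc n) \<le> coord n i y" "coord n i y \<le> real b * D (Suc n)"
  | (far) "Q n < i" "\<bar>coord n i y - D n\<bar> \<le> D (Suc n)"
  | (wait) b where "W" "i \<le> Q n \<and> b = M \<or> Q n < i \<and> b = M - 1"
      "real b * D (Suc n) \<le> coord n i y" "coord n i y \<le> real b * D (Suc n) + D (Suc (Suc n))"
  using assms(4)
proof (cases rule: kids_cases)
  case s: (step b)
  then show ?thesis using assms(3,5) cell_step[OF assms(1), of b] by (intro step[of b]) auto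
next
  case f: far
  then show ?thesis using assms(5) cell_back[OF assms(1)] D_pos[of "Suc n"] by (intro far) auto
next
  case w: (wait b)
  then have "b \<le> a n" using assms(3) by auto
  then show ?thesis using w assms(5) cell_wait[OF assms(1), of b] by (intro wait[of b]) auto
qed

lemma kids_coord_range:
  assumes "node n i \<subseteq> {0<..<1}" "1 \<le> M" "M \<le> a n" "z \<in> kids n M W (i, False)" "y \<in> cell (Suc n) z"
  shows "0 \<le> coord n i y" "coord n i y \<le> D n"
proof -
  have "y \<in> cell n (i, False)" using kids_cell_subset[of n "(i, False)" M z W] assms by auto
  then show "0 \<le> coord n i y" "coord n i y \<le> D n" by (auto simp: node_def)
qed

lemma covered_far:
  assumes "\<tau> \<le> 1" "i \<in> {1..Q (Suc n)}" "Q n < i" "\<bar>coord n i y - D n\<bar> \<le> D (Suc n)"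
    "real (Q (Suc n)) \<le> X" "X < real (Q (Suc (Suc n)))"
  shows "covered \<tau> X y"
  using assms by (intro covered_late[OF _ anchor_diff[of n i]]) auto

text \<open>Squaring turns the weight condition for \<open>\<nu> = 1/2\<close> into integers:
  without a waiting piece, \<open>D n \<le> (a n + 1) * D (n+1)\<close> and
  \<open>a n + 1 \<le> M^2\<close>; with it, \<open>a n = M^2\<close> and the square of the waiting
  term supplies the missing \<open>D (n+2)\<close>.\<close>

lemma admissible_1: "\<exists>M W. admissible 1 (1 / 2) n M W"
proof (rule digit_count_exists[OF a_pos[of n]])
  fix M W
  assume M: "1 \<le> M" "M \<le> a n" "\<And>j. 1 \<le> j \<Longrightarrow> j < M \<Longrightarrow> (M - j) * (j + 2) \<le> a n + 1"
    and W: "W \<Longrightarrow> (M = 1 \<or> M = 2 \<and> a n = 4) \<and> a n = M\<^sup>2" "\<not> W \<Longrightarrow> a n + 1 \<le> M\<^sup>2"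
  have d: "D n > 0" "D (Suc n) > 0" "D (Suc (Suc n)) > 0" "D (Suc (Suc n)) < D (Suc n)" using D_pos D_decr by auto
  have "sqrt (D n) \<le> real M * sqrt (D (Suc n)) + (if W then sqrt (D (Suc (Suc n))) else 0)"
  proof (rule real_le_lsqrt)
    show "D n \<le> (real M * sqrt (D (Suc n)) + (if W then sqrt (D (Suc (Suc n))) else 0))\<^sup>2"
    proof (cases W)
      case True
      have "D n = (real M)\<^sup>2 * D (Suc n) + D (Suc (Suc n))" using D_rec[of n] W(1) True by simp
      also have "\<dots> \<le> (real M * sqrt (D (Suc n)) + sqrt (D (Suc (Suc n))))\<^sup>2"
        using d by (simp add: power2_sum power_mult_distrib)
      finally show ?thesis using True by simp
    next
      case False
      have "D n \<le> real (a n + 1) * D (Suc n)" using D_rec[of n] d by (simp add: algebra_simps)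
      also have "\<dots> \<le> real (M\<^sup>2) * D (Suc n)" using W(2)[OF False] d
        by (intro mult_right_mono) (simp_all only: of_nat_le_iff less_imp_le)
      finally show ?thesis using False d by (simp add: power_mult_distrib)
    qed
  qed (use d in auto)
  moreover have "covered 1 X y"
    if "i \<in> {1..Q (Suc n)}" "node n i \<subseteq> {0<..<1}" "z \<in> kids n M W (i, False)" "y \<in> cell (Suc n) z"
      "real (Q (Suc n)) \<le> X" "X < real (Q (Suc (Suc n)))" for i z y X
  proof -
    note r = kids_coord_range[OF that(2) M(1,2) that(3,4)]
    from that(2) M(1,2) that(3,4) show ?thesis
    proof (cases rule: kids_coord)
      case (step b)
      then show ?thesis by (intro covered_step[OF that(1) r M(3) _ _ _ _ _ that(5,6)])
    next
      case far
      then show ?thesis using that by (intro covered_far) auto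
    next
      case (wait b)
      then show ?thesis using W(1) that by (intro covered_wait[OF that(1) r, of M b]) auto
    qed
  qed
  ultimately have "admissible 1 (1 / 2) n M W"
    unfolding admissible_def using M d by (auto simp: powr_half_sqrt)
  then show "\<exists>M W. admissible 1 (1 / 2) n M W" by blast
qed

end

section \<open>Dimension bounds\<close>

lemma hausdorff_dim_le:
  assumes "0 \<le> x" and "\<And>s. x < s \<Longrightarrow> hausdorff_measure s E = 0"
  shows "0 \<le> hausdorff_dim E" "hausdorff_dim E \<le> x"
proof -
  let ?S = "{s::real. s > 0 \<and> hausdorff_measure s E = 0}"
  have "x + 1 \<in> ?S" using assms by auto
  then show "0 \<le> hausdorff_dim E" unfolding hausdorff_dim_def by (intro cInf_greatest) auto
  have bdd: "bdd_below ?S" by (rule bdd_belowI[of _ 0]) auto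
  show "hausdorff_dim E \<le> x"
  proof (rule dense_ge)
    fix s assume "x < s"
    then have "s \<in> ?S" using assms by auto
    then show "hausdorff_dim E \<le> s" unfolding hausdorff_dim_def using bdd by (rule cInf_lower)
  qed
qed

text \<open>The exponent \<open>t\<close> keeps the set in the definition of the dimension nonempty;
  a lower bound passes to a real infimum only then.\<close>

lemma hausdorff_dim_ge:
  assumes "t > 0" "hausdorff_measure t E = 0"
    and "\<And>s. 0 < s \<Longrightarrow> s \<le> x \<Longrightarrow> hausdorff_measure s E \<noteq> 0"
  shows "x \<le> hausdorff_dim E"
  unfolding hausdorff_dim_def
proof (rule cInf_greatest)
  show "{s::real. s > 0 \<and> hausdorff_measure s E = 0} \<noteq> {}" using assms(1,2) by auto
next
  fix s assume "s \<in> {s::real. s > 0 \<and> hausdorff_measure s E = 0}"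
  then show "x \<le> s" using assms(3)[of s] by force
qed

section \<open>Admissible stages for \<open>\<tau> < 1\<close>\<close>

context irrational_rotation begin

text \<open>The whole node has length at most \<open>1 / Q (n+1)\<close>, which for such
  \<open>Q (n+2)\<close> is below \<open>X powr (- \<tau>)\<close> throughout the stage. So the base
  point alone covers it, every child is kept, and the weight condition is subadditivity of
  \<open>t powr \<nu>\<close>.\<close>

lemma admissible_full:
  assumes \<tau>: "0 < \<tau>" "\<tau> \<le> 1" and \<nu>: "0 < \<nu>" "\<nu> \<le> 1"
    and q': "real (Q (Suc (Suc n))) \<le> real (Q (Suc n)) powr (1 / \<tau>)"
  shows "admissible \<tau> \<nu> n (a n) True"
proof -
  let ?q = "real (Q (Suc n))" and ?q' = "real (Q (Suc (Suc n)))"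
  have q: "?q > 0" "?q' > 0" using Q_pos[of n] Q_pos[of "Suc n"] by auto
  have d: "D n > 0" "D (Suc n) > 0" "D (Suc (Suc n)) > 0" by (rule D_pos)+
  have a1: "1 \<le> real (a n)" using a_pos[of n] by simp
  have "D n powr \<nu> = (real (a n) * D (Suc n) + D (Suc (Suc n))) powr \<nu>" using D_rec[of n] by simp
  also have "\<dots> \<le> (real (a n) * D (Suc n)) powr \<nu> + D (Suc (Suc n)) powr \<nu>"
    using a1 d \<nu> by (intro powr_add_subadditive) auto
  also have "(real (a n) * D (Suc n)) powr \<nu> \<le> real (a n) * D (Suc n) powr \<nu>"
    using powr_mono[of \<nu> 1 "real (a n)"] a1 \<nu> d by (simp add: powr_mult)
  finally have pot: "D n powr \<nu> \<le> real (a n) * D (Suc n) powr \<nu> + D (Suc (Suc n)) powr \<nu>" by simp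
  have "covered \<tau> X y"
    if i: "i \<in> {1..Q (Suc n)}" "node n i \<subseteq> {0<..<1}" "z \<in> kids n (a n) True (i, False)" "y \<in> cell (Suc n) z"
      "?q \<le> X" "X < ?q'" for i z y X
  proof (rule coveredI[OF anchor_self[of n i]])
    have "\<bar>coord n i y - 0\<bar> \<le> D n" using kids_coord_range[OF i(2) a_pos order_refl i(3,4)] by simp
    also have "\<dots> \<le> ?q powr (- 1)" using D_le[of n] q by (simp add: powr_minus_divide)
    also have "\<dots> = (?q powr (1 / \<tau>)) powr (- \<tau>)" using \<tau> by (simp add: powr_powr)
    also have "\<dots> \<le> ?q' powr (- \<tau>)" using q' q \<tau> by (intro powr_mono2') auto
    also have "\<dots> < X powr (- \<tau>)" using i q \<tau> by (intro powr_less_mono2_neg) auto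
    finally show "\<bar>coord n i y - 0\<bar> < X powr (- \<tau>)" .
  qed (use i in auto)
  then show ?thesis unfolding admissible_def using a_pos pot by auto
qed

text \<open>\<open>Y\<close> is \<open>crit_scale \<tau> n / Q (n+1)\<close>, the solution of
  \<open>Y / q' = (Y * q) powr (- \<tau>)\<close>: up to \<open>X = Y * q\<close> the base point
  reaches \<open>Y\<close> steps far, and afterwards each kept child has its own orbit point. One
  step is given up in \<open>M\<close> because \<open>i\<close> itself may be as large as
  \<open>q\<close>. The factor 4 pays for \<open>Y / 2 \<le> M\<close> and for
  \<open>D n \<le> 2 * (q' / q) * D (n+1)\<close>.\<close>

lemma admissible_steps:
  assumes \<tau>: "0 < \<tau>" "\<tau> \<le> 1" and \<nu>: "0 < \<nu>" "\<nu> \<le> 1"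
    and q': "real (Q (Suc n)) powr (1 / \<tau>) \<le> real (Q (Suc (Suc n)))"
  defines "Y \<equiv> (real (Q (Suc (Suc n))) / real (Q (Suc n)) powr \<tau>) powr (1 / (1 + \<tau>))"
  assumes Y: "4 \<le> Y" "4 * (real (Q (Suc (Suc n))) / real (Q (Suc n))) powr \<nu> \<le> Y"
  shows "admissible \<tau> \<nu> n (nat \<lfloor>Y\<rfloor> - 1) False"
proof -
  let ?q = "real (Q (Suc n))" and ?q' = "real (Q (Suc (Suc n)))"
  define M where "M = nat \<lfloor>Y\<rfloor> - 1"
  have q: "?q > 0" "?q' > 0" using Q_pos[of n] Q_pos[of "Suc n"] by auto
  have d: "D n > 0" "D (Suc n) > 0" "D (Suc (Suc n)) > 0" "D (Suc (Suc n)) < D (Suc n)"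
    using D_pos D_decr by auto
  have fl: "4 \<le> \<lfloor>Y\<rfloor>" using Y by (simp add: le_floor_iff)
  then have "int M = \<lfloor>Y\<rfloor> - 1" unfolding M_def by linarith
  then have Mr: "real M = of_int \<lfloor>Y\<rfloor> - 1" by (metis of_int_of_nat_eq of_int_diff of_int_1)
  have M: "real M + 1 \<le> Y" "Y / 2 \<le> real M" "1 \<le> M"
  proof -
    have "Y < of_int \<lfloor>Y\<rfloor> + 1" "of_int \<lfloor>Y\<rfloor> \<le> Y" by linarith+
    then show "real M + 1 \<le> Y" "Y / 2 \<le> real M" using Y(1) Mr by linarith+
    show "1 \<le> M" using fl unfolding M_def by linarith
  qed
  have Yp: "Y powr (1 + \<tau>) = ?q' / ?q powr \<tau>" using \<tau> q by (simp add: Y_def powr_powr)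
  have Yq: "Y / ?q' = (Y * ?q) powr (- \<tau>)"
  proof -
    have "Y * Y powr \<tau> * ?q powr \<tau> = ?q'" using Yp Y q by (simp add: powr_add field_simps)
    then show ?thesis using Y q by (simp add: powr_mult powr_minus field_simps)
  qed
  have qa: "?q' / ?q \<le> real (a n) + 1"
  proof -
    have "?q' \<le> (real (a n) + 1) * ?q" using Q_mono[of n] by (simp add: Q_rec algebra_simps)
    then show ?thesis using q by (simp add: pos_divide_le_eq)
  qed
  have "Y \<le> ?q' / ?q"
  proof (rule ccontr)
    assume "\<not> Y \<le> ?q' / ?q"
    then have "(?q' / ?q) powr (1 + \<tau>) < Y powr (1 + \<tau>)" using q \<tau> by (intro powr_less_mono2) auto
    then have "(?q' / ?q) powr (1 + \<tau>) < ?q' / ?q powr \<tau>" unfolding Yp .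
    then have "?q' * ?q' powr \<tau> / (?q * ?q powr \<tau>) < ?q' / ?q powr \<tau>"
      using q by (simp add: powr_divide powr_add)
    then have "?q' powr \<tau> < ?q" using q by (simp add: field_simps)
    moreover have "?q = (?q powr (1 / \<tau>)) powr \<tau>" using q \<tau> by (simp add: powr_powr)
    moreover have "(?q powr (1 / \<tau>)) powr \<tau> \<le> ?q' powr \<tau>" using q' \<tau> by (intro powr_mono2) auto
    ultimately show False by linarith
  qed
  then have Ma: "M \<le> a n" using M(1) qa by linarith
  have pot: "D n powr \<nu> \<le> real M * D (Suc n) powr \<nu>"
  proof -
    have "1 \<le> real (a n)" using a_pos[of n] by simp
    moreover have "real (a n) * ?q \<le> ?q'" by (simp add: Q_rec)
    then have "real (a n) \<le> ?q' / ?q" using q by (simp add: pos_le_divide_eq)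
    ultimately have "real (a n) + 1 \<le> 2 * (?q' / ?q)" by linarith
    then have "(real (a n) + 1) * D (Suc n) \<le> 2 * (?q' / ?q) * D (Suc n)"
      using d by (intro mult_right_mono) auto
    moreover have "D n \<le> (real (a n) + 1) * D (Suc n)" using D_rec[of n] d by (simp add: algebra_simps)
    ultimately have "D n \<le> 2 * (?q' / ?q) * D (Suc n)" by linarith
    then have "D n powr \<nu> \<le> (2 * (?q' / ?q) * D (Suc n)) powr \<nu>" using d \<nu> by (intro powr_mono2) auto
    also have "\<dots> = 2 powr \<nu> * ((?q' / ?q) powr \<nu> * D (Suc n) powr \<nu>)"
      using q d by (simp add: powr_mult mult.assoc del: times_divide_eq_right times_divide_eq_left)
    also have "\<dots> \<le> 2 powr 1 * ((?q' / ?q) powr \<nu> * D (Suc n) powr \<nu>)"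
      using \<nu> by (intro mult_right_mono powr_mono) auto
    also have "\<dots> = (2 * (?q' / ?q) powr \<nu>) * D (Suc n) powr \<nu>" by (simp add: mult.assoc)
    also have "\<dots> \<le> real M * D (Suc n) powr \<nu>"
      using Y(2) M(2) by (intro mult_right_mono) auto
    finally show ?thesis .
  qed
  have "covered \<tau> X y"
    if i: "i \<in> {1..Q (Suc n)}" "node n i \<subseteq> {0<..<1}" "z \<in> kids n M False (i, False)" "y \<in> cell (Suc n) z"
      "?q \<le> X" "X < ?q'" for i z y X
  proof -
    note r = kids_coord_range[OF i(2) M(3) Ma i(3,4)]
    from i(2) M(3) Ma i(3,4) show ?thesis
    proof (cases rule: kids_coord)
      case (step b)
      show ?thesis
      proof (cases "real (i + b * Q (Suc n)) \<le> X")
        case True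
        have "\<bar>coord n i y - real b * D (Suc n)\<bar> \<le> D (Suc n)" using step by (simp add: left_diff_distrib)
        then show ?thesis using True i \<tau> by (intro covered_late[OF _ anchor_add[of n i b]]) auto
      next
        case False
        have "real b * ?q \<le> real M * ?q" using step by (intro mult_right_mono) auto
        moreover have "X < real i + real b * ?q" using False by simp
        moreover have "real i \<le> ?q" using i(1) by simp
        ultimately have "X < (real M + 1) * ?q" unfolding distrib_right mult_1_left by linarith
        also have "\<dots> \<le> Y * ?q" using M by (intro mult_right_mono) auto
        finally have X: "X < Y * ?q" .
        show ?thesis
        proof (rule coveredI[OF anchor_self[of n i]])
          have "\<bar>coord n i y - 0\<bar> \<le> real b * D (Suc n)" using r step by simp
          also have "\<dots> \<le> Y * (1 / ?q')" using step M D_le[of "Suc n"] d by (intro mult_mono) auto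
          also have "\<dots> = (Y * ?q) powr (- \<tau>)" using Yq by simp
          also have "\<dots> < X powr (- \<tau>)" using X i q \<tau> by (intro powr_less_mono2_neg) auto
          finally show "\<bar>coord n i y - 0\<bar> < X powr (- \<tau>)" .
        qed (use i in auto)
      qed
    next
      case far
      then show ?thesis using i \<tau> by (intro covered_far) auto
    qed auto
  qed
  then have "admissible \<tau> \<nu> n M False" unfolding admissible_def using M Ma pot by auto
  then show ?thesis by (simp add: M_def)
qed

text \<open>In logarithms, \<open>(L' - \<tau> * L) / (1 + \<tau>)\<close> has to exceed
  \<open>\<nu> * (L' - L)\<close> by \<open>ln 4\<close>. For \<open>\<tau> < 1\<close> the quotient
  of the first by \<open>L' - L\<close> decreases with \<open>L'\<close> and equals
  \<open>\<nu>\<close> at \<open>L' = v * L\<close>; since \<open>L' \<le> u * L\<close>, the slack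
  is at least \<open>\<kappa> * L\<close>. At \<open>\<tau> = 1\<close> the quotient is constantly
  1/2 and no slack exists.\<close>

lemma eventually_admissible:
  assumes \<tau>: "0 < \<tau>" "\<tau> \<le> 1" and u: "1 < u" "u < v" "irr_exponent \<theta> < ereal u" and v: "1 \<le> \<tau> * v"
  shows "\<forall>\<^sub>F n in sequentially. \<exists>M W. admissible \<tau> ((v - \<tau>) / ((1 + \<tau>) * (v - 1))) n M W"
proof (cases "\<tau> = 1")
  case True
  have half: "(v - 1) / ((1 + 1) * (v - 1)) = 1 / 2" using u by simp
  show ?thesis unfolding True half using admissible_1 by simp
next
  case False
  then have \<tau>1: "\<tau> < 1" using \<tau> by simp
  define \<nu> where "\<nu> = (v - \<tau>) / ((1 + \<tau>) * (v - 1))"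
  \<comment> \<open>The condition \<open>\<nu> \<le> 1\<close> amounts to
    \<open>1 \<le> \<tau> * v\<close>.\<close>
  have \<nu>: "0 < \<nu>" "\<nu> \<le> 1" using \<tau> u v by (simp_all add: \<nu>_def divide_le_eq algebra_simps)
  define \<kappa> where "\<kappa> = (1 - \<tau>) * (v - u) / ((1 + \<tau>) * (v - 1))"
  have \<kappa>: "\<kappa> > 0" using \<tau>1 \<tau> u by (simp add: \<kappa>_def)
  have "1 * \<tau> < 1 / \<tau>" 
  proof -
    have "\<tau> * \<tau> < 1 * 1" using \<tau> \<tau>1 by (intro mult_strict_mono) auto
    then show ?thesis using \<tau> by (simp add: pos_less_divide_eq)
  qed
  then have "1 / \<tau> - \<tau> > 0" by simp
  then have "\<forall>\<^sub>F x::real in at_top. 4 powr (1 + \<tau>) \<le> x powr (1 / \<tau> - \<tau>) \<and> 4 \<le> x powr \<kappa>"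
    using \<kappa> by (intro eventually_conj eventually_le_powr)
  then have "\<forall>\<^sub>F n in sequentially. 4 powr (1 + \<tau>) \<le> real (Q (Suc n)) powr (1 / \<tau> - \<tau>) \<and> 4 \<le> real (Q (Suc n)) powr \<kappa>"
    using filterlim_Q by (rule eventually_compose_filterlim)
  moreover have "\<forall>\<^sub>F n in sequentially. real (Q (Suc (Suc n))) \<le> real (Q (Suc n)) powr u"
    using u by (intro eventually_Q_le) auto
  ultimately have "\<forall>\<^sub>F n in sequentially. \<exists>M W. admissible \<tau> \<nu> n M W"
  proof eventually_elim
    case (elim n)
    let ?q = "real (Q (Suc n))" and ?q' = "real (Q (Suc (Suc n)))"
    have q: "?q > 0" "?q' > 0" using Q_pos[of n] Q_pos[of "Suc n"] by auto
    show ?case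
    proof (cases "?q' \<le> ?q powr (1 / \<tau>)")
      case True
      then show ?thesis using admissible_full[OF \<tau> \<nu>] by blast
    next
      case False
      define Z where "Z = ?q' / ?q powr \<tau>"
      have Z: "Z > 0" using q by (simp add: Z_def)
      have "4 powr (1 + \<tau>) \<le> ?q powr (1 / \<tau>) / ?q powr \<tau>" using elim(1) by (simp add: powr_diff)
      also have "\<dots> \<le> Z" using False q unfolding Z_def by (intro divide_right_mono) auto
      finally have "(4 powr (1 + \<tau>)) powr (1 / (1 + \<tau>)) \<le> Z powr (1 / (1 + \<tau>))"
        using \<tau> by (intro powr_mono2) auto
      then have Y4: "4 \<le> Z powr (1 / (1 + \<tau>))" using \<tau> by (simp add: powr_powr)
      define L where "L = ln ?q"
      define L' where "L' = ln ?q'"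
      have "L' \<le> ln (?q powr u)" unfolding L'_def using elim(2) q by (intro ln_mono) auto
      then have L': "L' \<le> u * L" using q by (simp add: L_def ln_powr)
      have "ln 4 \<le> ln (?q powr \<kappa>)" using elim(1) q by (intro ln_mono) auto
      then have \<kappa>L: "ln 4 \<le> \<kappa> * L" using q by (simp add: L_def ln_powr)
      have "ln 4 + \<nu> * (L' - L) \<le> (L' - \<tau> * L) / (1 + \<tau>)"
      proof -
        have "(1 - \<tau>) * ((v - u) * L) \<le> (1 - \<tau>) * (v * L - L')"
          using L' \<tau>1 by (intro mult_left_mono) (auto simp: algebra_simps)
        then have "(1 - \<tau>) * ((v - u) * L) / ((1 + \<tau>) * (v - 1)) \<le> (1 - \<tau>) * (v * L - L') / ((1 + \<tau>) * (v - 1))"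
          using \<tau> u by (intro divide_right_mono) auto
        then have "\<kappa> * L \<le> (1 - \<tau>) * (v * L - L') / ((1 + \<tau>) * (v - 1))" by (simp add: \<kappa>_def)
        also have "(1 - \<tau>) * (v * L - L') = (L' - \<tau> * L) * (v - 1) - (v - \<tau>) * (L' - L)" by (simp add: algebra_simps)
        also have "\<dots> / ((1 + \<tau>) * (v - 1)) = (L' - \<tau> * L) / (1 + \<tau>) - \<nu> * (L' - L)"
          using u by (simp only: \<nu>_def diff_divide_distrib[of "_ * _" "_ * _"]) simp
        finally show ?thesis using \<kappa>L by linarith
      qed
      then have "ln (4 * (?q' / ?q) powr \<nu>) \<le> ln (Z powr (1 / (1 + \<tau>)))"
        using q by (simp add: Z_def ln_mult ln_powr ln_div L_def L'_def)
      moreover have "0 < 4 * (?q' / ?q) powr \<nu>" "0 < Z powr (1 / (1 + \<tau>))" using q Z by simp_all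
      ultimately have "4 * (?q' / ?q) powr \<nu> \<le> Z powr (1 / (1 + \<tau>))" using ln_le_cancel_iff by blast
      then have "admissible \<tau> \<nu> n (nat \<lfloor>Z powr (1 / (1 + \<tau>))\<rfloor> - 1) False"
        using Y4 False unfolding Z_def by (intro admissible_steps[OF \<tau> \<nu>]) auto
      then show ?thesis by blast
    qed
  qed
  then show ?thesis by (simp add: \<nu>_def)
qed

lemma hausdorff_dim_infinite_exponent:
  assumes "irr_exponent \<theta> = \<infinity>" "\<tau> > 0"
  shows "hausdorff_dim (unif_set \<tau> \<theta>) = 0"
proof -
  \<comment> \<open>With this \<open>\<sigma>\<close> the quotient
    \<open>(1 / \<tau> + 1) / \<sigma>\<close> equals \<open>s\<close>, so adding 1 to the
    denominator makes it strictly smaller.\<close>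
  have "hausdorff_measure s (unif_set \<tau> \<theta>) = 0" if s: "0 < s" for s
  proof (rule hausdorff_measure_unif_set_eq_0[where \<sigma> = "(1 / \<tau> + 1) / s"])
    show \<sigma>: "0 < (1 / \<tau> + 1) / s" using s assms by (simp add: add_pos_pos)
    have "s * ((1 / \<tau> + 1) / s + 1) = s * ((1 / \<tau> + 1) / s) + s" by (simp only: distrib_left mult_1_right)
    also have "s * ((1 / \<tau> + 1) / s) = 1 / \<tau> + 1" using s by simp
    finally have "1 / \<tau> + 1 < s * ((1 / \<tau> + 1) / s + 1)" using s by linarith
    then show "(1 / \<tau> + 1) / ((1 / \<tau> + 1) / s + 1) < s" using \<sigma> by (simp only: pos_divide_less_eq add_pos_pos zero_less_one)
  qed (use assms in auto)
  then show ?thesis using hausdorff_dim_le[of 0 "unif_set \<tau> \<theta>"] by simp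
qed

section \<open>Letting the auxiliary exponents tend to \<open>w\<close>\<close>

lemma eventually_near_0:
  fixes g :: "real \<Rightarrow> real"
  assumes "(g \<longlongrightarrow> l) (at_right 0)" "l < s" "0 < c"
  obtains h where "0 < h" "h < c" "g h < s"
proof -
  have "\<forall>\<^sub>F h in at_right 0. g h < s \<and> h \<in> {0<..<c}"
    using assms by (intro eventually_conj order_tendstoD(2)[of g l] eventually_at_right_real) auto
  then obtain h where "g h < s \<and> h \<in> {0<..<c}"
    using eventually_happens'[OF trivial_limit_at_right_real] by blast
  then show ?thesis using that by auto
qed

lemma hausdorff_measure_finite_exponent:
  assumes w: "irr_exponent \<theta> = ereal w" "1 < w" and \<tau>: "\<tau> > 0" and s: "(1 / \<tau> + 1) / (w + 1) < s"
  shows "hausdorff_measure s (unif_set \<tau> \<theta>) = 0"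
proof -
  have "((\<lambda>h. (1 / \<tau> + 1) / (w - h + 1)) \<longlongrightarrow> (1 / \<tau> + 1) / (w - 0 + 1)) (at_right 0)"
    using w by (intro tendsto_intros) auto
  then have lim: "((\<lambda>h. (1 / \<tau> + 1) / (w - h + 1)) \<longlongrightarrow> (1 / \<tau> + 1) / (w + 1)) (at_right 0)" by simp
  obtain h where "0 < h" "h < w" "(1 / \<tau> + 1) / (w - h + 1) < s"
    by (rule eventually_near_0[OF lim s less_trans[OF zero_less_one w(2)]])
  then show ?thesis using w \<tau> by (intro hausdorff_measure_unif_set_eq_0[where \<sigma> = "w - h"]) auto
qed

lemma hausdorff_measure_finite_exponent':
  assumes w: "irr_exponent \<theta> = ereal w" and \<tau>: "1 < \<tau>" "\<tau> \<le> w" and s: "(w / \<tau> - 1) / (w\<^sup>2 - 1) < s"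
  shows "hausdorff_measure s (unif_set \<tau> \<theta>) = 0"
proof -
  have w1: "1 < w" using \<tau> by simp
  have w2: "1 < w\<^sup>2" using w1 by (simp add: one_less_power)
  have "0 \<le> (w / \<tau> - 1) / (w\<^sup>2 - 1)" using \<tau> w2 by simp
  then have s0: "s > 0" using s by linarith
  \<comment> \<open>The difference of the two sides of the condition on \<open>s\<close> for
    \<open>u = w + h\<close> and \<open>\<sigma> = w - h\<close>. It is negative at
    \<open>h = 0\<close>, hence also for some small positive \<open>h\<close>.\<close>
  let ?g = "\<lambda>h. (w + h - \<tau>) / ((1 + \<tau>) * (w + h - 1)) - s * \<tau> * (1 + (w - h)) / (1 + \<tau>)"
  have lim: "(?g \<longlongrightarrow> (w + 0 - \<tau>) / ((1 + \<tau>) * (w + 0 - 1)) - s * \<tau> * (1 + (w - 0)) / (1 + \<tau>)) (at_right 0)"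
    using w1 \<tau> by (intro tendsto_intros) auto
  have neg: "(w + 0 - \<tau>) / ((1 + \<tau>) * (w + 0 - 1)) - s * \<tau> * (1 + (w - 0)) / (1 + \<tau>) < 0"
  proof -
    have "(w / \<tau> - 1) < s * (w\<^sup>2 - 1)" using s w2 by (simp add: pos_divide_less_eq)
    then have "(w / \<tau> - 1) * \<tau> < s * (w\<^sup>2 - 1) * \<tau>" using \<tau> by (intro mult_strict_right_mono) auto
    then have "w - \<tau> < (s * \<tau> * (1 + w)) * (w - 1)" using \<tau> by (simp add: algebra_simps power2_eq_square)
    then have "(w - \<tau>) / (w - 1) < s * \<tau> * (1 + w)" using w1 by (simp add: pos_divide_less_eq)
    then have "(w - \<tau>) / (w - 1) / (1 + \<tau>) < s * \<tau> * (1 + w) / (1 + \<tau>)" using \<tau> by (intro divide_strict_right_mono) auto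
    then show ?thesis by (simp add: mult.commute)
  qed
  obtain h where h: "0 < h" "h < w" "?g h < 0"
    by (rule eventually_near_0[OF lim neg less_trans[OF zero_less_one w1]])
  show ?thesis
    by (rule hausdorff_measure_unif_set_eq_0'[where u = "w + h" and \<sigma> = "w - h"]) (use h w \<tau> s0 in auto)
qed

text \<open>Each \<open>h > 0\<close> gives the lower bound \<open>g h\<close> with
  \<open>u = w + h\<close> and \<open>v = w + 2 * h\<close>; the double step keeps \<open>u\<close>
  strictly between \<open>w\<close> and \<open>v\<close>. The claimed value is the limit
  \<open>g 0\<close>.\<close>

lemma hausdorff_dim_finite_exponent_ge:
  assumes w: "irr_exponent \<theta> = ereal w" "1 < w" and \<tau>: "1 / w \<le> \<tau>" "\<tau> \<le> 1"
  shows "(w / \<tau> - 1) / (w\<^sup>2 - 1) \<le> hausdorff_dim (unif_set \<tau> \<theta>)"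
proof -
  have \<tau>0: "0 < \<tau>"
  proof -
    have "0 < 1 / w" using w by simp
    then show ?thesis using \<tau> by linarith
  qed
  have w\<tau>: "1 \<le> \<tau> * w" using \<tau> w by (simp add: pos_divide_le_eq)
  define \<nu> where "\<nu> h = (w + 2 * h - \<tau>) / ((1 + \<tau>) * (w + 2 * h - 1))" for h
  define g where "g h = \<nu> h / (\<nu> h + (w + h) * (1 - \<nu> h))" for h
  \<comment> \<open>This closed form of the denominator of \<open>g 0\<close> lets the factor
    \<open>1 + \<tau>\<close> cancel.\<close>
  have \<nu>0: "\<nu> 0 + (w + 0) * (1 - \<nu> 0) = \<tau> * (w + 1) / (1 + \<tau>)"
  proof -
    have "(w - 1) * \<nu> 0 = (w - \<tau>) / (1 + \<tau>)" using w by (simp add: \<nu>_def)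
    then have "\<nu> 0 + (w + 0) * (1 - \<nu> 0) = w - (w - \<tau>) / (1 + \<tau>)" by (simp add: algebra_simps)
    also have "\<dots> = \<tau> * (w + 1) / (1 + \<tau>)" using \<tau>0 by (simp add: field_simps)
    finally show ?thesis .
  qed
  have g0: "g 0 = (w / \<tau> - 1) / (w\<^sup>2 - 1)"
  proof -
    have "g 0 = ((w - \<tau>) / ((1 + \<tau>) * (w - 1))) / (\<tau> * (w + 1) / (1 + \<tau>))"
      unfolding g_def \<nu>0 by (simp add: \<nu>_def)
    also have "\<dots> = ((1 + \<tau>) * (w - \<tau>)) / ((1 + \<tau>) * (\<tau> * ((w - 1) * (w + 1))))" by (simp add: mult_ac)
    also have "\<dots> = (w - \<tau>) / (\<tau> * ((w - 1) * (w + 1)))" using \<tau>0 by (intro mult_divide_mult_cancel_left) simp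
    also have "(w - 1) * (w + 1) = w\<^sup>2 - 1" by (simp add: algebra_simps power2_eq_square)
    also have "(w - \<tau>) / (\<tau> * (w\<^sup>2 - 1)) = (w / \<tau> - 1) / (w\<^sup>2 - 1)" using \<tau>0 by (simp add: diff_divide_distrib)
    finally show ?thesis .
  qed
  have t\<nu>: "(\<nu> \<longlongrightarrow> \<nu> 0) (at_right 0)" unfolding \<nu>_def
    using w \<tau>0 by (intro tendsto_intros) auto
  have "(g \<longlongrightarrow> g 0) (at_right 0)" unfolding g_def
    using \<tau>0 w \<nu>0 by (intro tendsto_intros t\<nu>) auto
  moreover have "\<forall>\<^sub>F h in at_right 0. g h \<le> hausdorff_dim (unif_set \<tau> \<theta>)"
    using eventually_at_right_less[of 0]
  proof eventually_elim
    case (elim h)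
    have "1 \<le> \<tau> * (w + 2 * h)" using w\<tau> elim \<tau>0 by (simp add: distrib_left add_increasing2)
    then have \<nu>: "0 < \<nu> h" "\<nu> h \<le> 1"
      using \<tau>0 \<tau> w elim by (simp_all add: \<nu>_def divide_le_eq algebra_simps)
    have "0 < \<nu> h + (w + h) * (1 - \<nu> h)" using \<nu> w elim by (intro add_pos_nonneg) auto
    then have le: "s * (\<nu> h + (w + h) * (1 - \<nu> h)) \<le> \<nu> h" if "s \<le> g h" for s
      using that by (simp add: g_def pos_le_divide_eq)
    have adm: "\<forall>\<^sub>F n in sequentially. \<exists>M W. admissible \<tau> (\<nu> h) n M W"
      unfolding \<nu>_def
      by (rule eventually_admissible[where u = "w + h"]) (use \<tau>0 \<tau> w elim \<open>1 \<le> \<tau> * (w + 2 * h)\<close> in auto)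
    define t where "t = (1 / \<tau> + 1) / (w + 1) + 1"
    have t: "(1 / \<tau> + 1) / (w + 1) < t" "t > 0" using \<tau>0 w by (auto simp: t_def add_nonneg_pos)
    show ?case
    proof (rule hausdorff_dim_ge[OF t(2)])
      show "hausdorff_measure t (unif_set \<tau> \<theta>) = 0" by (rule hausdorff_measure_finite_exponent[OF w \<tau>0 t(1)])
      fix s :: real assume "0 < s" "s \<le> g h"
      then show "hausdorff_measure s (unif_set \<tau> \<theta>) \<noteq> 0"
        using \<tau> \<nu> w elim le adm by (intro hausdorff_measure_unif_set_neq_0[where \<nu> = "\<nu> h" and u = "w + h"]) auto
    qed
  qed
  ultimately have "g 0 \<le> hausdorff_dim (unif_set \<tau> \<theta>)"
    by (rule tendsto_upperbound) simp
  then show ?thesis by (simp add: g0)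
qed

end

theorem theorem3:
  fixes \<theta> :: real
  assumes "0 < \<theta>" "\<theta> < 1" "\<theta> \<notin> \<rat>"
    and "irr_exponent \<theta> > 1"
  shows "(\<forall>w::real. irr_exponent \<theta> = ereal w \<longrightarrow>
            (\<forall>\<tau>. 1 / w \<le> \<tau> \<and> \<tau> \<le> 1 \<longrightarrow>
               (w / \<tau> - 1) / (w\<^sup>2 - 1) \<le> hausdorff_dim (unif_set \<tau> \<theta>) \<and>
               hausdorff_dim (unif_set \<tau> \<theta>) \<le> (1 / \<tau> + 1) / (w + 1)) \<and>
            (\<forall>\<tau>. 1 < \<tau> \<and> \<tau> \<le> w \<longrightarrow>
               0 \<le> hausdorff_dim (unif_set \<tau> \<theta>) \<and>
               hausdorff_dim (unif_set \<tau> \<theta>) \<le> (w / \<tau> - 1) / (w\<^sup>2 - 1)))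
       \<and> (irr_exponent \<theta> = \<infinity> \<longrightarrow> (\<forall>\<tau>>0. hausdorff_dim (unif_set \<tau> \<theta>) = 0))"
proof -
  interpret irrational_rotation \<theta> by unfold_locales (use assms in auto)
  show ?thesis
  proof (intro conjI allI impI)
    fix w \<tau> assume w: "irr_exponent \<theta> = ereal w" and \<tau>: "1 / w \<le> \<tau> \<and> \<tau> \<le> 1"
    have w1: "1 < w" using w assms(4) by simp
    then have "0 < 1 / w" by simp
    then have \<tau>0: "0 < \<tau>" using \<tau> by linarith
    show "(w / \<tau> - 1) / (w\<^sup>2 - 1) \<le> hausdorff_dim (unif_set \<tau> \<theta>)"
      using hausdorff_dim_finite_exponent_ge[OF w w1] \<tau> by blast
    show "hausdorff_dim (unif_set \<tau> \<theta>) \<le> (1 / \<tau> + 1) / (w + 1)"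
      using \<tau>0 w1 hausdorff_measure_finite_exponent[OF w w1 \<tau>0] by (intro hausdorff_dim_le) auto
  next
    fix w \<tau> assume w: "irr_exponent \<theta> = ereal w" and \<tau>: "1 < \<tau> \<and> \<tau> \<le> w"
    have "1 < w\<^sup>2" using \<tau> by (simp add: one_less_power)
    then have "0 \<le> (w / \<tau> - 1) / (w\<^sup>2 - 1)" using \<tau> by simp
    then show "0 \<le> hausdorff_dim (unif_set \<tau> \<theta>)"
      "hausdorff_dim (unif_set \<tau> \<theta>) \<le> (w / \<tau> - 1) / (w\<^sup>2 - 1)"
      using hausdorff_measure_finite_exponent'[OF w] \<tau> hausdorff_dim_le[of "(w / \<tau> - 1) / (w\<^sup>2 - 1)"]
      by blast+
  next
    fix \<tau> :: real assume "irr_exponent \<theta> = \<infinity>" "0 < \<tau>"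
    then show "hausdorff_dim (unif_set \<tau> \<theta>) = 0" by (rule hausdorff_dim_infinite_exponent)
  qed
qed

end
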